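(* Let $n\ge 2$, let $\mathfrak g_n$ be a simple complex Lie algebra of type $B_n$ and let $\mathfrak b_n$ be a Borel subalgebra of $\mathfrak g_n$. The number of $B_n$-paths, hence also the number of ad-nilpotent ideals in $\mathfrak b_n$, equals $\binom{2n}{n}$.
   Context: An ideal $\mathfrak i$ of $\mathfrak b_n$ is called ad-nilpotent if the adjoint action on $\mathfrak b_n$ of each element of $\mathfrak i$ is nilpotent. A $B_n$-path is a word of length $2n$ on the alphabet $\{r,f\}$ such that each prefix of the word contains at least as many $r$'s as $f$'s. *)

theory Defs
  imports Complex_Main "HOL-Library.Sublist"
begin

datatype letter = Rise | Fall

definition B_path :: "nat \<Rightarrow> letter list \<Rightarrow> bool" where
  "B_path n w \<longleftrightarrow>
     length w = 2 * n \<and> (\<forall>p. prefix p w \<longrightarrow> count_list p Fall \<le> count_list p Rise)"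

(* The Lie algebra is the whole type 'g; subalgebras, ideals, ... are sets. *)
locale complex_lie_algebra = vector_space scale
  for scale :: "complex \<Rightarrow> 'g::ab_group_add \<Rightarrow> 'g" (infixr "*s" 75) +
  fixes bracket :: "'g \<Rightarrow> 'g \<Rightarrow> 'g"
  assumes bracket_add_left: "bracket (x + y) z = bracket x z + bracket y z"
    and bracket_add_right: "bracket x (y + z) = bracket x y + bracket x z"
    and bracket_scale_left: "bracket (c *s x) y = c *s bracket x y"
    and bracket_scale_right: "bracket x (c *s y) = c *s bracket x y"
    and bracket_self: "bracket x x = 0"
    and jacobi: "bracket x (bracket y z) + bracket y (bracket z x) + bracket z (bracket x y) = 0"
begin

definition bracket_span :: "'g set \<Rightarrow> 'g set \<Rightarrow> 'g set" where
  "bracket_span A B = span {bracket x y | x y. x \<in> A \<and> y \<in> B}"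

definition lie_subalgebra :: "'g set \<Rightarrow> bool" where
  "lie_subalgebra S \<longleftrightarrow> subspace S \<and> (\<forall>x\<in>S. \<forall>y\<in>S. bracket x y \<in> S)"

definition lie_ideal :: "'g set \<Rightarrow> 'g set \<Rightarrow> bool" where
  "lie_ideal S I \<longleftrightarrow> subspace I \<and> I \<subseteq> S \<and> (\<forall>x\<in>S. \<forall>y\<in>I. bracket x y \<in> I)"

definition finite_dim :: bool where
  "finite_dim \<longleftrightarrow> (\<exists>B. finite B \<and> span B = UNIV)"

definition simple_lie_algebra :: bool where
  "simple_lie_algebra \<longleftrightarrow>
     finite_dim \<and> (\<exists>x y. bracket x y \<noteq> 0) \<and>
     (\<forall>I. lie_ideal UNIV I \<longrightarrow> I = {0} \<or> I = UNIV)"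

primrec derived_series :: "'g set \<Rightarrow> nat \<Rightarrow> 'g set" where
  "derived_series S 0 = S"
| "derived_series S (Suc k) = bracket_span (derived_series S k) (derived_series S k)"

definition solvable :: "'g set \<Rightarrow> bool" where
  "solvable S \<longleftrightarrow> (\<exists>k. derived_series S k = {0})"

definition borel_subalgebra :: "'g set \<Rightarrow> bool" where
  "borel_subalgebra b \<longleftrightarrow>
     lie_subalgebra b \<and> solvable b \<and>
     (\<forall>S. lie_subalgebra S \<and> solvable S \<and> b \<subseteq> S \<longrightarrow> S = b)"

definition ad_nilpotent_ideal :: "'g set \<Rightarrow> 'g set \<Rightarrow> bool" where
  "ad_nilpotent_ideal b I \<longleftrightarrow>
     lie_ideal b I \<and> (\<forall>x\<in>I. \<exists>k. \<forall>y\<in>b. (bracket x ^^ k) y = 0)"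

(* The usual definition for semisimple algebras: h is abelian, equal to its own
   centralizer, and acts by diagonalizable operators. *)
definition cartan_subalgebra :: "'g set \<Rightarrow> bool" where
  "cartan_subalgebra h \<longleftrightarrow>
     subspace h \<and>
     (\<forall>H\<in>h. \<forall>K\<in>h. bracket H K = 0) \<and>
     (\<forall>x. (\<forall>H\<in>h. bracket H x = 0) \<longrightarrow> x \<in> h) \<and>
     (\<forall>H\<in>h. span {x. \<exists>c. bracket H x = c *s x} = UNIV)"

(* Elements of the dual of h are represented by functions on 'g of which only the
   values on h matter. *)
definition root_space :: "'g set \<Rightarrow> ('g \<Rightarrow> complex) \<Rightarrow> 'g set" where
  "root_space h \<alpha> = {x. \<forall>H\<in>h. bracket H x = \<alpha> H *s x}"

(* A nonzero x in the root space forces \<alpha> to be linear on h. *)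
definition is_root :: "'g set \<Rightarrow> ('g \<Rightarrow> complex) \<Rightarrow> bool" where
  "is_root h \<alpha> \<longleftrightarrow> (\<exists>H\<in>h. \<alpha> H \<noteq> 0) \<and> (\<exists>x\<in>root_space h \<alpha>. x \<noteq> 0)"

definition is_base :: "'g set \<Rightarrow> nat \<Rightarrow> (nat \<Rightarrow> 'g \<Rightarrow> complex) \<Rightarrow> bool" where
  "is_base h n \<alpha> \<longleftrightarrow>
     (\<forall>i\<in>{1..n}. is_root h (\<alpha> i)) \<and>
     (\<forall>c :: nat \<Rightarrow> complex.
        (\<forall>H\<in>h. (\<Sum>i=1..n. c i * \<alpha> i H) = 0) \<longrightarrow> (\<forall>i\<in>{1..n}. c i = 0)) \<and>
     (\<forall>\<beta>. is_root h \<beta> \<longrightarrow>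
        (\<exists>c :: nat \<Rightarrow> int.
           ((\<forall>i\<in>{1..n}. c i \<ge> 0) \<or> (\<forall>i\<in>{1..n}. c i \<le> 0)) \<and>
           (\<forall>H\<in>h. \<beta> H = (\<Sum>i=1..n. of_int (c i) * \<alpha> i H))))"

(* The coroot of \<alpha>: the element H of [g_\<alpha>, g_{-\<alpha>}] with \<alpha>(H) = 2, so that
   \<beta>(H) is the Cartan integer 2(\<beta>,\<alpha>)/(\<alpha>,\<alpha>). *)
definition is_coroot :: "'g set \<Rightarrow> ('g \<Rightarrow> complex) \<Rightarrow> 'g \<Rightarrow> bool" where
  "is_coroot h \<alpha> H \<longleftrightarrow>
     H \<in> bracket_span (root_space h \<alpha>) (root_space h (\<lambda>K. - \<alpha> K)) \<and> \<alpha> H = 2"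

end

(* Bourbaki's numbering: the last simple root is the short one, and the (i,j) entry is
   2(\<alpha>_i,\<alpha>_j)/(\<alpha>_j,\<alpha>_j). *)
definition cartan_matrix_B :: "nat \<Rightarrow> nat \<Rightarrow> nat \<Rightarrow> int" where
  "cartan_matrix_B n i j =
     (if i = j then 2
      else if Suc i = n \<and> j = n then -2
      else if Suc i = j \<or> Suc j = i then -1
      else 0)"

definition (in complex_lie_algebra) type_B :: "nat \<Rightarrow> bool" where
  "type_B n \<longleftrightarrow>
     (\<exists>h \<alpha> H. cartan_subalgebra h \<and> is_base h n \<alpha> \<and>
        (\<forall>j\<in>{1..n}. is_coroot h (\<alpha> j) (H j)) \<and>
        (\<forall>i\<in>{1..n}. \<forall>j\<in>{1..n}. \<alpha> i (H j) = of_int (cartan_matrix_B n i j)))"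

end

theory Submission
  imports Defs "HOL-Computational_Algebra.Fundamental_Theorem_Algebra" "HOL-Library.Function_Algebras"
begin

text \<open>
  A Lie algebra $g$ of type $B_n$ is identified with the orthogonal Lie algebra $so(2n+1)$ by an argument of Kac:
  let $L$ be the subalgebra of the direct sum of $g$ and $so(2n+1)$ generated by the pairs of Chevalley generators. Its
  triangular decomposition shows that its torus is the span of the pairs of simple coroots, so the kernels of
  its two projections, being ideals, would have to meet this torus if they were nonzero; hence $L$ is the graph of
  an isomorphism. That $g$ is generated by its Chevalley generators follows from $sl_2$ theory in the quotient
  by a stable subspace, because a nonzero nonnegative combination of simple roots is positive on some simple coroot.

  A solvable subalgebra of $so(2n+1)$ stabilises an isotropic line by Lie's theorem; by induction it is conjugate
  under the orthogonal group to a subalgebra of the upper triangular matrices. So every Borel subalgebra becomes the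
  upper triangular one, without any appeal to the conjugacy theorem. Its ad-nilpotent ideals are spanned by root
  vectors. In row $-r$ the roots of an ideal form a final segment of length $d_r \<le> 2r-1$, and
  $d_r < d_{r+1}$ as soon as $d_r > 0$. Those sequences are counted by a Pascal type recursion, and
  the $B_n$-paths by the ballot numbers.
\<close>

section \<open>Eigenvectors\<close>

text \<open>The hypotheses fix g only through a Cartan matrix, so nothing relates it to matrices
  before the generators of both algebras are paired. The torus of L is controlled by one element K
  of h with \<alpha>_i(K) = 1 for all i: it grades the negative part, the torus and the positive
  part by negative, zero and positive integers, so no nonzero element of h hides in the two outer
  parts. Simplicity is assumed of g; for so(2n+1) its effect comes from one diagonal matrix whose
  weights separate all roots.

  Traces, the Killing form and the Weyl group do not enter. Linear dependence in an infinite family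
  of vectors takes their place, in Lie's theorem as well as in the sl2 arguments.

  Row -r of the upper triangle has the 2r - 1 columns of absolute value below r, whence the bound on
  d_r. The next row up inherits the columns of the ideal and, one step to the right, gains column r,
  whence the strict growth. Shapes with last entry at most e are counted by the entries e - n, ...,
  n of row e of Pascal's triangle, a single one for e = 2n.\<close>

locale field_vector_space = vector_space scale
  for scale :: "'a::field \<Rightarrow> 'b::ab_group_add \<Rightarrow> 'b" (infixr "*s" 75)
begin

definition linop :: "('b \<Rightarrow> 'b) \<Rightarrow> bool" where
  "linop T \<longleftrightarrow> (\<forall>x y. T (x + y) = T x + T y) \<and> (\<forall>c x. T (c *s x) = c *s T x)"

lemma linop_add: "linop T \<Longrightarrow> T (x + y) = T x + T y"
  by (simp add: linop_def)

lemma linop_scale: "linop T \<Longrightarrow> T (c *s x) = c *s T x"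
  by (simp add: linop_def)

lemma linop_0: "linop T \<Longrightarrow> T 0 = 0"
  using linop_scale[of T 0 0] by simp

lemma linop_diff: "linop T \<Longrightarrow> T (x - y) = T x - T y"
  by (metis add_diff_cancel diff_add_cancel linop_add)

lemma linop_sum: "linop T \<Longrightarrow> T (\<Sum>a\<in>A. f a) = (\<Sum>a\<in>A. T (f a))"
  by (induction A rule: infinite_finite_induct) (auto simp: linop_0 linop_add)

lemma linop_span_mem:
  assumes "linop T" "x \<in> span S" "\<And>y. y \<in> S \<Longrightarrow> T y \<in> U" "subspace U"
  shows "T x \<in> U"
  using assms(2)
proof (induction rule: span_induct_alt)
  case base
  then show ?case using assms by (simp add: linop_0 subspace_0)
next
  case (step c x y)
  then show ?case using assms by (simp add: linop_add linop_scale subspace_add subspace_scale)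
qed

lemma scale_mem_cancel: "subspace U \<Longrightarrow> c *s x \<in> U \<Longrightarrow> c \<noteq> 0 \<Longrightarrow> x \<in> U"
  using subspace_scale[of U "c *s x" "inverse c"] by simp

text \<open>Applying T - w b removes the summand \<open>v b\<close> and multiplies every other
  \<open>v a\<close> by w a - w b, which is nonzero; induction on \<open>A\<close> does the rest.
  For U = {0} this is the independence of eigenvectors, and for general U the same statement in the
  quotient.\<close>

lemma eigen_sum_mem:
  assumes T: "linop T" and U: "subspace U" "\<And>x. x \<in> U \<Longrightarrow> T x \<in> U"
    and "finite A" "inj_on w A" "\<And>a. a \<in> A \<Longrightarrow> T (v a) = w a *s v a"
    and "(\<Sum>a\<in>A. v a) \<in> U"
  shows "\<forall>a\<in>A. v a \<in> U"
  using assms(4-)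
proof (induction A arbitrary: v rule: finite_induct)
  case (insert b A)
  have "T (\<Sum>a\<in>insert b A. v a) - w b *s (\<Sum>a\<in>insert b A. v a) \<in> U"
    using insert U by (intro subspace_diff subspace_scale) auto
  moreover have "T (\<Sum>a\<in>insert b A. v a) - w b *s (\<Sum>a\<in>insert b A. v a)
      = (\<Sum>a\<in>A. (w a - w b) *s v a)"
    using insert
    by (simp add: linop_sum[OF T] linop_add[OF T] scale_right_distrib scale_sum_right
        scale_left_diff_distrib sum_subtractf)
  ultimately have "\<forall>a\<in>A. (w a - w b) *s v a \<in> U"
    using insert.prems insert.IH[of "\<lambda>a. (w a - w b) *s v a"]
    by (simp add: linop_scale[OF T] mult.commute)
  moreover have "w a - w b \<noteq> 0" if "a \<in> A" for a
    using insert.prems(1) insert.hyps(2) that by (metis eq_iff_diff_eq_0 inj_onD insertCI)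
  ultimately have A: "\<forall>a\<in>A. v a \<in> U"
    using scale_mem_cancel[OF U(1)] by blast
  moreover have "v b = (\<Sum>a\<in>insert b A. v a) - (\<Sum>a\<in>A. v a)"
    using insert by simp
  then have "v b \<in> U"
    using A insert.prems U(1) by (metis subspace_diff subspace_sum)
  ultimately show ?case by blast
qed simp

text \<open>Eigenvectors with a common eigenvalue are collected into one term, so that the sum over
  \<open>F\<close> has the distinct eigenvalues which \<open>eigen_sum_mem\<close> asks for.\<close>

lemma eigen_span:
  assumes T: "linop T" and x: "x \<in> span {y. \<exists>m\<in>M. T y = m *s y}"
  shows "\<exists>F v. finite F \<and> F \<subseteq> M \<and> x = (\<Sum>m\<in>F. v m) \<and> (\<forall>m. T (v m) = m *s v m)"
proof -
  \<comment> \<open>The extra clause that \<open>v\<close> vanishes off \<open>F\<close> allows a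
    vector with a new eigenvalue to be added to \<open>v m\<close> in the same way as one with an
    old eigenvalue.\<close>
  have "\<exists>F v. finite F \<and> F \<subseteq> M \<and> x = (\<Sum>m\<in>F. v m) \<and> (\<forall>m. T (v m) = m *s v m) \<and> (\<forall>m. m \<notin> F \<longrightarrow> v m = 0)"
    using x
  proof (induction rule: span_induct_alt)
    case base
    show ?case by (rule exI[of _ "{}"], rule exI[of _ "\<lambda>_. 0"]) (simp add: linop_0[OF T])
  next
    case (step c y x)
    then obtain F v m where *: "finite F" "F \<subseteq> M" "x = (\<Sum>m\<in>F. v m)" "\<forall>m. T (v m) = m *s v m"
      "m \<in> M" "T y = m *s y" "\<forall>m. m \<notin> F \<longrightarrow> v m = 0" by auto
    let ?v = "v(m := v m + c *s y)"
    have "(\<Sum>k\<in>insert m F. ?v k) = v m + c *s y + (\<Sum>k\<in>F - {m}. v k)"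
      using * by (simp add: sum.insert_remove)
    also have "v m + (\<Sum>k\<in>F - {m}. v k) = x"
      using * by (cases "m \<in> F") (auto simp: sum.remove)
    then have "v m + c *s y + (\<Sum>k\<in>F - {m}. v k) = c *s y + x"
      by (simp add: algebra_simps)
    finally show ?case
      using * by (intro exI[of _ "insert m F"] exI[of _ ?v])
        (auto simp: linop_add[OF T] linop_scale[OF T] scale_right_distrib mult.commute)
  qed
  then show ?thesis by blast
qed

text \<open>The family may repeat a vector, and then the relation is v i - v j = 0; otherwise its
  first \<open>card B\<close> + 1 members form a set too large to be independent.\<close>

lemma family_dependent:
  fixes v :: "nat \<Rightarrow> 'b"
  assumes "finite B" "\<And>k. v k \<in> span B"
  obtains N c where "(\<Sum>k<N. c k *s v k) = 0" "\<exists>k<N. c k \<noteq> 0"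
proof (cases "inj_on v {..card B}")
  case False
  then obtain i j where ij: "i \<le> card B" "j \<le> card B" "i \<noteq> j" "v i = v j"
    by (auto simp: inj_on_def)
  let ?c = "\<lambda>k. if k = i then 1 else if k = j then -1 else (0::'a)"
  have "(\<Sum>k<Suc (card B). ?c k *s v k) = (\<Sum>k\<in>{i,j}. ?c k *s v k)"
    using ij by (intro sum.mono_neutral_right) auto
  also have "\<dots> = 0" using ij by simp
  finally have "(\<Sum>k<Suc (card B). ?c k *s v k) = 0" .
  moreover have "\<exists>k<Suc (card B). ?c k \<noteq> 0"
    using ij by (intro exI[of _ i]) simp
  ultimately show thesis by (rule that)
next
  case True
  then have "card (v ` {..card B}) = Suc (card B)" by (simp add: card_image)
  moreover have "v ` {..card B} \<subseteq> span B" using assms by auto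
  ultimately have "dependent (v ` {..card B})"
    using independent_span_bound[OF assms(1), of "v ` {..card B}"] by auto
  then obtain t u where t: "finite t" "t \<subseteq> v ` {..card B}" "(\<Sum>x\<in>t. u x *s x) = 0" "\<exists>x\<in>t. u x \<noteq> 0"
    by (auto simp: dependent_explicit)
  let ?c = "\<lambda>k. if v k \<in> t then u (v k) else 0"
  have "(\<Sum>k<Suc (card B). ?c k *s v k) = (\<Sum>x\<in>v ` {..card B}. (if x \<in> t then u x else 0) *s x)"
    using True by (subst sum.reindex) (auto simp: lessThan_Suc_atMost)
  also have "\<dots> = (\<Sum>x\<in>t. u x *s x)"
    using t by (intro sum.mono_neutral_cong_right) auto
  finally have "(\<Sum>k<Suc (card B). ?c k *s v k) = 0" using t by simp
  moreover have "\<exists>k<Suc (card B). ?c k \<noteq> 0"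
    using t by (auto simp: less_Suc_eq_le)
  ultimately show thesis by (rule that)
qed

text \<open>This is how finite dimension stops a string of weight vectors: infinitely many
  eigenvectors with distinct eigenvalues satisfy a linear relation, and by
  \<open>eigen_sum_mem\<close> each term of the relation lies in U.\<close>

lemma eigen_family_mem:
  fixes v :: "nat \<Rightarrow> 'b"
  assumes T: "linop T" and U: "subspace U" "\<And>x. x \<in> U \<Longrightarrow> T x \<in> U"
    and B: "finite B" "\<And>k. v k \<in> span B"
    and w: "inj w" "\<And>k. T (v k) = w k *s v k"
  shows "\<exists>k. v k \<in> U"
proof -
  obtain N c where c: "(\<Sum>k<N. c k *s v k) = 0" "\<exists>k<N. c k \<noteq> 0"
    using family_dependent[of B v, OF B] by metis
  have "\<forall>k\<in>{..<N}. c k *s v k \<in> U"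
    using w c U(1)
    by (intro eigen_sum_mem[OF T U, where w=w])
       (auto simp: linop_scale[OF T] mult.commute subspace_0 intro: inj_on_subset[OF w(1)])
  with c obtain k where "c k *s v k \<in> U" "c k \<noteq> 0" by auto
  then show ?thesis using scale_mem_cancel[OF U(1)] by blast
qed

text \<open>The last nonzero coefficient of a relation expresses one vector through its
  predecessors; \<open>p\<close> is the first index at which this happens.\<close>

lemma family_minimal:
  fixes v :: "nat \<Rightarrow> 'b"
  assumes "finite B" "\<And>k. v k \<in> span B"
  obtains p where "v p \<in> span (v ` {..<p})" "\<And>k. k < p \<Longrightarrow> v k \<notin> span (v ` {..<k})"
proof -
  obtain N c where c: "(\<Sum>k<N. c k *s v k) = 0" "\<exists>k<N. c k \<noteq> 0"
    using family_dependent[of B v, OF assms] by metis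
  define q where "q = Max {k. k < N \<and> c k \<noteq> 0}"
  have q: "q < N" "c q \<noteq> 0" and qmax: "\<And>k. k < N \<Longrightarrow> c k \<noteq> 0 \<Longrightarrow> k \<le> q"
    using Max_in[of "{k. k < N \<and> c k \<noteq> 0}"] c(2) by (auto simp: q_def)
  have "(\<Sum>k<N. c k *s v k) = (\<Sum>k<Suc q. c k *s v k)"
    using q qmax by (intro sum.mono_neutral_right) (auto, metis Suc_le_lessD leD)
  then have "c q *s v q = - (\<Sum>k<q. c k *s v k)"
    using c by (simp add: eq_neg_iff_add_eq_0 add.commute)
  then have "c q *s v q \<in> span (v ` {..<q})"
    by (simp only:) (intro span_neg span_sum span_scale, auto intro: span_base)
  then have "v q \<in> span (v ` {..<q})"
    using q(2) scale_mem_cancel[OF subspace_span] by blast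
  then have "v (LEAST p. v p \<in> span (v ` {..<p})) \<in> span (v ` {..<(LEAST p. v p \<in> span (v ` {..<p}))})"
    by (rule LeastI)
  then show thesis using not_less_Least by (rule that)
qed

(* If [Y, X] acts like the scalar -mu modulo lower powers on the cyclic space of w, then mu = 0.
   This replaces the usual argument "the trace of a commutator vanishes". *)
lemma cyclic_commutator_zero:
  assumes X: "linop X" and Y: "linop Y" and B: "finite B" "\<And>k. (X ^^ k) w \<in> span B"
    and "w \<noteq> 0" and Y0: "Y w = l *s w"
    and YX: "\<And>k. Y ((X ^^ Suc k) w) - l *s (X ^^ Suc k) w + (of_nat (Suc k) * m) *s (X ^^ k) w
       \<in> span ((\<lambda>i. (X ^^ i) w) ` {..<k})"
    and char0: "\<And>k. of_nat (Suc k) \<noteq> (0::'a)"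
  shows "m = 0"
proof (rule ccontr)
  assume "m \<noteq> 0"
  let ?v = "\<lambda>i. (X ^^ i) w"
  obtain p where p: "?v p \<in> span (?v ` {..<p})" "\<And>k. k < p \<Longrightarrow> ?v k \<notin> span (?v ` {..<k})"
    using family_minimal[of B ?v, OF B] by metis
  with \<open>w \<noteq> 0\<close> have "p \<noteq> 0" by (intro notI) simp
  then obtain q where q: "p = Suc q" by (cases p) auto
  have mono: "span (?v ` {..<i}) \<subseteq> span (?v ` {..<j})" if "i \<le> j" for i j
    using that by (intro span_mono) auto
  have A: "Y (?v k) - l *s ?v k \<in> span (?v ` {..<k})" for k
  proof (cases k)
    case 0 then show ?thesis by (simp add: Y0)
  next
    case (Suc j)
    have "Y (?v k) - l *s ?v k + (of_nat (Suc j) * m) *s ?v j \<in> span (?v ` {..<k})"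
      using YX[of j] mono[of j k] Suc by auto
    moreover have "(of_nat (Suc j) * m) *s ?v j \<in> span (?v ` {..<k})"
      using Suc by (intro span_scale span_base) auto
    ultimately show ?thesis by (metis add_diff_cancel span_diff)
  qed
  \<comment> \<open>\<open>Z\<close> lowers the degree by one. Since \<open>v p\<close> is a
    combination of earlier vectors, \<open>Z\<close> sends it into the span of the vectors below q =
    p - 1, whereas by \<open>YX\<close> the image has the component -(q + 1) m along
    \<open>v q\<close>. Minimality of p leaves only m = 0.\<close>
  define Z where "Z = (\<lambda>x. Y x - l *s x)"
  have Z: "linop Z" using Y by (auto simp: linop_def Z_def algebra_simps)
  have "Z (?v (Suc q)) \<in> span (?v ` {..<q})"
  proof (rule linop_span_mem[OF Z])
    show "?v (Suc q) \<in> span (?v ` {..<p})" using p q by simp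
    fix y assume "y \<in> ?v ` {..<p}"
    then obtain k where "k \<le> q" "y = ?v k" using q by (auto simp: less_Suc_eq_le)
    then show "Z y \<in> span (?v ` {..<q})" using A[of k] mono[of k q] by (auto simp: Z_def)
  qed simp
  with YX[of q] have "(of_nat (Suc q) * m) *s ?v q \<in> span (?v ` {..<q})"
    unfolding Z_def by (metis add_diff_cancel_left' span_diff)
  moreover have "of_nat (Suc q) * m \<noteq> 0" using \<open>m \<noteq> 0\<close> char0[of q] by simp
  ultimately have "?v q \<in> span (?v ` {..<q})"
    using scale_mem_cancel[OF subspace_span] by blast
  with p q show False by simp
qed

end

text \<open>If q(T) v = 0 and q = (X - z) r, then r(T) v is either an eigenvector for z or zero; in
  the second case r, of smaller degree, takes the place of q.\<close>

lemma (in field_vector_space) eigenvector_exists_aux: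
  assumes T: "linop T" and alg: "\<And>q :: 'a poly. degree q > 0 \<Longrightarrow> \<exists>z. poly q z = 0"
    and C: "subspace C" "\<And>x. x \<in> C \<Longrightarrow> T x \<in> C"
  shows "q \<noteq> 0 \<Longrightarrow> v \<in> C \<Longrightarrow> v \<noteq> 0 \<Longrightarrow> (\<Sum>i\<le>degree q. coeff q i *s (T ^^ i) v) = 0
     \<Longrightarrow> \<exists>u\<in>C. u \<noteq> 0 \<and> (\<exists>c. T u = c *s u)"
proof (induction "degree q" arbitrary: q rule: less_induct)
  case less
  show ?case
  proof (cases "degree q = 0")
    case True
    with less.prems have "coeff q 0 \<noteq> 0" by (metis leading_coeff_0_iff)
    with less.prems True show ?thesis by simp
  next
    case False
    then obtain z where "poly q z = 0" using alg by auto
    then obtain r where r: "q = [:-z, 1:] * r" by (metis dvdE poly_eq_0_iff_dvd)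
    with less.prems have "r \<noteq> 0" by auto
    then have deg: "degree q = Suc (degree r)" unfolding r by (subst degree_mult_eq) auto
    define u where "u = (\<Sum>i\<le>degree r. coeff r i *s (T ^^ i) v)"
    have "coeff q i *s (T ^^ i) v = (if i = 0 then 0 else coeff r (i-1) *s (T ^^ i) v) - z *s (coeff r i *s (T ^^ i) v)" for i
      unfolding r by (cases i) (auto simp: scale_left_distrib scale_left_diff_distrib)
    then have "(\<Sum>i\<le>Suc (degree r). coeff q i *s (T ^^ i) v)
      = (\<Sum>i\<le>Suc (degree r). if i = 0 then 0 else coeff r (i-1) *s (T ^^ i) v)
       - z *s (\<Sum>i\<le>Suc (degree r). coeff r i *s (T ^^ i) v)"
      by (simp only: sum_subtractf scale_sum_right)
    also have "(\<Sum>i\<le>Suc (degree r). if i = 0 then 0 else coeff r (i-1) *s (T ^^ i) v)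
        = (\<Sum>i\<le>degree r. coeff r i *s (T ^^ Suc i) v)"
      by (subst sum.atMost_Suc_shift) simp
    also have "\<dots> = T u"
      by (simp add: u_def linop_sum[OF T] linop_scale[OF T])
    also have "(\<Sum>i\<le>Suc (degree r). coeff r i *s (T ^^ i) v) = u"
      by (simp add: u_def coeff_eq_0)
    finally have *: "T u = z *s u"
      using less.prems(4) deg by simp
    have TC: "(T ^^ i) v \<in> C" for i by (induction i) (auto simp: less.prems C)
    have "u \<in> C" unfolding u_def using C TC by (intro subspace_sum subspace_scale) auto
    show ?thesis
    proof (cases "u = 0")
      case True
      then show ?thesis using less.hyps[of r] deg \<open>r \<noteq> 0\<close> less.prems u_def by auto
    next
      case False
      then show ?thesis using * \<open>u \<in> C\<close> by blast
    qed
  qed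
qed

lemma complex_eigenvector_exists:
  fixes scale :: "complex \<Rightarrow> 'v::ab_group_add \<Rightarrow> 'v"
  assumes "field_vector_space scale" "field_vector_space.linop scale T"
    and "module.subspace scale C" "\<And>x. x \<in> C \<Longrightarrow> T x \<in> C"
    and "finite B" "C \<subseteq> module.span scale B" "v \<in> C" "v \<noteq> 0"
  shows "\<exists>u\<in>C. u \<noteq> 0 \<and> (\<exists>c. T u = scale c u)"
proof -
  interpret field_vector_space scale by fact
  have TC: "(T ^^ i) v \<in> C" for i by (induction i) (auto simp: assms)
  then obtain N c where c: "(\<Sum>k<N. scale (c k) ((T ^^ k) v)) = 0" "\<exists>k<N. c k \<noteq> 0"
    using family_dependent[OF assms(5), of "\<lambda>i. (T ^^ i) v"] assms(6) by (metis subsetD)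
  define q where "q = (\<Sum>k<N. monom (c k) k)"
  have cq: "coeff q i = (if i < N then c i else 0)" for i
    by (auto simp: q_def coeff_sum if_distrib cong: if_cong)
  with c have "q \<noteq> 0" by (metis coeff_0)
  have "(\<Sum>i\<le>degree q. scale (coeff q i) ((T ^^ i) v)) = (\<Sum>i\<in>{..<N} \<union> {..degree q}. scale (coeff q i) ((T ^^ i) v))"
    by (intro sum.mono_neutral_left) (auto simp: coeff_eq_0)
  also have "\<dots> = (\<Sum>i<N. scale (c i) ((T ^^ i) v))"
    by (rule sum.mono_neutral_cong_right) (auto simp: cq)
  finally have "(\<Sum>i\<le>degree q. scale (coeff q i) ((T ^^ i) v)) = 0" using c by simp
  moreover have "\<exists>z. poly q z = 0" if "degree q > 0" for q :: "complex poly"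
    using fundamental_theorem_of_algebra[of q] that by (metis constant_degree neq0_conv)
  ultimately show ?thesis
    using eigenvector_exists_aux[of T C q v] assms \<open>q \<noteq> 0\<close> by blast
qed

text \<open>Unless the whole family acts on C by scalars, some T has an eigenspace in C that is
  proper, nonzero and stable under the family. \<open>N\<close> bounds the size of independent
  subsets of C; it drops because a vector y outside the eigenspace enlarges every independent subset
  of it.\<close>

lemma commuting_common_eigenvector:
  fixes scale :: "complex \<Rightarrow> 'v::ab_group_add \<Rightarrow> 'v"
  assumes "field_vector_space scale" "finite B"
    and lin: "\<And>T. T \<in> \<T> \<Longrightarrow> field_vector_space.linop scale T"
  shows "module.subspace scale C \<Longrightarrow> C \<subseteq> module.span scale B \<Longrightarrow> C \<noteq> {0} \<Longrightarrow>
    (\<And>T x. T \<in> \<T> \<Longrightarrow> x \<in> C \<Longrightarrow> T x \<in> C) \<Longrightarrow>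
    (\<And>S T x. S \<in> \<T> \<Longrightarrow> T \<in> \<T> \<Longrightarrow> x \<in> C \<Longrightarrow> S (T x) = T (S x)) \<Longrightarrow>
    (\<And>D. D \<subseteq> C \<Longrightarrow> \<not> module.dependent scale D \<Longrightarrow> card D \<le> N) \<Longrightarrow>
    \<exists>u\<in>C. u \<noteq> 0 \<and> (\<forall>T\<in>\<T>. \<exists>c. T u = scale c u)"
proof (induction N arbitrary: C rule: less_induct)
  case (less N)
  interpret field_vector_space scale by fact
  obtain v where v: "v \<in> C" "v \<noteq> 0" using less.prems(1,3) subspace_0 by blast
  show ?case
  proof (cases "\<forall>T\<in>\<T>. \<exists>c. \<forall>u\<in>C. T u = scale c u")
    case True
    then show ?thesis using v by blast
  next
    case False
    then obtain T where T: "T \<in> \<T>" "\<And>c. \<exists>u\<in>C. T u \<noteq> scale c u" by blast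
    obtain u c where u: "u \<in> C" "u \<noteq> 0" "T u = scale c u"
      using complex_eigenvector_exists[OF assms(1) lin[OF T(1)] less.prems(1) _ assms(2) less.prems(2) v]
        less.prems(4) T(1) by blast
    obtain y where y: "y \<in> C" "T y \<noteq> scale c y" using T by blast
    define C' where "C' = {x \<in> C. T x = scale c x}"
    have linT: "linop T" using lin T by blast
    have sub: "subspace C'"
      using less.prems(1) linT
      by (auto simp: subspace_def C'_def linop_0 linop_add linop_scale scale_right_distrib mult.commute)
    have bound: "card (insert y D) \<le> N \<and> y \<notin> D" if D: "D \<subseteq> C'" "independent D" for D
    proof -
      have "y \<notin> span D" using y D(1) sub span_minimal[of D C'] unfolding C'_def by blast
      then have "independent (insert y D)" "y \<notin> D" using D(2)
        by (auto simp: independent_insert span_base)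
      moreover have "insert y D \<subseteq> C" using y D(1) C'_def by auto
      ultimately show ?thesis using less.prems(6) by blast
    qed
    have fin: "finite D" if "D \<subseteq> C'" "independent D" for D
      using that independent_span_bound[OF assms(2), of D] less.prems(2) C'_def by blast
    have "N \<noteq> 0" using bound[of "{}"] by (auto simp: independent_empty)
    have "\<exists>u\<in>C'. u \<noteq> 0 \<and> (\<forall>T\<in>\<T>. \<exists>c. T u = scale c u)"
    proof (rule less.IH[of "N - 1"])
      show "N - 1 < N" using \<open>N \<noteq> 0\<close> by simp
      show "C' \<noteq> {0}" using u C'_def by auto
      show "C' \<subseteq> span B" using less.prems(2) C'_def by auto
      show "S x \<in> C'" if "S \<in> \<T>" "x \<in> C'" for S x
        using that less.prems(4,5) T(1) linop_scale[OF lin[OF that(1)]] unfolding C'_def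
        by (metis (mono_tags, lifting) mem_Collect_eq)
      show "S (T x) = T (S x)" if "S \<in> \<T>" "T \<in> \<T>" "x \<in> C'" for S T x
        using that less.prems(5) C'_def by blast
      show "card D \<le> N - 1" if "D \<subseteq> C'" "independent D" for D
        using bound[OF that] fin[OF that] by auto
    qed (rule sub)
    then show ?thesis using C'_def by blast
  qed
qed

section \<open>Lie's theorem\<close>

sublocale complex_lie_algebra \<subseteq> field_vector_space scale ..

context complex_lie_algebra
begin

lemma linop_bracket: "linop (bracket x)"
  by (simp add: linop_def bracket_add_right bracket_scale_right)

lemma linop_bracket_left: "linop (\<lambda>y. bracket y x)"
  by (simp add: linop_def bracket_add_left bracket_scale_left)

lemma bracket_0 [simp]: "bracket x 0 = 0" "bracket 0 x = 0"
  using linop_0[OF linop_bracket] linop_0[OF linop_bracket_left] by auto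

lemma bracket_diff_left: "bracket (x - y) z = bracket x z - bracket y z"
  using linop_diff[OF linop_bracket_left] .

lemma bracket_diff_right: "bracket z (x - y) = bracket z x - bracket z y"
  using linop_diff[OF linop_bracket] .

lemma bracket_skew: "bracket x y = - bracket y x"
proof -
  have "0 = bracket (x + y) (x + y)" by (simp only: bracket_self)
  also have "\<dots> = bracket x y + bracket y x"
    by (simp only: bracket_add_left bracket_add_right) (simp add: bracket_self)
  finally show ?thesis by (simp add: eq_neg_iff_add_eq_0)
qed

lemma bracket_minus_left: "bracket (- x) z = - bracket x z"
  using bracket_diff_left[of 0 x z] by simp

lemma bracket_minus_right: "bracket z (- x) = - bracket z x"
  using bracket_diff_right[of z 0 x] by simp

lemma jacobi_derivation: "bracket x (bracket y z) = bracket (bracket x y) z + bracket y (bracket x z)"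
proof -
  have "bracket y (bracket z x) = - bracket y (bracket x z)"
    by (metis bracket_skew bracket_minus_right)
  moreover have "bracket z (bracket x y) = - bracket (bracket x y) z"
    by (metis bracket_skew)
  ultimately show ?thesis
    using jacobi[of x y z] by (simp add: algebra_simps)
qed

lemma bracket_span_subset:
  assumes "subspace U" "\<And>x y. x \<in> A \<Longrightarrow> y \<in> B \<Longrightarrow> bracket x y \<in> U"
  shows "bracket_span A B \<subseteq> U"
  unfolding bracket_span_def using assms by (intro span_minimal) auto

lemma bracket_spanI: "x \<in> A \<Longrightarrow> y \<in> B \<Longrightarrow> bracket x y \<in> bracket_span A B"
  unfolding bracket_span_def by (intro span_base) auto

lemma derived_series_shift: "derived_series (bracket_span S S) k = derived_series S (Suc k)"
  by (induction k) auto

lemma derived_subalgebra: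
  assumes "lie_subalgebra S"
  shows "lie_subalgebra (bracket_span S S)" "bracket_span S S \<subseteq> S"
proof -
  show *: "bracket_span S S \<subseteq> S"
    using assms by (intro bracket_span_subset) (auto simp: lie_subalgebra_def)
  have "subspace (bracket_span S S)" by (simp add: bracket_span_def)
  then show "lie_subalgebra (bracket_span S S)"
    using * bracket_spanI[of _ S _ S] unfolding lie_subalgebra_def by blast
qed

end

locale lie_representation = complex_lie_algebra scale bracket + V: field_vector_space vscale
  for scale :: "complex \<Rightarrow> 'g::ab_group_add \<Rightarrow> 'g" (infixr "*s" 75) and bracket
    and vscale :: "complex \<Rightarrow> 'v::ab_group_add \<Rightarrow> 'v" (infixr "*v" 75) +
  fixes S :: "'g set" and \<rho> :: "'g \<Rightarrow> 'v \<Rightarrow> 'v"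
  assumes rho_linop: "x \<in> S \<Longrightarrow> V.linop (\<rho> x)"
    and rho_add: "x \<in> S \<Longrightarrow> y \<in> S \<Longrightarrow> \<rho> (x + y) v = \<rho> x v + \<rho> y v"
    and rho_scale: "x \<in> S \<Longrightarrow> \<rho> (c *s x) v = c *v \<rho> x v"
    and rho_bracket: "x \<in> S \<Longrightarrow> y \<in> S \<Longrightarrow> \<rho> (bracket x y) v = \<rho> x (\<rho> y v) - \<rho> y (\<rho> x v)"
    and S_sub: "lie_subalgebra S"
begin

lemma restrict_rep: "lie_subalgebra S' \<Longrightarrow> S' \<subseteq> S \<Longrightarrow> lie_representation scale bracket vscale S' \<rho>"
  by unfold_locales (auto intro!: rho_linop rho_add rho_scale rho_bracket)

text \<open>On the cyclic space generated by w under \<rho> x, the operator \<rho> y is triangular: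
  l y on the diagonal and multiples of l [x, y] next to it. \<open>cyclic_commutator_zero\<close>
  then forces l [x, y] = 0.\<close>

lemma weight_bracket_zero:
  assumes x: "x \<in> S" and S': "S' \<subseteq> S" "\<And>y. y \<in> S' \<Longrightarrow> bracket x y \<in> S'"
    and w: "w \<noteq> 0" "\<And>y. y \<in> S' \<Longrightarrow> \<rho> y w = l y *v w"
    and B: "finite B" "\<And>k. (\<rho> x ^^ k) w \<in> V.span B"
    and y: "y \<in> S'"
  shows "l (bracket x y) = 0"
proof (rule V.cyclic_commutator_zero[where X="\<rho> x" and Y="\<rho> y" and w=w and l="l y"])
  let ?v = "\<lambda>i. (\<rho> x ^^ i) w"
  let ?U = "\<lambda>k. V.span (?v ` {..<k})"
  have mono: "?U i \<subseteq> ?U j" if "i \<le> j" for i j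
    using that by (intro V.span_mono) auto
  have X: "\<rho> x z \<in> ?U (Suc k)" if "z \<in> ?U k" for z k
    by (rule V.linop_span_mem[OF rho_linop[OF x] that])
       (auto intro!: V.span_base image_eqI[where x="Suc _"])
  \<comment> \<open>Proved for all y in S' at once, because the induction step for y uses the case
    of \<open>bracket x y\<close>.\<close>
  have *: "\<forall>y\<in>S'. \<rho> y (?v (Suc k)) - l y *v ?v (Suc k) + (of_nat (Suc k) * l (bracket x y)) *v ?v k \<in> ?U k" for k
  proof (induction k)
    case 0
    show ?case
    proof
      fix y assume y: "y \<in> S'"
      have "\<rho> y (\<rho> x w) = \<rho> x (\<rho> y w) - \<rho> (bracket x y) w"
        using rho_bracket[of x y w] x y S' by (auto simp: algebra_simps)
      also have "\<dots> = l y *v \<rho> x w - l (bracket x y) *v w"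
        using w(2)[OF y] w(2)[of "bracket x y"] S' y V.linop_scale[OF rho_linop[OF x]] by simp
      finally show "\<rho> y (?v (Suc 0)) - l y *v ?v (Suc 0) + (of_nat (Suc 0) * l (bracket x y)) *v ?v 0 \<in> ?U 0"
        by simp
    qed
  next
    case (Suc k)
    show ?case
    proof
      fix y assume y: "y \<in> S'"
      define d where "d = \<rho> y (?v (Suc k)) - l y *v ?v (Suc k) + (of_nat (Suc k) * l (bracket x y)) *v ?v k"
      have d: "d \<in> ?U k" using Suc y d_def by blast
      define d' where "d' = \<rho> (bracket x y) (?v (Suc k)) - l (bracket x y) *v ?v (Suc k)"
      have "d' + (of_nat (Suc k) * l (bracket x (bracket x y))) *v ?v k \<in> ?U (Suc k)"
        using Suc S'(2)[OF y] mono[of k "Suc k"] d'_def by auto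
      moreover have "(of_nat (Suc k) * l (bracket x (bracket x y))) *v ?v k \<in> ?U (Suc k)"
        by (intro V.span_scale V.span_base) auto
      ultimately have d': "d' \<in> ?U (Suc k)" by (metis add_diff_cancel V.span_diff)
      have "\<rho> y (?v (Suc (Suc k))) = \<rho> x (\<rho> y (?v (Suc k))) - \<rho> (bracket x y) (?v (Suc k))"
        using rho_bracket[of x y "?v (Suc k)"] x y S' by (auto simp: algebra_simps)
      also have "\<rho> y (?v (Suc k)) = d + l y *v ?v (Suc k) - (of_nat (Suc k) * l (bracket x y)) *v ?v k"
        by (simp add: d_def)
      also have "\<rho> x \<dots> = \<rho> x d + l y *v ?v (Suc (Suc k)) - (of_nat (Suc k) * l (bracket x y)) *v ?v (Suc k)"
        using V.linop_add[OF rho_linop[OF x]] V.linop_diff[OF rho_linop[OF x]] V.linop_scale[OF rho_linop[OF x]]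
        by simp
      also have "\<rho> (bracket x y) (?v (Suc k)) = d' + l (bracket x y) *v ?v (Suc k)"
        by (simp add: d'_def)
      finally have "\<rho> y (?v (Suc (Suc k))) - l y *v ?v (Suc (Suc k))
          + (of_nat (Suc (Suc k)) * l (bracket x y)) *v ?v (Suc k) = \<rho> x d - d'"
        unfolding of_nat_Suc[of "Suc k"] distrib_right V.scale_left_distrib mult_1_left
        by (simp add: algebra_simps del: of_nat_Suc)
      also have "\<dots> \<in> ?U (Suc k)" using X[OF d] d' by (rule V.span_diff)
      finally show "\<rho> y (?v (Suc (Suc k))) - l y *v ?v (Suc (Suc k))
          + (of_nat (Suc (Suc k)) * l (bracket x y)) *v ?v (Suc k) \<in> ?U (Suc k)" .
    qed
  qed
  show "\<rho> y ((\<rho> x ^^ Suc k) w) - l y *v (\<rho> x ^^ Suc k) w + (of_nat (Suc k) * l (bracket x y)) *v (\<rho> x ^^ k) w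
       \<in> V.span ((\<lambda>i. (\<rho> x ^^ i) w) ` {..<k})" for k
    using *[of k] y by blast
  show "of_nat (Suc k) \<noteq> (0::complex)" for k by (simp only: of_nat_eq_0_iff nat.distinct not_False_eq_True)
qed (use assms rho_linop in auto)

end

context complex_lie_algebra
begin

text \<open>The induction is on the derived length. A common eigenvector of S' = [S, S] yields a
  weight space W, stable under S because the weight vanishes on [S, S']. The weight then turns out
  to vanish on every bracket of elements of S, so S acts on W by commuting operators.\<close>

lemma lie_theorem_aux:
  fixes vscale :: "complex \<Rightarrow> 'v::ab_group_add \<Rightarrow> 'v"
  shows "derived_series S k = {0} \<Longrightarrow> lie_representation scale bracket vscale S \<rho> \<Longrightarrow>
     module.subspace vscale C \<Longrightarrow> finite B \<Longrightarrow> C \<subseteq> module.span vscale B \<Longrightarrow> C \<noteq> {0} \<Longrightarrow>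
     (\<And>x v. x \<in> S \<Longrightarrow> v \<in> C \<Longrightarrow> \<rho> x v \<in> C) \<Longrightarrow>
     \<exists>u\<in>C. u \<noteq> 0 \<and> (\<forall>x\<in>S. \<exists>c. \<rho> x u = vscale c u)"
proof (induction k arbitrary: S)
  case 0
  then interpret lie_representation scale bracket vscale S \<rho> by blast
  obtain v where "v \<in> C" "v \<noteq> 0" using 0 V.subspace_0 by blast
  moreover have "\<rho> 0 v = vscale 0 v" using rho_scale[of 0 0 v] 0 by simp
  ultimately show ?case using 0 by auto
next
  case (Suc k)
  then interpret lie_representation scale bracket vscale S \<rho> by blast
  define S' where "S' = bracket_span S S"
  have S': "lie_subalgebra S'" "S' \<subseteq> S" using derived_subalgebra[OF S_sub] by (auto simp: S'_def)
  have ideal: "bracket x y \<in> S'" if "x \<in> S" "y \<in> S" for x y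
    using bracket_spanI that S'_def by blast
  have "\<exists>u\<in>C. u \<noteq> 0 \<and> (\<forall>x\<in>S'. \<exists>c. \<rho> x u = vscale c u)"
  proof (rule Suc.IH)
    show "derived_series S' k = {0}" using Suc.prems(1) derived_series_shift S'_def by metis
    show "lie_representation scale bracket vscale S' \<rho>" using S' by (rule restrict_rep)
    show "\<And>x v. x \<in> S' \<Longrightarrow> v \<in> C \<Longrightarrow> \<rho> x v \<in> C" using Suc.prems S' by blast
  qed (use Suc.prems in auto)
  then obtain w l where w: "w \<in> C" "w \<noteq> 0" "\<And>x. x \<in> S' \<Longrightarrow> \<rho> x w = vscale (l x) w"
    by metis
  define W where "W = {v \<in> C. \<forall>x\<in>S'. \<rho> x v = vscale (l x) v}"
  have WC: "W \<subseteq> C" "w \<in> W" using w by (auto simp: W_def)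
  have subW: "V.subspace W"
    unfolding V.subspace_def W_def
    using Suc.prems(3) V.linop_0[OF rho_linop] V.linop_add[OF rho_linop] V.linop_scale[OF rho_linop] S'
    by (auto simp: V.subspace_0 V.subspace_add V.subspace_scale V.scale_right_distrib mult.commute)
  have pow: "(\<rho> x ^^ i) v \<in> C" if "x \<in> S" "v \<in> C" for x v i
    using that Suc.prems(7) by (induction i) auto
  have l0: "l (bracket x y) = 0" if "x \<in> S" "y \<in> S'" for x y
  proof (rule weight_bracket_zero[where w=w and S'=S' and B=B])
    show "(\<rho> x ^^ k) w \<in> V.span B" for k using pow[OF that(1) w(1)] Suc.prems(5) by blast
  qed (use that ideal S' w Suc.prems(4) in auto)
  have stab: "\<rho> x v \<in> W" if "x \<in> S" "v \<in> W" for x v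
  proof -
    have "\<rho> y (\<rho> x v) = vscale (l y) (\<rho> x v)" if "y \<in> S'" for y
    proof -
      have yS: "y \<in> S" "bracket x y \<in> S'" using that S' ideal \<open>x \<in> S\<close> by auto
      have "\<rho> y (\<rho> x v) = \<rho> x (\<rho> y v) - \<rho> (bracket x y) v"
        using rho_bracket[of x y v] \<open>x \<in> S\<close> yS by (auto simp: algebra_simps)
      also have "\<dots> = vscale (l y) (\<rho> x v)"
        using that \<open>v \<in> W\<close> yS l0[of x y] V.linop_scale[OF rho_linop] \<open>x \<in> S\<close> by (simp add: W_def)
      finally show ?thesis .
    qed
    then show ?thesis using that Suc.prems(7) WC by (auto simp: W_def)
  qed
  \<comment> \<open>Here y need not lie in S', so \<open>w\<close> need not be an eigenvector of
    \<rho> y; an eigenvector u of \<rho> y is chosen in W instead. As [x, y] acts on W by a scalar,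
    the commutation formula for the powers of \<rho> x on u is exact.\<close>
  have l0': "l (bracket x y) = 0" if xy: "x \<in> S" "y \<in> S" for x y
  proof -
    obtain u c where u: "u \<in> W" "u \<noteq> 0" "\<rho> y u = vscale c u"
      using complex_eigenvector_exists[of vscale "\<rho> y" W B w]
      using V.field_vector_space_axioms rho_linop[OF xy(2)] subW stab[OF xy(2)] Suc.prems WC w by blast
    have uW: "(\<rho> x ^^ i) u \<in> W" for i
      using xy u stab by (induction i) auto
    have br: "\<rho> (bracket x y) v = vscale (l (bracket x y)) v" if "v \<in> W" for v
      using that ideal[OF \<open>x \<in> S\<close> \<open>y \<in> S\<close>] by (simp add: W_def)
    have eq: "\<rho> y ((\<rho> x ^^ Suc i) u) = vscale c ((\<rho> x ^^ Suc i) u)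
        - vscale (of_nat (Suc i) * l (bracket x y)) ((\<rho> x ^^ i) u)" for i
    proof (induction i)
      case 0
      show ?case
        using rho_bracket[OF xy, of u] u br[OF u(1)] V.linop_scale[OF rho_linop[OF xy(1)]]
        by (simp add: algebra_simps)
    next
      case (Suc i)
      have "\<rho> y ((\<rho> x ^^ Suc (Suc i)) u) = \<rho> x (\<rho> y ((\<rho> x ^^ Suc i) u)) - vscale (l (bracket x y)) ((\<rho> x ^^ Suc i) u)"
        using rho_bracket[OF xy, of "(\<rho> x ^^ Suc i) u"] br[OF uW, of "Suc i"] by (simp add: algebra_simps)
      also have "\<rho> x (\<rho> y ((\<rho> x ^^ Suc i) u)) = vscale c ((\<rho> x ^^ Suc (Suc i)) u)
        - vscale (of_nat (Suc i) * l (bracket x y)) ((\<rho> x ^^ Suc i) u)"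
        unfolding Suc
        by (simp add: V.linop_diff[OF rho_linop[OF xy(1)]] V.linop_scale[OF rho_linop[OF xy(1)]])
      finally show ?case
        unfolding of_nat_Suc[of "Suc i"] distrib_right V.scale_left_distrib mult_1_left
        by (simp add: algebra_simps del: of_nat_Suc)
    qed
    show ?thesis
    proof (rule V.cyclic_commutator_zero[where X="\<rho> x" and Y="\<rho> y" and w=u and l=c and B=B])
      show "(\<rho> x ^^ k) u \<in> V.span B" for k using uW WC Suc.prems by blast
      show "of_nat (Suc k) \<noteq> (0::complex)" for k by (simp only: of_nat_eq_0_iff nat.distinct not_False_eq_True)
      show "\<rho> y ((\<rho> x ^^ Suc k) u) - vscale c ((\<rho> x ^^ Suc k) u) + vscale (of_nat (Suc k) * l (bracket x y)) ((\<rho> x ^^ k) u)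
       \<in> V.span ((\<lambda>i. (\<rho> x ^^ i) u) ` {..<k})" for k
        unfolding eq by (simp add: V.span_zero)
    qed (use u xy rho_linop Suc.prems in auto)
  qed
  have comm: "\<rho> x (\<rho> y v) = \<rho> y (\<rho> x v)" if "x \<in> S" "y \<in> S" "v \<in> W" for x y v
    using rho_bracket[of x y v] that l0'[of x y] ideal[of x y] by (simp add: W_def)
  have "\<exists>u\<in>W. u \<noteq> 0 \<and> (\<forall>T\<in>\<rho> ` S. \<exists>c. T u = vscale c u)"
  proof (rule commuting_common_eigenvector[where B=B and N="card B"])
    show "card D \<le> card B" if "D \<subseteq> W" "V.independent D" for D
      using V.independent_span_bound[of B D] that WC Suc.prems by blast
  qed (use V.field_vector_space_axioms Suc.prems rho_linop subW WC w stab comm in auto)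
  then show ?case using WC by blast
qed

lemma lie_theorem:
  assumes "solvable S" "lie_representation scale bracket vscale S \<rho>"
    and "module.subspace vscale C" "finite B" "C \<subseteq> module.span vscale B" "C \<noteq> {0}"
    and "\<And>x v. x \<in> S \<Longrightarrow> v \<in> C \<Longrightarrow> \<rho> x v \<in> C"
  obtains u where "u \<in> C" "u \<noteq> 0" "\<And>x. x \<in> S \<Longrightarrow> \<exists>c. \<rho> x u = vscale c u"
proof -
  obtain k where "derived_series S k = {0}" using assms(1) solvable_def by blast
  from lie_theorem_aux[OF this assms(2-)] that show thesis by blast
qed

end

section \<open>Lie algebras of type B\<close>

declare One_nat_def [simp del]

section \<open>The Cartan matrix of type B\<close>

lemma cartan_matrix_B_deltas:
  "cartan_matrix_B n i j = (if j = i then 2 else 0) +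
     (if j = Suc i then (if j = n then -2 else -1) else 0) + (if i = Suc j then -1 else 0)"
  by (auto simp: cartan_matrix_B_def)

lemma cartan_matrix_B_row_sum:
  fixes c :: "nat \<Rightarrow> complex"
  assumes "i \<in> {1..n}"
  shows "(\<Sum>j=1..n. of_int (cartan_matrix_B n i j) * c j) =
     2 * c i - (if i < n then (if Suc i = n then 2 else 1) * c (Suc i) else 0) - (if i \<ge> 2 then c (i - 1) else 0)"
proof -
  have *: "of_int (cartan_matrix_B n i j) * c j = (if j = i then 2 * c j else 0) +
     (if j = Suc i then (if j = n then -2 else -1) * c j else 0) + (if j = i - 1 then - c j else 0)"
    if "j \<in> {1..n}" for j
    using that assms by (auto simp: cartan_matrix_B_deltas)
  have "(\<Sum>j=1..n. of_int (cartan_matrix_B n i j) * c j) =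
     (\<Sum>j=1..n. if j = i then 2 * c j else 0)
     + (\<Sum>j=1..n. if j = Suc i then (if j = n then -2 else -1) * c j else 0)
     + (\<Sum>j=1..n. if j = i - 1 then - c j else 0)"
    by (simp only: sum.cong[OF refl *] sum.distrib)
  also have "\<dots> = 2 * c i - (if i < n then (if Suc i = n then 2 else 1) * c (Suc i) else 0) - (if i \<ge> 2 then c (i - 1) else 0)"
    using assms by (simp only: sum.delta finite_atLeastAtMost) auto
  finally show ?thesis .
qed

lemma cartan_matrix_B_column_sum:
  fixes c :: "nat \<Rightarrow> int"
  assumes "j \<in> {1..n}"
  shows "(\<Sum>i=1..n. c i * cartan_matrix_B n i j) =
     2 * c j - (if j \<ge> 2 then (if j = n then 2 else 1) * c (j - 1) else 0) - (if j < n then c (Suc j) else 0)"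
proof -
  have *: "c i * cartan_matrix_B n i j = (if i = j then 2 * c i else 0) +
     (if i = j - 1 then (if j = n then -2 else -1) * c i else 0) + (if i = Suc j then - c i else 0)"
    if "i \<in> {1..n}" for i
    using that assms by (auto simp: cartan_matrix_B_deltas)
  have "(\<Sum>i=1..n. c i * cartan_matrix_B n i j) =
     (\<Sum>i=1..n. if i = j then 2 * c i else 0)
     + (\<Sum>i=1..n. if i = j - 1 then (if j = n then -2 else -1) * c i else 0)
     + (\<Sum>i=1..n. if i = Suc j then - c i else 0)"
    by (simp only: sum.cong[OF refl *] sum.distrib)
  also have "\<dots> = 2 * c j - (if j \<ge> 2 then (if j = n then 2 else 1) * c (j - 1) else 0) - (if j < n then c (Suc j) else 0)"
    using assms by (simp only: sum.delta finite_atLeastAtMost) auto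
  finally show ?thesis .
qed

text \<open>Halving the last unknown, c_n = C_n / 2, turns row i < n into the second difference 2
  C_i - C_(i+1) - C_(i-1) and row n into C_n - C_(n-1), with C_0 = 0. Hence the first differences of
  C are the tail sums \<open>b\<close> of the right-hand side, and C is recovered by summing
  them.\<close>

lemma cartan_matrix_B_solvable:
  fixes a :: "nat \<Rightarrow> complex"
  obtains c where "\<And>i. i \<in> {1..n} \<Longrightarrow> (\<Sum>j=1..n. of_int (cartan_matrix_B n i j) * c j) = a i"
proof -
  define b where "b = (\<lambda>i. \<Sum>l=i..n. a l)"
  define C where "C = (\<lambda>k. \<Sum>l=1..k. b l)"
  define c where "c = (\<lambda>k. if k = n then C k / 2 else C k)"
  have C: "C (Suc k) = C k + b (Suc k)" for k by (simp add: C_def)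
  have b: "b i = a i + b (Suc i)" if "i \<le> n" for i
    using that by (simp add: b_def sum.atLeast_Suc_atMost)
  have bn: "b (Suc n) = 0" by (simp add: b_def)
  have "(\<Sum>j=1..n. of_int (cartan_matrix_B n i j) * c j) = a i" if i: "i \<in> {1..n}" for i
  proof -
    obtain k where k: "i = Suc k" using i by (cases i) auto
    have C0: "C 0 = 0" by (simp add: C_def)
    have prev: "(if i \<ge> 2 then c (i - 1) else 0) = C k"
      using i k C0 by (auto simp: c_def not_le less_Suc_eq)
    show ?thesis
    proof (cases "i < n")
      case True
      then have "(if Suc i = n then 2 else 1) * c (Suc i) = C i + b (Suc i)"
        by (auto simp: c_def C)
      moreover have "c i = C k + b i" using True k C[of k] by (simp add: c_def)
      ultimately show ?thesis
        unfolding cartan_matrix_B_row_sum[OF i] prev using True b[of i] k by (auto simp: C)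
    next
      case False
      then have "i = n" using i by simp
      then have "2 * c i = C k + b i" using k C[of k] by (simp add: c_def)
      then show ?thesis
        unfolding cartan_matrix_B_row_sum[OF i] prev using False b[of i] bn \<open>i = n\<close> by simp
    qed
  qed
  then show thesis by (rule that)
qed

text \<open>If no column sum were positive, the sequence 0, c_1, ..., c_n would have nondecreasing
  differences, and column n would make the last difference at most 0. All differences would then be
  at most 0, so no c_i could be positive.\<close>

lemma cartan_matrix_B_positive:
  fixes c :: "nat \<Rightarrow> int"
  assumes "\<And>i. i \<in> {1..n} \<Longrightarrow> c i \<ge> 0" "\<exists>i\<in>{1..n}. c i \<noteq> 0"
  shows "\<exists>j\<in>{1..n}. (\<Sum>i=1..n. c i * cartan_matrix_B n i j) > 0"
proof (rule ccontr)
  assume "\<not> ?thesis"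
  then have le: "(\<Sum>i=1..n. c i * cartan_matrix_B n i j) \<le> 0" if "j \<in> {1..n}" for j
    using that by (auto simp: not_less)
  define d where "d = (\<lambda>k. if k = 0 then 0 else c k)"
  have step: "d k - d (k-1) \<le> d (Suc k) - d k" if "k \<in> {1..n}" "k < n" for k
    using le[OF that(1)] that
    unfolding cartan_matrix_B_column_sum[OF that(1)]
    by (cases "k = 1") (auto simp: d_def numeral_2_eq_2 split: if_splits)
  have last: "d n - d (n-1) \<le> 0" if "n \<in> {1..n}"
    using le[OF that] that unfolding cartan_matrix_B_column_sum[OF that]
    by (cases "n = 1") (auto simp: d_def split: if_splits)
  have dec: "1 \<le> k \<Longrightarrow> d k - d (k-1) \<le> 0" if "k \<le> n" for k
    using that
  proof (induction rule: inc_induct)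
    case base then show ?case using last by simp
  next
    case (step m)
    then show ?case using \<open>\<And>k. k \<in> {1..n} \<Longrightarrow> k < n \<Longrightarrow> d k - d (k-1) \<le> d (Suc k) - d k\<close>[of m] by auto
  qed
  have "k \<le> n \<Longrightarrow> d k \<le> 0" for k
  proof (induction k)
    case 0 then show ?case by (simp add: d_def)
  next
    case (Suc k) then show ?case using dec[of "Suc k"] by simp
  qed
  then have "c i \<le> 0" if "i \<in> {1..n}" for i using that \<open>\<And>k. k \<le> n \<Longrightarrow> d k \<le> 0\<close>[of i] by (simp add: d_def)
  with assms show False by force
qed

section \<open>sl2 strings modulo a stable subspace\<close>

context complex_lie_algebra
begin

(* U = 0 gives the usual sl2 facts; a nonzero U lets them be applied in the quotient by U. *)
lemma sl2_string:
  assumes fin: finite_dim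
    and U: "subspace U" "\<And>x. x \<in> U \<Longrightarrow> bracket e x \<in> U" "\<And>x. x \<in> U \<Longrightarrow> bracket f x \<in> U"
    and ef: "bracket e f = t" "bracket t e = 2 *s e"
    and z: "bracket t z = l *s z" "bracket e (bracket f z) \<in> U" "\<And>k. l \<noteq> - of_nat k"
  shows "z \<in> U"
proof -
  let ?z = "\<lambda>k. (bracket e ^^ k) z"
  have tU: "bracket t x \<in> U" if "x \<in> U" for x
    using jacobi_derivation[of e f x] U that
    by (metis add_diff_cancel ef(1) subspace_diff)
  have tz: "bracket t (?z k) = (l + 2 * of_nat k) *s ?z k" for k
  proof (induction k)
    case (Suc k)
    have "bracket t (?z (Suc k)) = bracket (2 *s e) (?z k) + bracket e ((l + 2 * of_nat k) *s ?z k)"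
      using jacobi_derivation[of t e "?z k"] ef Suc by simp
    then show ?case by (simp add: bracket_scale_left bracket_scale_right bracket_add_right scale_left_distrib)
  qed (simp add: z)
  \<comment> \<open>The usual sl2 coefficient, computed modulo U. The hypothesis on l keeps (k +
    1)(l + k) nonzero, so membership in U passes from e^(k+1) z down to e^k z; the weights l + 2k
    are distinct, so some power lies in U to begin with.\<close>
  have fz: "bracket f (?z (Suc k)) + (of_nat (Suc k) * (l + of_nat k)) *s ?z k \<in> U" for k
  proof (induction k)
    case 0
    have "bracket f (bracket e z) = bracket e (bracket f z) - l *s z"
      using jacobi_derivation[of e f z] ef z by simp
    then show ?case using z by simp
  next
    case (Suc k)
    let ?c = "of_nat (Suc k) * (l + of_nat k)"
    have "bracket e (bracket f (?z (Suc k)) + ?c *s ?z k) \<in> U" using Suc U by blast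
    moreover have "bracket f (?z (Suc (Suc k))) = bracket e (bracket f (?z (Suc k))) - (l + 2 * of_nat (Suc k)) *s ?z (Suc k)"
      using jacobi_derivation[of e f "?z (Suc k)"] ef tz[of "Suc k"] by simp
    moreover have "of_nat (Suc (Suc k)) * (l + of_nat (Suc k)) = ?c + (l + 2 * of_nat (Suc k))"
      by (simp add: algebra_simps)
    ultimately show ?case
      by (simp add: bracket_add_right bracket_scale_right scale_left_distrib del: of_nat_Suc)
  qed
  obtain B where B: "finite B" "span B = UNIV" using fin finite_dim_def by blast
  obtain k where "?z k \<in> U"
    using eigen_family_mem[of "bracket t" U B ?z "\<lambda>k. l + 2 * of_nat k"] linop_bracket U tU B tz
    by (auto simp: inj_def)
  then show ?thesis
  proof (induction k)
    case (Suc k)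
    have "bracket f (?z (Suc k)) \<in> U" using U Suc by blast
    then have "(of_nat (Suc k) * (l + of_nat k)) *s ?z k \<in> U"
      using fz[of k] subspace_diff[OF U(1)] by (metis add_diff_cancel_left')
    moreover have "of_nat (Suc k) * (l + of_nat k) \<noteq> 0"
      using z(3)[of k] by (simp add: add_eq_0_iff2 del: of_nat_Suc)
    ultimately show ?case using scale_mem_cancel[OF U(1)] Suc.IH by blast
  qed simp
qed

end

section \<open>Roots, coroots and Chevalley generators of the abstract algebra\<close>

locale type_B_data = complex_lie_algebra +
  fixes h :: "'a set" and \<alpha> :: "nat \<Rightarrow> 'a \<Rightarrow> complex" and H :: "nat \<Rightarrow> 'a" and n :: nat
  assumes simple: simple_lie_algebra
    and cartan: "cartan_subalgebra h"
    and base: "is_base h n \<alpha>"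
    and coroots: "j \<in> {1..n} \<Longrightarrow> is_coroot h (\<alpha> j) (H j)"
    and cartan_integers: "i \<in> {1..n} \<Longrightarrow> j \<in> {1..n} \<Longrightarrow> \<alpha> i (H j) = of_int (cartan_matrix_B n i j)"
begin

lemma fin: finite_dim
  using simple by (simp add: simple_lie_algebra_def)

lemma h_subspace: "subspace h" and h_abelian: "K \<in> h \<Longrightarrow> K' \<in> h \<Longrightarrow> bracket K K' = 0"
  and h_centralizer: "(\<And>K. K \<in> h \<Longrightarrow> bracket K x = 0) \<Longrightarrow> x \<in> h"
  and h_diagonalizable: "K \<in> h \<Longrightarrow> span {x. \<exists>c. bracket K x = c *s x} = UNIV"
  using cartan unfolding cartan_subalgebra_def by blast+

lemma root_spaceD: "x \<in> root_space h \<beta> \<Longrightarrow> K \<in> h \<Longrightarrow> bracket K x = \<beta> K *s x"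
  by (simp add: root_space_def)

lemma root_space_subspace: "subspace (root_space h \<beta>)"
  by (auto simp: subspace_def root_space_def bracket_add_right bracket_scale_right
      scale_right_distrib mult.commute)

lemma root_space_cong: "(\<And>K. K \<in> h \<Longrightarrow> \<beta> K = \<gamma> K) \<Longrightarrow> root_space h \<beta> = root_space h \<gamma>"
  by (auto simp: root_space_def)

lemma root_space_bracket:
  "x \<in> root_space h \<beta> \<Longrightarrow> y \<in> root_space h \<gamma> \<Longrightarrow> bracket x y \<in> root_space h (\<lambda>K. \<beta> K + \<gamma> K)"
  by (auto simp: root_space_def jacobi_derivation[of _ x y] bracket_scale_left bracket_scale_right scale_left_distrib)

lemma root_space_0: "(\<And>K. K \<in> h \<Longrightarrow> \<beta> K = 0) \<Longrightarrow> root_space h \<beta> = h"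
  unfolding root_space_def using h_abelian h_centralizer by (intro equalityI subsetI) simp_all

text \<open>A Cartan subalgebra is only assumed to act diagonalizably element by element. A common
  eigenvector x of F is split into eigenvectors of K; since K' in F commutes with K, independence of
  eigenvectors shows that K' scales each component as it scales x.\<close>

lemma simultaneous_eigenvectors:
  assumes "finite F" "F \<subseteq> h"
  shows "span {x. \<forall>K\<in>F. \<exists>c. bracket K x = c *s x} = UNIV"
  using assms
proof (induction F rule: finite_induct)
  case (insert K F)
  let ?E = "\<lambda>F. {x. \<forall>K\<in>F. \<exists>c. bracket K x = c *s x}"
  have "?E F \<subseteq> span (?E (insert K F))"
  proof
    fix x assume x: "x \<in> ?E F"
    have "x \<in> span {y. \<exists>m\<in>UNIV. bracket K y = m *s y}"
      using h_diagonalizable[of K] insert.prems by auto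
    then obtain G v where v: "finite G" "x = (\<Sum>m\<in>G. v m)" "\<And>m. bracket K (v m) = m *s v m"
      using eigen_span[OF linop_bracket] by blast
    have "\<exists>c. bracket K' (v m) = c *s v m" if "K' \<in> F" "m \<in> G" for K' m
    proof -
      obtain c where c: "bracket K' x = c *s x" using x \<open>K' \<in> F\<close> by auto
      define u where "u = (\<lambda>m. bracket K' (v m) - c *s v m)"
      have "bracket K (bracket K' (v m)) = bracket K' (bracket K (v m))" for m
        using jacobi_derivation[of K K' "v m"] h_abelian[of K K'] insert.prems \<open>K' \<in> F\<close> by auto
      then have "bracket K (u m) = m *s u m" for m
        using v by (simp add: u_def bracket_diff_right bracket_scale_right scale_right_diff_distrib mult.commute)
      moreover have "(\<Sum>m\<in>G. u m) \<in> {0}"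
        using c v(2) by (simp add: u_def sum_subtractf linop_sum[OF linop_bracket, symmetric] scale_sum_right)
      ultimately have "\<forall>m\<in>G. u m \<in> {0}"
        using v(1) by (intro eigen_sum_mem[OF linop_bracket[of K], where w="\<lambda>m. m"]) (auto simp: subspace_def)
      then show ?thesis using \<open>m \<in> G\<close> by (auto simp: u_def)
    qed
    then have "v m \<in> ?E (insert K F)" if "m \<in> G" for m using v(3) that by blast
    then show "x \<in> span (?E (insert K F))" unfolding v(2) by (intro span_sum span_base)
  qed
  then have "span (?E F) \<subseteq> span (?E (insert K F))" by (intro span_minimal) auto
  then show ?case using insert by auto
qed simp

text \<open>A finite basis of h is enough, because the elements that act on a fixed vector by a
  scalar form a subspace. The union runs over all functions \<beta>, so the zero weight space h is
  included.\<close>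

lemma root_space_decomposition: "span (\<Union>\<beta>. root_space h \<beta>) = UNIV"
proof -
  obtain B where B: "finite B" "span B = UNIV" using fin finite_dim_def by blast
  obtain F where F: "F \<subseteq> h" "independent F" "h \<subseteq> span F"
    using maximal_independent_subset[of h] by blast
  then have "finite F" using independent_span_bound[OF B(1), of F] B by auto
  have "{x. \<forall>K\<in>F. \<exists>c. bracket K x = c *s x} \<subseteq> (\<Union>\<beta>. root_space h \<beta>)"
  proof
    fix x assume x: "x \<in> {x. \<forall>K\<in>F. \<exists>c. bracket K x = c *s x}"
    let ?S = "{K. \<exists>c. bracket K x = c *s x}"
    have "subspace ?S"
      unfolding subspace_def
      by (auto simp: bracket_add_left bracket_scale_left simp flip: scale_left_distrib intro: exI[of _ 0])
    moreover have "F \<subseteq> ?S" using x by blast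
    ultimately have "h \<subseteq> ?S" using span_minimal[of F ?S] F(3) by blast
    then have "\<forall>K. \<exists>c. K \<in> h \<longrightarrow> bracket K x = c *s x" by blast
    then obtain \<beta> where "\<forall>K\<in>h. bracket K x = \<beta> K *s x" by metis
    then show "x \<in> (\<Union>\<beta>. root_space h \<beta>)" by (auto simp: root_space_def)
  qed
  then show ?thesis using simultaneous_eigenvectors[OF \<open>finite F\<close> F(1)] span_mono by blast
qed

lemma simple_roots: "i \<in> {1..n} \<Longrightarrow> is_root h (\<alpha> i)"
  using base by (simp add: is_base_def)

lemma simple_independent:
  fixes c :: "nat \<Rightarrow> int"
  assumes "\<And>K. K \<in> h \<Longrightarrow> (\<Sum>i=1..n. of_int (c i) * \<alpha> i K) = 0" "i \<in> {1..n}"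
  shows "c i = 0"
proof -
  have "\<forall>i\<in>{1..n}. complex_of_int (c i) = 0"
    using conjunct1[OF conjunct2[OF base[unfolded is_base_def]], THEN spec, of "\<lambda>i. of_int (c i)"]
      assms(1) by simp
  with assms(2) show ?thesis by simp
qed

lemma root_coefficients:
  "is_root h \<beta> \<Longrightarrow> \<exists>c :: nat \<Rightarrow> int. ((\<forall>i\<in>{1..n}. c i \<ge> 0) \<or> (\<forall>i\<in>{1..n}. c i \<le> 0)) \<and>
    (\<forall>K\<in>h. \<beta> K = (\<Sum>i=1..n. of_int (c i) * \<alpha> i K))"
  by (rule conjunct2[OF conjunct2[OF base[unfolded is_base_def]], rule_format])

lemma simple_root_add: "i \<in> {1..n} \<Longrightarrow> K \<in> h \<Longrightarrow> K' \<in> h \<Longrightarrow> \<alpha> i (K + K') = \<alpha> i K + \<alpha> i K'"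
  and simple_root_scale: "i \<in> {1..n} \<Longrightarrow> K \<in> h \<Longrightarrow> \<alpha> i (c *s K) = c * \<alpha> i K"
proof -
  assume i: "i \<in> {1..n}" and K: "K \<in> h"
  obtain x where x: "x \<in> root_space h (\<alpha> i)" "x \<noteq> 0"
    using simple_roots[OF i] by (auto simp: is_root_def)
  have "c *s K \<in> h" using h_subspace K subspace_scale by blast
  from root_spaceD[OF x(1) this] root_spaceD[OF x(1) K] x(2)
  show "\<alpha> i (c *s K) = c * \<alpha> i K" by (simp add: bracket_scale_left)
  assume K': "K' \<in> h"
  have "K + K' \<in> h" using h_subspace K K' subspace_add by blast
  from root_spaceD[OF x(1) this] root_spaceD[OF x(1) K] root_spaceD[OF x(1) K'] x(2)
  show "\<alpha> i (K + K') = \<alpha> i K + \<alpha> i K'" by (simp add: bracket_add_left flip: scale_left_distrib)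
qed

text \<open>Coefficients with respect to the base are unique, so a root cannot have coefficients of
  both signs. This yields [e_i, f_j] = 0 for distinct i and j, and it ends the descent in
  \<open>generation_step\<close>.\<close>

lemma mixed_not_root:
  fixes d :: "nat \<Rightarrow> int"
  assumes "j \<in> {1..n}" "d j < 0" "k \<in> {1..n}" "d k > 0"
    and "x \<in> root_space h (\<lambda>K. \<Sum>i=1..n. of_int (d i) * \<alpha> i K)"
  shows "x = 0"
proof (rule ccontr)
  assume "x \<noteq> 0"
  moreover have "\<exists>K\<in>h. (\<Sum>i=1..n. of_int (d i) * \<alpha> i K) \<noteq> 0"
    using simple_independent[of d j] assms by fastforce
  ultimately have "is_root h (\<lambda>K. \<Sum>i=1..n. of_int (d i) * \<alpha> i K)"
    using assms(5) by (auto simp: is_root_def)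
  then obtain c where c: "(\<forall>i\<in>{1..n}. c i \<ge> 0) \<or> (\<forall>i\<in>{1..n}. c i \<le> 0)"
    "\<And>K. K \<in> h \<Longrightarrow> (\<Sum>i=1..n. of_int (d i) * \<alpha> i K) = (\<Sum>i=1..n. of_int (c i) * \<alpha> i K)"
    using root_coefficients by blast
  have "(d i - c i) = 0" if "i \<in> {1..n}" for i
    by (rule simple_independent[of "\<lambda>i. d i - c i", OF _ that])
       (simp add: left_diff_distrib sum_subtractf c(2))
  then show False using c(1) assms by force
qed

text \<open>Every root is a combination of simple roots, so K kills every root space and is central,
  while the center is an ideal different from the whole simple algebra.\<close>

lemma center_trivial:
  assumes "K \<in> h" "\<And>i. i \<in> {1..n} \<Longrightarrow> \<alpha> i K = 0"
  shows "K = 0"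
proof -
  have "bracket K x = 0" if "x \<in> root_space h \<beta>" for x \<beta>
  proof (cases "\<beta> K = 0 \<or> x = 0")
    case True
    then show ?thesis using root_spaceD[OF that assms(1)] by auto
  next
    case False
    then have "is_root h \<beta>" using that assms(1) by (auto simp: is_root_def)
    then obtain c where "\<beta> K = (\<Sum>i=1..n. of_int (c i) * \<alpha> i K)"
      using root_coefficients assms(1) by blast
    then have "\<beta> K = 0" using assms(2) by simp
    with False show ?thesis by simp
  qed
  then have central: "bracket K x = 0" for x
  proof -
    have "x \<in> span (\<Union>\<beta>. root_space h \<beta>)" using root_space_decomposition by simp
    then have "bracket K x \<in> {0}"
      by (rule linop_span_mem[OF linop_bracket]) (use \<open>\<And>x \<beta>. x \<in> root_space h \<beta> \<Longrightarrow> bracket K x = 0\<close> in \<open>auto simp: subspace_def\<close>)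
    then show ?thesis by simp
  qed
  define Z where "Z = {z. \<forall>x. bracket z x = 0}"
  have "subspace Z" by (auto simp: Z_def subspace_def bracket_add_left bracket_scale_left)
  moreover have "bracket x z = 0" if "z \<in> Z" for x z
    using that bracket_skew[of x z] by (auto simp: Z_def)
  ultimately have "lie_ideal UNIV Z"
    by (auto simp: lie_ideal_def subspace_0)
  moreover have "Z \<noteq> UNIV" using simple by (auto simp: simple_lie_algebra_def Z_def)
  ultimately have "Z = {0}" using simple by (auto simp: simple_lie_algebra_def)
  then show ?thesis using central by (auto simp: Z_def)
qed

lemma H_in_h: "j \<in> {1..n} \<Longrightarrow> H j \<in> h"
proof -
  assume "j \<in> {1..n}"
  then have "H j \<in> bracket_span (root_space h (\<alpha> j)) (root_space h (\<lambda>K. - \<alpha> j K))"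
    using coroots by (simp add: is_coroot_def)
  moreover have "bracket_span (root_space h (\<alpha> j)) (root_space h (\<lambda>K. - \<alpha> j K)) \<subseteq> h"
  proof (rule bracket_span_subset[OF h_subspace])
    fix x y assume "x \<in> root_space h (\<alpha> j)" "y \<in> root_space h (\<lambda>K. - \<alpha> j K)"
    from root_space_bracket[OF this] show "bracket x y \<in> h" by (simp add: root_space_0)
  qed
  ultimately show ?thesis by blast
qed

lemma simple_root_sum:
  assumes "i \<in> {1..n}" "finite A" "\<And>a. a \<in> A \<Longrightarrow> K a \<in> h"
  shows "\<alpha> i (\<Sum>a\<in>A. c a *s K a) = (\<Sum>a\<in>A. c a * \<alpha> i (K a))"
  using assms(2,3)
proof (induction A rule: finite_induct)
  case empty
  show ?case using simple_root_scale[OF assms(1), of 0 0] h_subspace by (simp add: subspace_0)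
next
  case (insert a A)
  have "(\<Sum>a\<in>A. c a *s K a) \<in> h" "c a *s K a \<in> h"
    using h_subspace insert by (auto intro!: subspace_sum subspace_scale)
  then show ?case using insert simple_root_add[OF assms(1)] simple_root_scale[OF assms(1)] by simp
qed

lemma h_element:
  fixes a :: "nat \<Rightarrow> complex"
  obtains c where "\<And>i. i \<in> {1..n} \<Longrightarrow> \<alpha> i (\<Sum>j=1..n. c j *s H j) = a i" "(\<Sum>j=1..n. c j *s H j) \<in> h"
proof -
  obtain c where c: "\<And>i. i \<in> {1..n} \<Longrightarrow> (\<Sum>j=1..n. of_int (cartan_matrix_B n i j) * c j) = a i"
    using cartan_matrix_B_solvable[of n a] by blast
  have "\<alpha> i (\<Sum>j=1..n. c j *s H j) = a i" if "i \<in> {1..n}" for i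
    using c[OF that] by (subst simple_root_sum[OF that]) (auto simp: H_in_h cartan_integers[OF that] mult.commute)
  moreover have "(\<Sum>j=1..n. c j *s H j) \<in> h"
    using h_subspace H_in_h by (intro subspace_sum subspace_scale) auto
  ultimately show thesis by (rule that)
qed

text \<open>Solvability of the Cartan system gives a combination of coroots with the same simple
  root values as K, and by \<open>center_trivial\<close> these values determine an element of
  h.\<close>

lemma h_span:
  assumes "K \<in> h"
  obtains c where "K = (\<Sum>j=1..n. c j *s H j)"
proof -
  obtain c where c: "\<And>i. i \<in> {1..n} \<Longrightarrow> \<alpha> i (\<Sum>j=1..n. c j *s H j) = \<alpha> i K" "(\<Sum>j=1..n. c j *s H j) \<in> h"
    using h_element[of "\<lambda>i. \<alpha> i K"] by blast
  define D where "D = (\<Sum>j=1..n. c j *s H j)"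
  have "(-1) *s D \<in> h" using c(2) h_subspace subspace_scale D_def by blast
  then have "\<alpha> i (K + (-1) *s D) = 0" if "i \<in> {1..n}" for i
    using simple_root_add[OF that assms, of "(-1) *s D"] simple_root_scale[OF that c(2), of "-1"] c(1)[OF that]
    by (simp add: D_def)
  moreover have "K + (-1) *s D \<in> h" using \<open>(-1) *s D \<in> h\<close> assms h_subspace subspace_add by blast
  ultimately have "K + (-1) *s D = 0" using center_trivial by blast
  then have "K = D" by simp
  then show thesis using that D_def by blast
qed

text \<open>Subtracting a multiple of e from x makes \<beta> vanish on [z, f], so that [e, [f, z]] =
  0. But z has weight 2, and \<open>sl2_string\<close> with U = {0} gives z = 0. Stated for a
  general \<beta> in order to serve both \<alpha>_i and -\<alpha>_i.\<close>

lemma simple_root_space_line: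
  assumes e: "e \<in> root_space h \<beta>" and f: "f \<in> root_space h (\<lambda>K. - \<beta> K)"
    and b: "\<beta> (bracket e f) = 2" and add: "\<And>K K'. K \<in> h \<Longrightarrow> K' \<in> h \<Longrightarrow> \<beta> (K + K') = \<beta> K + \<beta> K'"
    and scale: "\<And>c K. K \<in> h \<Longrightarrow> \<beta> (c *s K) = c * \<beta> K"
    and x: "x \<in> root_space h \<beta>"
  obtains c where "x = c *s e"
proof -
  have inh: "bracket y f \<in> h" if "y \<in> root_space h \<beta>" for y
    using root_space_bracket[OF that f] by (simp add: root_space_0)
  define c where "c = \<beta> (bracket x f) / 2"
  define z where "z = x + (- c) *s e"
  have zr: "z \<in> root_space h \<beta>"
    unfolding z_def using root_space_subspace e x by (intro subspace_add subspace_scale)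
  have "\<beta> (bracket z f) = 0"
  proof -
    have "bracket z f = bracket x f + (-c) *s bracket e f"
      by (simp add: z_def bracket_diff_left bracket_scale_left)
    moreover have "\<beta> (bracket x f + (-c) *s bracket e f) = \<beta> (bracket x f) + (-c) * 2"
      using add[OF inh[OF x], of "(-c) *s bracket e f"] scale[OF inh[OF e], of "-c"] b
        subspace_scale[OF h_subspace inh[OF e]] by metis
    ultimately show ?thesis by (simp add: c_def)
  qed
  then have "bracket (bracket z f) e = 0" using root_spaceD[OF e inh[OF zr]] by simp
  then have "bracket e (bracket f z) = 0"
    by (metis bracket_skew bracket_minus_left bracket_0(1) add.inverse_inverse neg_0_equal_iff_equal)
  moreover have "bracket (bracket e f) e = 2 *s e" "bracket (bracket e f) z = 2 *s z"
    using root_spaceD[OF _ inh[OF e]] e zr b by auto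
  moreover have "2 \<noteq> - complex_of_nat k" for k
  proof
    assume "2 = - complex_of_nat k"
    then have "of_nat (2 + k) = (0::complex)" by (simp add: eq_neg_iff_add_eq_0)
    then show False by (simp only: of_nat_eq_0_iff)
  qed
  ultimately have "z \<in> {0}"
    by (intro sl2_string[of "{0}" e f "bracket e f" z 2, OF fin]) (auto simp: subspace_def)
  then have "x = c *s e" by (simp add: z_def)
  then show thesis by (rule that)
qed

text \<open>The definition of a coroot only places H_i in the span of brackets of the two root
  spaces. Both spaces are lines, so this span is the line through one bracket, and \<alpha>_i(H_i) =
  2 fixes the scalar.\<close>

lemma chevalley_pair:
  assumes i: "i \<in> {1..n}"
  obtains e f where "e \<in> root_space h (\<alpha> i)" "f \<in> root_space h (\<lambda>K. - \<alpha> i K)" "bracket e f = H i"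
proof -
  let ?P = "root_space h (\<alpha> i)" and ?N = "root_space h (\<lambda>K. - \<alpha> i K)"
  have H: "H i \<in> bracket_span ?P ?N" "\<alpha> i (H i) = 2"
    using coroots[OF i] by (auto simp: is_coroot_def)
  have inh: "bracket x y \<in> h" if "x \<in> ?P" "y \<in> ?N" for x y
    using root_space_bracket[OF that] by (simp add: root_space_0)
  have "\<exists>x\<in>?P. \<exists>y\<in>?N. \<alpha> i (bracket x y) \<noteq> 0"
  proof (rule ccontr)
    assume "\<not> ?thesis"
    then have "bracket_span ?P ?N \<subseteq> {K \<in> h. \<alpha> i K = 0}"
      using inh simple_root_add[OF i] simple_root_scale[OF i] h_subspace simple_root_scale[OF i, of 0 0]
      by (intro bracket_span_subset) (auto simp: subspace_def)
    with H show False by auto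
  qed
  then obtain e y where e: "e \<in> ?P" and y: "y \<in> ?N" "\<alpha> i (bracket e y) \<noteq> 0" by blast
  define f where "f = (2 / \<alpha> i (bracket e y)) *s y"
  have f: "f \<in> ?N" using y root_space_subspace subspace_scale f_def by blast
  have ef: "\<alpha> i (bracket e f) = 2"
    using simple_root_scale[OF i inh[OF e y(1)]] y(2) by (simp add: f_def bracket_scale_right)
  have "bracket_span ?P ?N \<subseteq> span {bracket e f}"
  proof (rule bracket_span_subset)
    fix u v assume u: "u \<in> ?P" and v: "v \<in> ?N"
    obtain c where c: "u = c *s e"
      by (rule simple_root_space_line[OF e f ef _ _ u]) (use simple_root_add[OF i] simple_root_scale[OF i] in auto)
    have e': "e \<in> root_space h (\<lambda>K. - (- \<alpha> i K))" using e by simp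
    have "- \<alpha> i (bracket f e) = 2"
      using simple_root_scale[OF i inh[OF e f], of "-1"] ef bracket_skew[of f e] by simp
    then obtain d where d: "v = d *s f"
      by (rule simple_root_space_line[OF f e' _ _ _ v]) (use simple_root_add[OF i] simple_root_scale[OF i] in auto)
    show "bracket u v \<in> span {bracket e f}"
      unfolding c d by (simp add: bracket_scale_left bracket_scale_right span_scale span_base)
  qed (rule subspace_span)
  then obtain c where c: "H i = c *s bracket e f"
    using H(1) by (auto simp: span_singleton)
  then have "c = 1" using simple_root_scale[OF i inh[OF e f], of c] H(2) ef by simp
  then show thesis using that e f c by simp
qed

(* In the quotient by U a root vector of minimal height would be a lowest weight vector; cartan_matrix_B_positive
   gives it a positive weight. Stated for (e, f, t) so as to cover the negative roots by (f, e, -t). *)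
lemma generation_step:
  fixes e f t :: "nat \<Rightarrow> 'a" and a :: "nat \<Rightarrow> 'a \<Rightarrow> complex" and c :: "nat \<Rightarrow> int"
  assumes ef: "\<And>i. i \<in> {1..n} \<Longrightarrow> e i \<in> root_space h (a i)"
      "\<And>i. i \<in> {1..n} \<Longrightarrow> f i \<in> root_space h (\<lambda>K. - a i K)"
      "\<And>i. i \<in> {1..n} \<Longrightarrow> bracket (e i) (f i) = t i"
      "\<And>i. i \<in> {1..n} \<Longrightarrow> t i \<in> h"
    and A: "\<And>i j. i \<in> {1..n} \<Longrightarrow> j \<in> {1..n} \<Longrightarrow> a i (t j) = of_int (cartan_matrix_B n i j)"
    and mixed: "\<And>d :: nat \<Rightarrow> int. \<And>j k x. j \<in> {1..n} \<Longrightarrow> k \<in> {1..n} \<Longrightarrow> d j < 0 \<Longrightarrow> d k > 0 \<Longrightarrow>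
       x \<in> root_space h (\<lambda>K. \<Sum>i=1..n. of_int (d i) * a i K) \<Longrightarrow> x = 0"
    and U: "subspace U" "\<And>i x. i \<in> {1..n} \<Longrightarrow> x \<in> U \<Longrightarrow> bracket (e i) x \<in> U"
      "\<And>i x. i \<in> {1..n} \<Longrightarrow> x \<in> U \<Longrightarrow> bracket (f i) x \<in> U" "h \<subseteq> U"
  shows "(\<And>i. i \<in> {1..n} \<Longrightarrow> c i \<ge> 0) \<Longrightarrow> root_space h (\<lambda>K. \<Sum>i=1..n. of_int (c i) * a i K) \<subseteq> U"
proof (induction "nat (\<Sum>i=1..n. c i)" arbitrary: c rule: less_induct)
  case less
  show ?case
  proof (cases "\<exists>i\<in>{1..n}. c i \<noteq> 0")
    case False
    then have "root_space h (\<lambda>K. \<Sum>i=1..n. of_int (c i) * a i K) = h"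
      by (intro root_space_0) auto
    then show ?thesis using U by simp
  next
    case True
    then obtain j where j: "j \<in> {1..n}" "(\<Sum>i=1..n. c i * cartan_matrix_B n i j) > 0"
      using cartan_matrix_B_positive[of n c] less.prems by blast
    define m where "m = (\<Sum>i=1..n. c i * cartan_matrix_B n i j)"
    define c' where "c' = c(j := c j - 1)"
    have c'sum: "(\<Sum>i=1..n. of_int (c' i) * a i K) = (\<Sum>i=1..n. of_int (c i) * a i K) - a j K" for K
    proof -
      have "(\<Sum>i=1..n. of_int (c' i) * a i K) = (\<Sum>i=1..n. of_int (c i) * a i K - (if i = j then a i K else 0))"
        by (intro sum.cong) (auto simp: c'_def left_diff_distrib)
      then show ?thesis using j by (simp add: sum_subtractf)
    qed
    show ?thesis
    proof
      fix x assume x: "x \<in> root_space h (\<lambda>K. \<Sum>i=1..n. of_int (c i) * a i K)"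
      have "bracket (f j) x \<in> root_space h (\<lambda>K. - a j K + (\<Sum>i=1..n. of_int (c i) * a i K))"
        using root_space_bracket[OF ef(2)[OF j(1)] x] .
      then have fx: "bracket (f j) x \<in> root_space h (\<lambda>K. \<Sum>i=1..n. of_int (c' i) * a i K)"
        by (simp add: c'sum)
      have fxU: "bracket (f j) x \<in> U"
      proof (cases "c j = 0")
        case False
        then have cj: "c j > 0" using less.prems[OF j(1)] by simp
        have "(\<Sum>i=1..n. c' i) = (\<Sum>i=1..n. c i - (if i = j then 1 else 0))"
          by (intro sum.cong) (auto simp: c'_def)
        then have "(\<Sum>i=1..n. c' i) = (\<Sum>i=1..n. c i) - 1"
          using j by (simp add: sum_subtractf)
        moreover have "(\<Sum>i=1..n. c i) \<ge> c j"
          using less.prems j by (intro member_le_sum) auto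
        ultimately have "nat (\<Sum>i=1..n. c' i) < nat (\<Sum>i=1..n. c i)" using cj by simp
        then have "root_space h (\<lambda>K. \<Sum>i=1..n. of_int (c' i) * a i K) \<subseteq> U"
          by (rule less.hyps) (use less.prems cj in \<open>auto simp: c'_def\<close>)
        then show ?thesis using fx by blast
      next
        case True
        \<comment> \<open>With c j = 0, the weight lowered by the j-th root has coefficients of both
          signs, so f_j kills x.\<close>
        then obtain k where "k \<in> {1..n}" "c k > 0" "k \<noteq> j"
          using \<open>\<exists>i\<in>{1..n}. c i \<noteq> 0\<close> less.prems by (metis order_le_less)
        then have "bracket (f j) x = 0"
          using mixed[of j k c'] j fx True by (auto simp: c'_def)
        then show ?thesis using U(1) by (simp add: subspace_0)
      qed
      show "x \<in> U"
      proof (rule sl2_string[OF fin U(1)])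
        show "bracket (e j) (f j) = t j" using ef j by simp
        have "bracket (t j) (e j) = a j (t j) *s e j"
          using root_spaceD[OF ef(1)[OF j(1)] ef(4)[OF j(1)]] .
        then show "bracket (t j) (e j) = 2 *s e j" using A[OF j(1) j(1)] by (simp add: cartan_matrix_B_def)
        have "(\<Sum>i=1..n. of_int (c i) * a i (t j)) = (of_int m :: complex)"
          using A[OF _ j(1)] by (simp add: m_def)
        then show "bracket (t j) x = of_int m *s x" using root_spaceD[OF x ef(4)[OF j(1)]] by simp
        show "bracket (e j) (bracket (f j) x) \<in> U" using U(2)[OF j(1) fxU] .
        show "of_int m \<noteq> - complex_of_nat k" for k
        proof
          assume "of_int m = - complex_of_nat k"
          then have "complex_of_int (m + int k) = 0" by simp
          then have "m + int k = 0" using of_int_eq_0_iff by blast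
          with j(2) show False by (simp add: m_def)
        qed
      qed (use U j in auto)
    qed
  qed
qed

lemma generation:
  assumes ef: "\<And>i. i \<in> {1..n} \<Longrightarrow> e i \<in> root_space h (\<alpha> i)"
      "\<And>i. i \<in> {1..n} \<Longrightarrow> f i \<in> root_space h (\<lambda>K. - \<alpha> i K)"
      "\<And>i. i \<in> {1..n} \<Longrightarrow> bracket (e i) (f i) = H i"
    and U: "subspace U" "\<And>i x. i \<in> {1..n} \<Longrightarrow> x \<in> U \<Longrightarrow> bracket (e i) x \<in> U"
      "\<And>i x. i \<in> {1..n} \<Longrightarrow> x \<in> U \<Longrightarrow> bracket (f i) x \<in> U" "\<And>i. i \<in> {1..n} \<Longrightarrow> H i \<in> U"
  shows "U = UNIV"
proof -
  have hU: "h \<subseteq> U"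
  proof
    fix K assume "K \<in> h"
    then obtain c where "K = (\<Sum>j=1..n. c j *s H j)" using h_span by blast
    then show "K \<in> U" using U by (auto intro!: subspace_sum subspace_scale)
  qed
  have "root_space h \<beta> \<subseteq> U" for \<beta>
  proof (cases "is_root h \<beta>")
    case False
    have "x \<in> U" if "x \<in> root_space h \<beta>" for x
    proof (cases "x = 0")
      case False
      then have "root_space h \<beta> = h"
        using \<open>\<not> is_root h \<beta>\<close> that by (intro root_space_0) (auto simp: is_root_def)
      then show ?thesis using hU that by auto
    qed (use U(1) subspace_0 in auto)
    then show ?thesis by blast
  next
    case True
    then obtain c where c: "(\<forall>i\<in>{1..n}. c i \<ge> 0) \<or> (\<forall>i\<in>{1..n}. c i \<le> 0)"
      "\<And>K. K \<in> h \<Longrightarrow> \<beta> K = (\<Sum>i=1..n. of_int (c i) * \<alpha> i K)"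
      using root_coefficients by blast
    from c(1) show ?thesis
    proof
      assume c0: "\<forall>i\<in>{1..n}. c i \<ge> 0"
      have "root_space h (\<lambda>K. \<Sum>i=1..n. of_int (c i) * \<alpha> i K) \<subseteq> U"
      proof (rule generation_step[where e=e and f=f and t=H])
        show "x = 0" if "j \<in> {1..n}" "k \<in> {1..n}" "d j < 0" "d k > 0"
          "x \<in> root_space h (\<lambda>K. \<Sum>i=1..n. of_int (d i) * \<alpha> i K)" for d :: "nat \<Rightarrow> int" and j k x
          by (rule mixed_not_root[of j d k]) (use that in auto)
      qed (use ef U hU c0 H_in_h cartan_integers in auto)
      then show ?thesis using root_space_cong[OF c(2)] by simp
    next
      assume c0: "\<forall>i\<in>{1..n}. c i \<le> 0"
      have "root_space h (\<lambda>K. \<Sum>i=1..n. of_int (- c i) * - \<alpha> i K) \<subseteq> U"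
      proof (rule generation_step[where e=f and f=e and t="\<lambda>i. - H i"])
        show "bracket (f i) (e i) = - H i" if "i \<in> {1..n}" for i
          using ef(3)[OF that] bracket_skew by metis
        show "- H i \<in> h" if "i \<in> {1..n}" for i
          using H_in_h[OF that] h_subspace subspace_neg by blast
        show "- \<alpha> i (- H j) = of_int (cartan_matrix_B n i j)" if "i \<in> {1..n}" "j \<in> {1..n}" for i j
          using simple_root_scale[OF that(1) H_in_h[OF that(2)], of "-1"] cartan_integers[OF that] by simp
        show "x = 0" if "j \<in> {1..n}" "k \<in> {1..n}" "d j < 0" "d k > 0"
          "x \<in> root_space h (\<lambda>K. \<Sum>i=1..n. of_int (d i) * - \<alpha> i K)" for d :: "nat \<Rightarrow> int" and j k x
          by (rule mixed_not_root[of k "\<lambda>i. - d i" j]) (use that in auto)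
      qed (use ef U hU c0 in auto)
      then show ?thesis using root_space_cong[OF c(2)] by simp
    qed
  qed
  then have "span (\<Union>\<beta>. root_space h \<beta>) \<subseteq> U" using U(1) by (intro span_minimal) auto
  then show ?thesis using root_space_decomposition by auto
qed

text \<open>The bracket has weight \<alpha>_i - \<alpha>_j, whose coefficients have both
  signs.\<close>

lemma chevalley_commute:
  assumes "i \<in> {1..n}" "j \<in> {1..n}" "i \<noteq> j" "x \<in> root_space h (\<alpha> i)" "y \<in> root_space h (\<lambda>K. - \<alpha> j K)"
  shows "bracket x y = 0"
proof (rule mixed_not_root[of j "\<lambda>k. if k = i then 1 else if k = j then -1 else 0" i])
  have "(\<Sum>k=1..n. of_int (if k = i then 1 else if k = j then -1 else 0) * \<alpha> k K) = \<alpha> i K + - \<alpha> j K" for K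
  proof -
    have "(\<Sum>k=1..n. of_int (if k = i then 1 else if k = j then -1 else 0) * \<alpha> k K)
      = (\<Sum>k=1..n. (if k = i then \<alpha> k K else 0) + (if k = j then - \<alpha> k K else 0))"
      using assms by (intro sum.cong) auto
    then show ?thesis using assms by (simp add: sum.distrib)
  qed
  then show "bracket x y \<in> root_space h (\<lambda>K. \<Sum>k=1..n. of_int (if k = i then 1 else if k = j then -1 else 0) * \<alpha> k K)"
    using root_space_bracket[OF assms(4,5)] by simp
qed (use assms in auto)

end

section \<open>The orthogonal Lie algebra\<close>

text \<open>Matrices are functions on all pairs of integers, so one type serves every n; membership
  in a set such as \<open>so_mat n\<close> confines the support to \<open>box n\<close>. Indices
  symmetric about 0 turn the reflection in the antidiagonal into (i, j) -> (-j, -i).\<close>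

type_synonym cmat = "int \<Rightarrow> int \<Rightarrow> complex"

abbreviation box :: "nat \<Rightarrow> int set" where "box n \<equiv> {- int n..int n}"

definition mat_scale :: "complex \<Rightarrow> cmat \<Rightarrow> cmat" where
  "mat_scale c M = (\<lambda>i j. c * M i j)"

definition mat_mult :: "nat \<Rightarrow> cmat \<Rightarrow> cmat \<Rightarrow> cmat" where
  "mat_mult n A B = (\<lambda>i j. \<Sum>k\<in>box n. A i k * B k j)"

definition mat_bracket :: "nat \<Rightarrow> cmat \<Rightarrow> cmat \<Rightarrow> cmat" where
  "mat_bracket n A B = mat_mult n A B - mat_mult n B A"

lemma sum_fun_apply: "(\<Sum>a\<in>A. f a) x = (\<Sum>a\<in>A. f a x)"
  by (induction A rule: infinite_finite_induct) auto

lemma mat_scale_apply [simp]: "mat_scale c M i j = c * M i j"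
  by (simp add: mat_scale_def)

lemma mat_vector_space: "field_vector_space mat_scale"
  by unfold_locales (auto simp: fun_eq_iff algebra_simps)

lemma mat_mult_assoc: "mat_mult n (mat_mult n A B) C = mat_mult n A (mat_mult n B C)"
proof -
  have "(\<Sum>k\<in>box n. (\<Sum>l\<in>box n. A i l * B l k) * C k j) = (\<Sum>l\<in>box n. A i l * (\<Sum>k\<in>box n. B l k * C k j))" for i j
    unfolding sum_distrib_left sum_distrib_right by (subst sum.swap) (simp add: mult.assoc)
  then show ?thesis by (simp add: mat_mult_def)
qed

lemma mat_mult_add_left: "mat_mult n (A + B) C = mat_mult n A C + mat_mult n B C"
  and mat_mult_add_right: "mat_mult n C (A + B) = mat_mult n C A + mat_mult n C B"
  and mat_mult_diff_left: "mat_mult n (A - B) C = mat_mult n A C - mat_mult n B C"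
  and mat_mult_diff_right: "mat_mult n C (A - B) = mat_mult n C A - mat_mult n C B"
  and mat_mult_scale_left: "mat_mult n (mat_scale c A) B = mat_scale c (mat_mult n A B)"
  and mat_mult_scale_right: "mat_mult n A (mat_scale c B) = mat_scale c (mat_mult n A B)"
  by (auto simp: fun_eq_iff mat_mult_def sum.distrib sum_subtractf sum_distrib_left algebra_simps)

lemma mat_lie_algebra: "complex_lie_algebra mat_scale (mat_bracket n)"
proof -
  interpret field_vector_space mat_scale by (rule mat_vector_space)
  show ?thesis
  proof
    show "mat_bracket n x (mat_bracket n y z) + mat_bracket n y (mat_bracket n z x) + mat_bracket n z (mat_bracket n x y) = 0" for x y z
      unfolding mat_bracket_def mat_mult_diff_left mat_mult_diff_right mat_mult_assoc by simp
    show "mat_bracket n (mat_scale c x) y = mat_scale c (mat_bracket n x y)"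
      "mat_bracket n x (mat_scale c y) = mat_scale c (mat_bracket n x y)" for c x y
      by (simp_all add: mat_bracket_def mat_mult_scale_left mat_mult_scale_right scale_right_diff_distrib)
  qed (simp_all add: mat_bracket_def mat_mult_add_left mat_mult_add_right)
qed

(* so(2n+1) for the symmetric form pairing e_i with e_{-i}. *)
definition so_mat :: "nat \<Rightarrow> cmat set" where
  "so_mat n = {M. (\<forall>i j. i \<notin> box n \<or> j \<notin> box n \<longrightarrow> M i j = 0) \<and> (\<forall>i j. M (- j) (- i) = - M i j)}"

lemma so_mat_support: "M \<in> so_mat n \<Longrightarrow> i \<notin> box n \<or> j \<notin> box n \<Longrightarrow> M i j = 0"
  by (auto simp: so_mat_def)

lemma so_mat_skew: "M \<in> so_mat n \<Longrightarrow> M (- j) (- i) = - M i j"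
  by (auto simp: so_mat_def)

lemma so_mat_antidiagonal: "M \<in> so_mat n \<Longrightarrow> M i (- i) = 0"
  using so_mat_skew[of M n "-i" i] by simp

lemma so_mat_center: "M \<in> so_mat n \<Longrightarrow> M 0 0 = 0"
  using so_mat_antidiagonal[of M n 0] by simp

lemma so_mat_subspace: "module.subspace mat_scale (so_mat n)"
proof -
  interpret field_vector_space mat_scale by (rule mat_vector_space)
  show ?thesis
    unfolding subspace_def so_mat_def by auto
qed

lemma sum_box_uminus: "(\<Sum>k\<in>box n. f (- k)) = (\<Sum>k\<in>box n. f k)"
  by (rule sum.reindex_bij_witness[of _ uminus uminus]) auto

lemma so_mat_mult_flip:
  assumes "A \<in> so_mat n" "B \<in> so_mat n"
  shows "mat_mult n A B (- j) (- i) = mat_mult n B A i j"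
proof -
  have "mat_mult n A B (- j) (- i) = (\<Sum>k\<in>box n. A (- j) (- k) * B (- k) (- i))"
    unfolding mat_mult_def by (rule sum_box_uminus[symmetric])
  then show ?thesis
    using assms by (simp add: so_mat_skew mat_mult_def mult.commute)
qed

lemma so_mat_bracket:
  assumes "A \<in> so_mat n" "B \<in> so_mat n"
  shows "mat_bracket n A B \<in> so_mat n"
proof -
  have "mat_bracket n A B i j = 0" if "i \<notin> box n \<or> j \<notin> box n" for i j
    using that so_mat_support[OF assms(1)] so_mat_support[OF assms(2)]
    by (auto simp: mat_bracket_def mat_mult_def)
  then show ?thesis
    using so_mat_mult_flip[OF assms] so_mat_mult_flip[OF assms(2,1)]
    by (auto simp: so_mat_def mat_bracket_def)
qed

text \<open>The matrix unit E_(a,b) made skew for the form: a root vector of weight eps_a - eps_b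
  for a different from b and -b, where eps_(-a) = -eps_a. For a = b nonzero it is a torus element,
  and for b = -a it is zero.\<close>

definition so_unit :: "int \<Rightarrow> int \<Rightarrow> cmat" where
  "so_unit a b = (\<lambda>i j. (if i = a \<and> j = b then 1 else 0) - (if i = - b \<and> j = - a then 1 else 0))"

lemma so_unit_mem: "a \<in> box n \<Longrightarrow> b \<in> box n \<Longrightarrow> so_unit a b \<in> so_mat n"
proof -
  assume ab: "a \<in> box n" "b \<in> box n"
  have "so_unit a b (- j) (- i) = - so_unit a b i j" for i j
  proof -
    have *: "(- j = a \<and> - i = b) = (i = - b \<and> j = - a)" "(- j = - b \<and> - i = - a) = (i = a \<and> j = b)" by auto
    show ?thesis unfolding so_unit_def * by (simp only: minus_diff_eq)
  qed
  moreover have "so_unit a b i j = 0" if "i \<notin> box n \<or> j \<notin> box n" for i j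
  proof -
    have *: "\<not> (i = a \<and> j = b)" "\<not> (i = - b \<and> j = - a)" using that ab by auto
    show ?thesis unfolding so_unit_def if_not_P[OF *(1)] if_not_P[OF *(2)] by simp
  qed
  ultimately show ?thesis by (simp add: so_mat_def)
qed

lemma so_unit_flip: "so_unit (- b) (- a) = - so_unit a b"
proof (intro ext)
  fix i j
  show "so_unit (- b) (- a) i j = (- so_unit a b) i j"
    unfolding so_unit_def fun_Compl_def minus_minus by (simp only: minus_diff_eq)
qed

lemma mat_bracket_so_unit:
  assumes "a \<in> box n" "b \<in> box n"
  shows "mat_bracket n (so_unit a b) M i j =
    (if i = a then M b j else 0) - (if i = - b then M (- a) j else 0)
    - (if j = b then M i a else 0) + (if j = - a then M i (- b) else 0)"
proof -
  have "mat_mult n (so_unit a b) M i j =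
     (\<Sum>k\<in>box n. (if k = b then (if i = a then M k j else 0) else 0) - (if k = - a then (if i = - b then M k j else 0) else 0))"
    unfolding mat_mult_def by (intro sum.cong) (auto simp: so_unit_def)
  moreover have "mat_mult n M (so_unit a b) i j =
     (\<Sum>k\<in>box n. (if k = a then (if j = b then M i k else 0) else 0) - (if k = - b then (if j = - a then M i k else 0) else 0))"
    unfolding mat_mult_def by (intro sum.cong) (auto simp: so_unit_def)
  ultimately show ?thesis
    using assms by (simp add: mat_bracket_def sum_subtractf)
qed

section \<open>Diagonal matrices and root components\<close>

definition so_diag :: "nat \<Rightarrow> (int \<Rightarrow> complex) \<Rightarrow> cmat" where
  "so_diag n d = (\<lambda>i j. if i = j \<and> i \<in> box n then d i else 0)"

lemma so_diag_mem: "(\<And>i. d (- i) = - d i) \<Longrightarrow> so_diag n d \<in> so_mat n"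
  by (auto simp: so_mat_def so_diag_def)

lemma mat_bracket_so_diag:
  assumes "M \<in> so_mat n"
  shows "mat_bracket n (so_diag n d) M i j = (d i - d j) * M i j"
proof (cases "i \<in> box n \<and> j \<in> box n")
  case True
  have "mat_mult n (so_diag n d) M i j = (\<Sum>k\<in>box n. if k = i then d i * M k j else 0)"
    unfolding mat_mult_def by (intro sum.cong) (auto simp: so_diag_def)
  moreover have "mat_mult n M (so_diag n d) i j = (\<Sum>k\<in>box n. if k = j then M i k * d j else 0)"
    unfolding mat_mult_def by (intro sum.cong) (auto simp: so_diag_def)
  ultimately show ?thesis using True by (simp add: mat_bracket_def algebra_simps)
next
  case False
  moreover have "mat_bracket n (so_diag n d) M i j = 0"
    using False so_mat_support[OF assms] by (auto simp: mat_bracket_def mat_mult_def so_diag_def)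
  ultimately show ?thesis using so_mat_support[OF assms, of i j] by auto
qed

text \<open>The hypothesis says that all simple roots vanish on the diagonal of M. The middle entry
  of a skew matrix is zero, the equalities carry this down to index -n, and skewness reflects it to
  the positive indices.\<close>

lemma so_mat_diagonal_zero:
  assumes M: "M \<in> so_mat n" and step: "\<And>p. - int n \<le> p \<Longrightarrow> p < 0 \<Longrightarrow> M p p = M (p + 1) (p + 1)"
  shows "M i i = 0"
proof -
  have neg: "M p p = 0" if "p \<le> 0" for p
    using that
  proof (induction p rule: int_le_induct)
    case base then show ?case using so_mat_center[OF M] .
  next
    case (step p)
    show ?case
    proof (cases "- int n \<le> p - 1")
      case True then show ?thesis using step assms(2)[of "p - 1"] by simp
    next
      case False then show ?thesis using so_mat_support[OF M] by auto
    qed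
  qed
  then show ?thesis using neg[of i] neg[of "- i"] so_mat_skew[OF M, of i i] by (cases "i \<le> 0") auto
qed

(* A balanced ternary weight: its differences over so_roots are nonzero and pairwise distinct. *)
definition ternary :: "int \<Rightarrow> int" where
  "ternary p = - sgn p * 3 ^ nat \<bar>p\<bar>"

lemma ternary_odd: "ternary (- p) = - ternary p"
  by (simp add: ternary_def)

lemma ternary_abs: "p \<noteq> 0 \<Longrightarrow> \<bar>ternary p\<bar> = 3 ^ nat \<bar>p\<bar>"
  by (auto simp: ternary_def abs_mult abs_sgn_eq)

lemma ternary_abs_less: "\<bar>q\<bar> < \<bar>p\<bar> \<Longrightarrow> 3 * \<bar>ternary q\<bar> \<le> 3 ^ nat \<bar>p\<bar>"
proof (cases "q = 0")
  case False
  assume "\<bar>q\<bar> < \<bar>p\<bar>"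
  then have "(3::int) ^ Suc (nat \<bar>q\<bar>) \<le> 3 ^ nat \<bar>p\<bar>" by (intro power_increasing) auto
  then show ?thesis using ternary_abs[OF False] by simp
qed (simp add: ternary_def)

lemma ternary_inj: "ternary q = ternary q' \<Longrightarrow> q = q'"
proof -
  assume eq: "ternary q = ternary q'"
  have sgn: "sgn (ternary p) = - sgn p" for p :: int by (auto simp: ternary_def sgn_mult)
  have "sgn q = sgn q'" using eq sgn[of q] sgn[of q'] by simp
  moreover have "\<bar>q\<bar> = \<bar>q'\<bar>"
  proof (cases "q = 0 \<or> q' = 0")
    case True then show ?thesis using \<open>sgn q = sgn q'\<close> by (auto simp: sgn_if split: if_splits)
  next
    case False
    then have "(3::int) ^ nat \<bar>q\<bar> = 3 ^ nat \<bar>q'\<bar>" using eq ternary_abs by metis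
    then have "nat \<bar>q\<bar> = nat \<bar>q'\<bar>" by (subst (asm) power_inject_exp) auto
    then show ?thesis by simp
  qed
  ultimately show ?thesis by (metis mult_sgn_abs)
qed

text \<open>With base 3 the smaller index contributes at most a third of 3^|p|, so the absolute
  value of the difference lies between 2/3 and 4/3 of 3^|p|. These ranges are disjoint for different
  |p|, and the sign of the difference then determines p, hence q.\<close>

lemma ternary_difference_inj:
  assumes "\<bar>q\<bar> < \<bar>p\<bar>" "\<bar>q'\<bar> < \<bar>p'\<bar>" "ternary p - ternary q = ternary p' - ternary q'"
  shows "p = p' \<and> q = q'"
proof -
  have pos: "(3::int) ^ nat \<bar>p\<bar> > 0" "(3::int) ^ nat \<bar>p'\<bar> > 0" by auto
  have "p \<noteq> 0" "p' \<noteq> 0" using assms(1,2) by auto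
  note b = ternary_abs[OF \<open>p \<noteq> 0\<close>] ternary_abs[OF \<open>p' \<noteq> 0\<close>]
    ternary_abs_less[OF assms(1)] ternary_abs_less[OF assms(2)]
  have "\<not> \<bar>p\<bar> < \<bar>p'\<bar>"
  proof
    assume "\<bar>p\<bar> < \<bar>p'\<bar>"
    from ternary_abs_less[OF this] b pos assms(3) show False by linarith
  qed
  moreover have "\<not> \<bar>p'\<bar> < \<bar>p\<bar>"
  proof
    assume "\<bar>p'\<bar> < \<bar>p\<bar>"
    from ternary_abs_less[OF this] b pos assms(3) show False by linarith
  qed
  ultimately have "\<bar>p\<bar> = \<bar>p'\<bar>" by simp
  then have "p = p' \<or> p = - p'" by (auto simp: abs_if split: if_splits)
  moreover have "p \<noteq> - p'"
  proof
    assume "p = - p'"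
    then have "2 * ternary p' = ternary q' - ternary q" using assms(3) ternary_odd[of p'] by simp
    with b(2,3,4) pos(2) show False unfolding \<open>\<bar>p\<bar> = \<bar>p'\<bar>\<close> by linarith
  qed
  ultimately have "p = p'" by simp
  then show ?thesis using assms ternary_inj by auto
qed

(* One index pair from each orbit of (p,q) -> (-q,-p) off the diagonals. *)
definition so_roots :: "nat \<Rightarrow> (int \<times> int) set" where
  "so_roots n = {(p, q). \<bar>q\<bar> < \<bar>p\<bar> \<and> \<bar>p\<bar> \<le> int n}"

lemma finite_so_roots: "finite (so_roots n)"
  by (rule finite_subset[of _ "box n \<times> box n"]) (auto simp: so_roots_def)

lemma so_rootsD: "(p, q) \<in> so_roots n \<Longrightarrow> p \<in> box n \<and> q \<in> box n \<and> p \<noteq> 0 \<and> p \<noteq> q \<and> p \<noteq> - q"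
  by (auto simp: so_roots_def)

lemma so_unit_on_roots:
  assumes "(p, q) \<in> so_roots n" "(p', q') \<in> so_roots n"
  shows "so_unit p' q' p q = (if p' = p \<and> q' = q then 1 else 0)"
proof -
  have *: "\<not> (p = - q' \<and> q = - p')" using assms by (auto simp: so_roots_def)
  show ?thesis
    unfolding so_unit_def if_not_P[OF *] by (simp only: eq_commute[of p p'] eq_commute[of q q'] diff_zero)
qed

lemma so_mat_eqI:
  assumes "M \<in> so_mat n" "N \<in> so_mat n" "\<And>i. M i i = N i i"
    "\<And>p q. (p, q) \<in> so_roots n \<Longrightarrow> M p q = N p q"
  shows "M = N"
proof (intro ext)
  fix i j
  have "i = j \<or> j = - i \<or> (i \<notin> box n \<or> j \<notin> box n) \<or> (i, j) \<in> so_roots n \<or> (- j, - i) \<in> so_roots n"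
    unfolding so_roots_def mem_Collect_eq prod.case atLeastAtMost_iff by linarith
  then consider "i = j" | "j = - i" | "i \<notin> box n \<or> j \<notin> box n" | "(i, j) \<in> so_roots n" | "(- j, - i) \<in> so_roots n"
    by blast
  then show "M i j = N i j"
  proof cases
    case 3
    then show ?thesis using so_mat_support[OF assms(1)] so_mat_support[OF assms(2)] by metis
  next
    case 5
    then show ?thesis using assms(4)[OF 5] so_mat_skew[OF assms(1), of j i] so_mat_skew[OF assms(2), of j i] by simp
  qed (use assms in \<open>auto simp: so_mat_antidiagonal\<close>)
qed

lemma so_mat_decomposition:
  assumes "M \<in> so_mat n"
  shows "M = so_diag n (\<lambda>i. M i i) + (\<Sum>(p,q)\<in>so_roots n. mat_scale (M p q) (so_unit p q))" (is "M = ?D + ?S")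
proof (rule so_mat_eqI[OF assms])
  interpret field_vector_space mat_scale by (rule mat_vector_space)
  have S: "?S i j = (\<Sum>(p,q)\<in>so_roots n. M p q * so_unit p q i j)" for i j
    by (simp add: sum_fun_apply case_prod_unfold)
  show "?D + ?S \<in> so_mat n"
    using so_mat_subspace assms
    by (intro subspace_add subspace_sum so_diag_mem)
       (auto intro!: subspace_scale so_unit_mem simp: so_mat_skew dest!: so_rootsD)
  show "M i i = (?D + ?S) i i" for i
  proof -
    have "?S i i = 0" unfolding S by (rule sum.neutral) (auto simp: so_unit_def so_roots_def)
    then show ?thesis using so_mat_support[OF assms, of i i] by (auto simp: so_diag_def)
  qed
  show "M p q = (?D + ?S) p q" if pq: "(p, q) \<in> so_roots n" for p q
  proof -
    have "?S p q = (\<Sum>z\<in>so_roots n. if z = (p, q) then M p q else 0)"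
      unfolding S by (rule sum.cong) (auto simp: so_unit_on_roots[OF pq] split: if_splits)
    also have "\<dots> = M p q" using pq finite_so_roots by simp
    finally show ?thesis using pq by (auto simp: so_diag_def so_roots_def)
  qed
qed

text \<open>A single diagonal matrix acts for the whole torus: the diagonal part of M has eigenvalue
  0 and the component at (p, q) has eigenvalue ternary p - ternary q. All of these are distinct, so
  \<open>eigen_sum_mem\<close> separates them.\<close>

lemma so_mat_components:
  assumes U: "module.subspace mat_scale U"
    and stable: "\<And>X. X \<in> U \<Longrightarrow> mat_bracket n (so_diag n (\<lambda>i. of_int (ternary i))) X \<in> U"
    and M: "M \<in> so_mat n" "M \<in> U"
  shows "so_diag n (\<lambda>i. M i i) \<in> U" "\<And>p q. (p, q) \<in> so_roots n \<Longrightarrow> M p q \<noteq> 0 \<Longrightarrow> so_unit p q \<in> U"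
proof -
  interpret complex_lie_algebra mat_scale "mat_bracket n" by (rule mat_lie_algebra)
  let ?T = "so_diag n (\<lambda>i. of_int (ternary i))"
  \<comment> \<open>The index (0, 0) is not in \<open>so_roots n\<close> and stands for the diagonal
    part; the test p = 0 recognises it, because every root position has p nonzero.\<close>
  define v where "v = (\<lambda>z. case z of (p, q) \<Rightarrow> if p = 0 then so_diag n (\<lambda>i. M i i) else mat_scale (M p q) (so_unit p q))"
  define w where "w = (\<lambda>z. case z of (p, q) \<Rightarrow> complex_of_int (ternary p - ternary q))"
  have vso: "v z \<in> so_mat n" if "z \<in> insert (0,0) (so_roots n)" for z
    using that so_mat_subspace M
    by (cases z) (auto simp: v_def so_mat_skew dest!: so_rootsD intro!: so_diag_mem subspace_scale so_unit_mem)
  have sum: "(\<Sum>z\<in>insert (0,0) (so_roots n). v z) = M"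
  proof -
    have "(\<Sum>z\<in>insert (0,0) (so_roots n). v z) = v (0,0) + (\<Sum>z\<in>so_roots n. v z)"
      using finite_so_roots by (subst sum.insert) (auto simp: so_roots_def)
    also have "(\<Sum>z\<in>so_roots n. v z) = (\<Sum>(p,q)\<in>so_roots n. mat_scale (M p q) (so_unit p q))"
      by (rule sum.cong) (auto simp: v_def so_roots_def)
    finally show ?thesis using so_mat_decomposition[OF M(1)] by (simp add: v_def)
  qed
  have "\<forall>z\<in>insert (0,0) (so_roots n). v z \<in> U"
  proof (rule eigen_sum_mem[OF linop_bracket[of ?T] U stable])
    show "inj_on w (insert (0,0) (so_roots n))"
    proof (rule inj_onI)
      fix z z' assume z: "z \<in> insert (0,0) (so_roots n)" "z' \<in> insert (0,0) (so_roots n)" "w z = w z'"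
      have nz: "ternary p - ternary q \<noteq> 0" if "(p, q) \<in> so_roots n" for p q
        using that ternary_inj[of p q] by (auto simp: so_roots_def)
      have eq: "ternary (fst z) - ternary (snd z) = ternary (fst z') - ternary (snd z')"
        using z(3) unfolding w_def case_prod_unfold of_int_eq_iff .
      show "z = z'"
        using z(1,2) eq nz[of "fst z" "snd z"] nz[of "fst z'" "snd z'"]
          ternary_difference_inj[of "snd z" "fst z" "snd z'" "fst z'"]
        by (auto simp: so_roots_def)
    qed
    show "mat_bracket n ?T (v z) = mat_scale (w z) (v z)" if "z \<in> insert (0,0) (so_roots n)" for z
    proof (intro ext)
      fix i j
      have "mat_bracket n ?T (v z) i j = of_int (ternary i - ternary j) * v z i j"
        using mat_bracket_so_diag[OF vso[OF that]] by simp
      also have "\<dots> = w z * v z i j"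
        using that by (cases z) (auto simp: v_def w_def so_diag_def so_unit_def ternary_odd dest: so_rootsD)
      finally show "mat_bracket n ?T (v z) i j = mat_scale (w z) (v z) i j" by simp
    qed
  qed (use sum M finite_so_roots in auto)
  then have *: "v (0,0) \<in> U" "\<And>z. z \<in> so_roots n \<Longrightarrow> v z \<in> U" by auto
  show "so_diag n (\<lambda>i. M i i) \<in> U" using *(1) by (simp add: v_def)
  show "so_unit p q \<in> U" if "(p, q) \<in> so_roots n" "M p q \<noteq> 0" for p q
  proof -
    have "mat_scale (M p q) (so_unit p q) \<in> U"
      using *(2)[OF that(1)] so_rootsD[OF that(1)] by (simp add: v_def)
    then show ?thesis using scale_mem_cancel[OF U] that(2) by blast
  qed
qed

section \<open>The isomorphism with the orthogonal Lie algebra\<close>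

locale two_lie_algebras = G: complex_lie_algebra scale bracket + M: complex_lie_algebra scale' bracket'
  for scale :: "complex \<Rightarrow> 'g::ab_group_add \<Rightarrow> 'g" (infixr "*s" 75) and bracket
    and scale' :: "complex \<Rightarrow> 'm::ab_group_add \<Rightarrow> 'm" (infixr "*t" 75) and bracket'
begin

inductive nilpart :: "nat set \<Rightarrow> (nat \<Rightarrow> 'g) \<Rightarrow> (nat \<Rightarrow> 'm) \<Rightarrow> 'g \<Rightarrow> 'm \<Rightarrow> bool"
  for I e e' where
    zero: "nilpart I e e' 0 0"
  | gen: "i \<in> I \<Longrightarrow> nilpart I e e' (e i) (e' i)"
  | add: "nilpart I e e' x x' \<Longrightarrow> nilpart I e e' y y' \<Longrightarrow> nilpart I e e' (x + y) (x' + y')"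
  | scale: "nilpart I e e' x x' \<Longrightarrow> nilpart I e e' (c *s x) (c *t x')"
  | bracket: "i \<in> I \<Longrightarrow> nilpart I e e' x x' \<Longrightarrow> nilpart I e e' (bracket (e i) x) (bracket' (e' i) x')"

definition torus :: "nat set \<Rightarrow> (nat \<Rightarrow> 'g) \<Rightarrow> (nat \<Rightarrow> 'm) \<Rightarrow> 'g \<Rightarrow> 'm \<Rightarrow> bool" where
  "torus I t t' x x' \<longleftrightarrow> (\<exists>c. x = (\<Sum>i\<in>I. c i *s t i) \<and> x' = (\<Sum>i\<in>I. c i *t t' i))"

lemma torus_0: "torus I t t' 0 0"
  unfolding torus_def by (rule exI[of _ "\<lambda>_. 0"]) simp

lemma torus_gen: "finite I \<Longrightarrow> i \<in> I \<Longrightarrow> torus I t t' (t i) (t' i)"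
  unfolding torus_def
  by (rule exI[of _ "\<lambda>j. if j = i then 1 else 0"]) (simp add: if_distrib[of "\<lambda>c. c *s _"] if_distrib[of "\<lambda>c. c *t _"] cong: if_cong)

lemma torus_add: "torus I t t' x x' \<Longrightarrow> torus I t t' y y' \<Longrightarrow> torus I t t' (x + y) (x' + y')"
proof -
  assume "torus I t t' x x'" "torus I t t' y y'"
  then obtain c d where "x = (\<Sum>i\<in>I. c i *s t i)" "x' = (\<Sum>i\<in>I. c i *t t' i)"
    "y = (\<Sum>i\<in>I. d i *s t i)" "y' = (\<Sum>i\<in>I. d i *t t' i)" by (auto simp: torus_def)
  then show ?thesis unfolding torus_def
    by (intro exI[of _ "\<lambda>i. c i + d i"]) (simp add: sum.distrib G.scale_left_distrib M.scale_left_distrib)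
qed

lemma torus_scale: "torus I t t' x x' \<Longrightarrow> torus I t t' (a *s x) (a *t x')"
proof -
  assume "torus I t t' x x'"
  then obtain c where "x = (\<Sum>i\<in>I. c i *s t i)" "x' = (\<Sum>i\<in>I. c i *t t' i)" by (auto simp: torus_def)
  then show ?thesis unfolding torus_def
    by (intro exI[of _ "\<lambda>i. a * c i"]) (simp add: G.scale_sum_right M.scale_sum_right)
qed

lemma torus_uminus: "torus I (\<lambda>i. - t i) (\<lambda>i. - t' i) = torus I t t'"
proof -
  have *: "torus I t t' x x'" if "torus I (\<lambda>i. - t i) (\<lambda>i. - t' i) x x'" for t t' x x'
  proof -
    from that obtain c where "x = (\<Sum>i\<in>I. c i *s (- t i))" "x' = (\<Sum>i\<in>I. c i *t (- t' i))"
      by (auto simp: torus_def)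
    then show ?thesis unfolding torus_def by (intro exI[of _ "\<lambda>i. - c i"]) simp
  qed
  show ?thesis using *[of t t'] *[of "\<lambda>i. - t i" "\<lambda>i. - t' i"] by (auto simp: fun_eq_iff)
qed

lemma nilpart_weight:
  assumes "\<And>i. i \<in> I \<Longrightarrow> bracket k (e i) = c i *s e i" "\<And>i. i \<in> I \<Longrightarrow> bracket' k' (e' i) = c i *t e' i"
  shows "nilpart I e e' x x' \<Longrightarrow> nilpart I e e' (bracket k x) (bracket' k' x')"
proof (induction rule: nilpart.induct)
  case (bracket i x x')
  have "bracket k (bracket (e i) x) = c i *s bracket (e i) x + bracket (e i) (bracket k x)"
    "bracket' k' (bracket' (e' i) x') = c i *t bracket' (e' i) x' + bracket' (e' i) (bracket' k' x')"
    using G.jacobi_derivation[of k "e i" x] M.jacobi_derivation[of k' "e' i" x'] assms bracket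
    by (simp_all add: G.bracket_scale_left M.bracket_scale_left)
  then show ?case using bracket by (simp add: nilpart.add nilpart.scale nilpart.bracket)
qed (auto simp: assms G.bracket_add_right M.bracket_add_right G.bracket_scale_right M.bracket_scale_right
      intro: nilpart.intros)

text \<open>Moving f_j past e_i leaves [t_i, x], again a combination of nested brackets, and
  [e_i, k] for a torus element k is a multiple of e_i. A torus contribution therefore survives only
  for a single generator. The lemma is applied a second time with the roles of e and f
  exchanged.\<close>

lemma nilpart_cross:
  assumes fin: "finite I"
    and fe: "\<And>i j. i \<in> I \<Longrightarrow> j \<in> I \<Longrightarrow> bracket (f j) (e i) = (if i = j then t i else 0)"
      "\<And>i j. i \<in> I \<Longrightarrow> j \<in> I \<Longrightarrow> bracket' (f' j) (e' i) = (if i = j then t' i else 0)"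
    and te: "\<And>i j. i \<in> I \<Longrightarrow> j \<in> I \<Longrightarrow> bracket (t j) (e i) = a i j *s e i"
      "\<And>i j. i \<in> I \<Longrightarrow> j \<in> I \<Longrightarrow> bracket' (t' j) (e' i) = a i j *t e' i"
    and j: "j \<in> I"
  shows "nilpart I e e' x x' \<Longrightarrow> \<exists>y y' k k'. nilpart I e e' y y' \<and> torus I t t' k k' \<and>
     bracket (f j) x = y + k \<and> bracket' (f' j) x' = y' + k'"
proof (induction rule: nilpart.induct)
  case zero
  show ?case
    by (intro exI[of _ "0::'g"] exI[of _ "0::'m"]) (simp add: nilpart.zero torus_0)
next
  case (gen i)
  have "torus I t t' (if i = j then t i else 0) (if i = j then t' i else 0)"
    using torus_0 torus_gen[OF fin gen] by (cases "i = j") auto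
  then show ?case
    by (intro exI[of _ "0::'g"] exI[of _ "0::'m"] exI[of _ "if i = j then t i else 0"]
        exI[of _ "if i = j then t' i else 0"]) (simp add: nilpart.zero fe[OF gen j])
next
  case (add x x' y y')
  obtain z z' k k' where *: "nilpart I e e' z z'" "torus I t t' k k'"
    "bracket (f j) x = z + k" "bracket' (f' j) x' = z' + k'" using add.IH(1) by metis
  obtain w w' l l' where **: "nilpart I e e' w w'" "torus I t t' l l'"
    "bracket (f j) y = w + l" "bracket' (f' j) y' = w' + l'" using add.IH(2) by metis
  from * ** have "bracket (f j) (x + y) = (z + w) + (k + l)" "bracket' (f' j) (x' + y') = (z' + w') + (k' + l')"
    by (simp_all add: G.bracket_add_right M.bracket_add_right)
  then show ?case using nilpart.add[OF *(1) **(1)] torus_add[OF *(2) **(2)] by blast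
next
  case (scale x x' c)
  obtain z z' k k' where *: "nilpart I e e' z z'" "torus I t t' k k'"
    "bracket (f j) x = z + k" "bracket' (f' j) x' = z' + k'" using scale.IH by metis
  from * have "bracket (f j) (c *s x) = c *s z + c *s k" "bracket' (f' j) (c *t x') = c *t z' + c *t k'"
    by (simp_all add: G.bracket_scale_right M.bracket_scale_right G.scale_right_distrib M.scale_right_distrib)
  then show ?case using nilpart.scale[OF *(1)] torus_scale[OF *(2)] by blast
next
  case (bracket i x x')
  obtain z z' k k' where *: "nilpart I e e' z z'" "torus I t t' k k'"
    "bracket (f j) x = z + k" "bracket' (f' j) x' = z' + k'" using bracket.IH by metis
  obtain c where c: "k = (\<Sum>i\<in>I. c i *s t i)" "k' = (\<Sum>i\<in>I. c i *t t' i)" using *(2) by (auto simp: torus_def)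
  have ek: "bracket (e i) k = (- (\<Sum>l\<in>I. c l * a i l)) *s e i" "bracket' (e' i) k' = (- (\<Sum>l\<in>I. c l * a i l)) *t e' i"
  proof -
    have "bracket (e i) (t l) = (- a i l) *s e i" "bracket' (e' i) (t' l) = (- a i l) *t e' i" if "l \<in> I" for l
      using te[OF bracket(1) that] G.bracket_skew[of "e i" "t l"] M.bracket_skew[of "e' i" "t' l"] by simp_all
    then show "bracket (e i) k = (- (\<Sum>l\<in>I. c l * a i l)) *s e i" "bracket' (e' i) k' = (- (\<Sum>l\<in>I. c l * a i l)) *t e' i"
      unfolding c
      by (simp_all add: G.linop_sum[OF G.linop_bracket] M.linop_sum[OF M.linop_bracket]
          G.bracket_scale_right M.bracket_scale_right sum_negf G.scale_sum_left M.scale_sum_left)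
  qed
  define y where "y = bracket (if i = j then t i else 0) x + bracket (e i) z + bracket (e i) k"
  define y' where "y' = bracket' (if i = j then t' i else 0) x' + bracket' (e' i) z' + bracket' (e' i) k'"
  have "nilpart I e e' (bracket (if i = j then t i else 0) x) (bracket' (if i = j then t' i else 0) x')"
    using nilpart_weight[of I "t i" e "\<lambda>l. a l i" "t' i" e', OF te(1)[OF _ bracket(1)] te(2)[OF _ bracket(1)] bracket(2)]
      nilpart.zero by (cases "i = j") auto
  then have "nilpart I e e' y y'"
    unfolding y_def y'_def ek using bracket(1) *(1) by (intro nilpart.intros)
  moreover have "bracket (f j) (bracket (e i) x) = y + 0" "bracket' (f' j) (bracket' (e' i) x') = y' + 0"
    using G.jacobi_derivation[of "f j" "e i" x] M.jacobi_derivation[of "f' j" "e' i" x'] * fe[OF bracket(1) j]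
    by (simp_all add: y_def y'_def G.bracket_add_right M.bracket_add_right add.assoc)
  ultimately show ?case using torus_0 by blast
qed

end

text \<open>One matrix \<open>a\<close> gives the torus weights in both algebras; this shared matrix
  is what makes the generated set of pairs small.\<close>

locale chevalley_pairs = two_lie_algebras scale bracket scale' bracket'
  for scale :: "complex \<Rightarrow> 'g::ab_group_add \<Rightarrow> 'g" (infixr "*s" 75) and bracket
    and scale' :: "complex \<Rightarrow> 'm::ab_group_add \<Rightarrow> 'm" (infixr "*t" 75) and bracket' +
  fixes I :: "nat set" and e f t :: "nat \<Rightarrow> 'g" and e' f' t' :: "nat \<Rightarrow> 'm" and a :: "nat \<Rightarrow> nat \<Rightarrow> complex"
  assumes finI: "finite I"
    and ef: "\<And>i j. i \<in> I \<Longrightarrow> j \<in> I \<Longrightarrow> bracket (e i) (f j) = (if i = j then t i else 0)"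
    and ef': "\<And>i j. i \<in> I \<Longrightarrow> j \<in> I \<Longrightarrow> bracket' (e' i) (f' j) = (if i = j then t' i else 0)"
    and te: "\<And>i j. i \<in> I \<Longrightarrow> j \<in> I \<Longrightarrow> bracket (t j) (e i) = a i j *s e i"
    and te': "\<And>i j. i \<in> I \<Longrightarrow> j \<in> I \<Longrightarrow> bracket' (t' j) (e' i) = a i j *t e' i"
    and tf: "\<And>i j. i \<in> I \<Longrightarrow> j \<in> I \<Longrightarrow> bracket (t j) (f i) = (- a i j) *s f i"
    and tf': "\<And>i j. i \<in> I \<Longrightarrow> j \<in> I \<Longrightarrow> bracket' (t' j) (f' i) = (- a i j) *t f' i"
begin

(* The subalgebra of the direct sum generated by the pairs (e_i, e'_i) and (f_i, f'_i), in its triangular decomposition. *)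
definition graph :: "'g \<Rightarrow> 'm \<Rightarrow> bool" where
  "graph x x' \<longleftrightarrow> (\<exists>y y' k k' z z'. nilpart I f f' y y' \<and> torus I t t' k k' \<and> nilpart I e e' z z' \<and>
     x = y + k + z \<and> x' = y' + k' + z')"

lemma graphI: "nilpart I f f' y y' \<Longrightarrow> torus I t t' k k' \<Longrightarrow> nilpart I e e' z z' \<Longrightarrow> graph (y + k + z) (y' + k' + z')"
  unfolding graph_def by blast

lemma graph_pos: "nilpart I e e' z z' \<Longrightarrow> graph z z'"
  using graphI[OF nilpart.zero torus_0] by simp

lemma graph_neg: "nilpart I f f' y y' \<Longrightarrow> graph y y'"
  using graphI[OF _ torus_0 nilpart.zero] by simp

lemma graph_torus: "torus I t t' k k' \<Longrightarrow> graph k k'"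
  using graphI[OF nilpart.zero _ nilpart.zero] by simp

lemma graph_add: "graph x x' \<Longrightarrow> graph y y' \<Longrightarrow> graph (x + y) (x' + y')"
proof -
  assume "graph x x'" "graph y y'"
  then obtain a a' b b' c c' d d' k k' l l' where *: "nilpart I f f' a a'" "torus I t t' k k'" "nilpart I e e' b b'"
     "nilpart I f f' c c'" "torus I t t' l l'" "nilpart I e e' d d'"
     "x = a + k + b" "x' = a' + k' + b'" "y = c + l + d" "y' = c' + l' + d'"
    unfolding graph_def by blast
  then have "x + y = (a + c) + (k + l) + (b + d)" "x' + y' = (a' + c') + (k' + l') + (b' + d')"
    by (simp_all add: algebra_simps)
  then show ?thesis using * graphI nilpart.add torus_add by metis
qed

lemma graph_scale: "graph x x' \<Longrightarrow> graph (c *s x) (c *t x')"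
proof -
  assume "graph x x'"
  then obtain a a' b b' k k' where *: "nilpart I f f' a a'" "torus I t t' k k'" "nilpart I e e' b b'"
     "x = a + k + b" "x' = a' + k' + b'"
    unfolding graph_def by blast
  then have "c *s x = c *s a + c *s k + c *s b" "c *t x' = c *t a' + c *t k' + c *t b'"
    by (simp_all add: G.scale_right_distrib M.scale_right_distrib)
  then show ?thesis using * graphI nilpart.scale torus_scale by metis
qed

lemma graph_0: "graph 0 0"
  using graph_torus torus_0 by blast

lemma graph_diff: "graph x x' \<Longrightarrow> graph y y' \<Longrightarrow> graph (x - y) (x' - y')"
  using graph_add[of x x' "(-1) *s y" "(-1) *t y'"] graph_scale[of y y' "-1"] by simp

lemma fe: "i \<in> I \<Longrightarrow> j \<in> I \<Longrightarrow> bracket (f j) (e i) = (if i = j then - t i else 0)"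
  and fe': "i \<in> I \<Longrightarrow> j \<in> I \<Longrightarrow> bracket' (f' j) (e' i) = (if i = j then - t' i else 0)"
  using ef[of i j] ef'[of i j] G.bracket_skew[of "f j" "e i"] M.bracket_skew[of "f' j" "e' i"] by simp_all

lemma graph_bracket_e:
  assumes j: "j \<in> I" and g: "graph x x'"
  shows "graph (bracket (e j) x) (bracket' (e' j) x')"
proof -
  obtain y y' k k' z z' where *: "nilpart I f f' y y'" "torus I t t' k k'" "nilpart I e e' z z'"
     "x = y + k + z" "x' = y' + k' + z'"
    using g unfolding graph_def by blast
  have "\<exists>u u' l l'. nilpart I f f' u u' \<and> torus I t t' l l' \<and>
     bracket (e j) y = u + l \<and> bracket' (e' j) y' = u' + l'"
    by (rule nilpart_cross[where a="\<lambda>i j. - a i j"]) (use finI ef ef' tf tf' j *(1) in auto)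
  then obtain u u' l l' where u: "nilpart I f f' u u'" "torus I t t' l l'"
     "bracket (e j) y = u + l" "bracket' (e' j) y' = u' + l'"
    by blast
  have "graph (bracket (e j) k) (bracket' (e' j) k')"
  proof -
    obtain c where c: "k = (\<Sum>i\<in>I. c i *s t i)" "k' = (\<Sum>i\<in>I. c i *t t' i)" using *(2) by (auto simp: torus_def)
    have "bracket (e j) (t i) = (- a j i) *s e j" "bracket' (e' j) (t' i) = (- a j i) *t e' j" if "i \<in> I" for i
      using te[OF j that] te'[OF j that] G.bracket_skew[of "e j" "t i"] M.bracket_skew[of "e' j" "t' i"] by simp_all
    then have "bracket (e j) k = (\<Sum>i\<in>I. c i * (- a j i)) *s e j" "bracket' (e' j) k' = (\<Sum>i\<in>I. c i * (- a j i)) *t e' j"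
      unfolding c
      by (simp_all add: G.linop_sum[OF G.linop_bracket] M.linop_sum[OF M.linop_bracket]
          G.bracket_scale_right M.bracket_scale_right G.scale_sum_left M.scale_sum_left)
    then show ?thesis using graph_scale[OF graph_pos[OF nilpart.gen[OF j]]] by simp
  qed
  moreover have "graph (bracket (e j) y) (bracket' (e' j) y')"
    unfolding u(3,4) using graph_add[OF graph_neg[OF u(1)] graph_torus[OF u(2)]] .
  moreover have "graph (bracket (e j) z) (bracket' (e' j) z')"
    using graph_pos[OF nilpart.bracket[OF j *(3)]] .
  ultimately show ?thesis
    unfolding *(4,5) G.bracket_add_right M.bracket_add_right by (intro graph_add)
qed

lemma graph_bracket_f:
  assumes j: "j \<in> I" and g: "graph x x'"
  shows "graph (bracket (f j) x) (bracket' (f' j) x')"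
proof -
  obtain y y' k k' z z' where *: "nilpart I f f' y y'" "torus I t t' k k'" "nilpart I e e' z z'"
     "x = y + k + z" "x' = y' + k' + z'"
    using g unfolding graph_def by blast
  have "\<exists>u u' l l'. nilpart I e e' u u' \<and> torus I (\<lambda>i. - t i) (\<lambda>i. - t' i) l l' \<and>
     bracket (f j) z = u + l \<and> bracket' (f' j) z' = u' + l'"
    by (rule nilpart_cross[where a="\<lambda>i j. - a i j"])
       (use finI fe fe' te te' j *(3) in \<open>auto simp: G.bracket_minus_left M.bracket_minus_left\<close>)
  then obtain u u' l l' where u: "nilpart I e e' u u'" "torus I t t' l l'"
     "bracket (f j) z = u + l" "bracket' (f' j) z' = u' + l'"
    unfolding torus_uminus by blast
  have "graph (bracket (f j) k) (bracket' (f' j) k')"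
  proof -
    obtain c where c: "k = (\<Sum>i\<in>I. c i *s t i)" "k' = (\<Sum>i\<in>I. c i *t t' i)" using *(2) by (auto simp: torus_def)
    have "bracket (f j) (t i) = a j i *s f j" "bracket' (f' j) (t' i) = a j i *t f' j" if "i \<in> I" for i
      using tf[OF j that] tf'[OF j that] G.bracket_skew[of "f j" "t i"] M.bracket_skew[of "f' j" "t' i"] by simp_all
    then have "bracket (f j) k = (\<Sum>i\<in>I. c i * a j i) *s f j" "bracket' (f' j) k' = (\<Sum>i\<in>I. c i * a j i) *t f' j"
      unfolding c
      by (simp_all add: G.linop_sum[OF G.linop_bracket] M.linop_sum[OF M.linop_bracket]
          G.bracket_scale_right M.bracket_scale_right G.scale_sum_left M.scale_sum_left)
    then show ?thesis using graph_scale[OF graph_neg[OF nilpart.gen[OF j]]] by simp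
  qed
  moreover have "graph (bracket (f j) z) (bracket' (f' j) z')"
    unfolding u(3,4) using graph_add[OF graph_pos[OF u(1)] graph_torus[OF u(2)]] .
  moreover have "graph (bracket (f j) y) (bracket' (f' j) y')"
    using graph_neg[OF nilpart.bracket[OF j *(1)]] .
  ultimately show ?thesis
    unfolding *(4,5) G.bracket_add_right M.bracket_add_right by (intro graph_add)
qed

text \<open>The pairs whose bracket preserves \<open>graph\<close> are closed under linear
  combinations and, by the Jacobi identity, under brackets. They include the generators, hence all
  of \<open>graph\<close>, so stability under the generators is enough for \<open>graph\<close> to
  be a subalgebra.\<close>

definition normalizes :: "'g \<Rightarrow> 'm \<Rightarrow> bool" where
  "normalizes x x' \<longleftrightarrow> (\<forall>y y'. graph y y' \<longrightarrow> graph (bracket x y) (bracket' x' y'))"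

lemma normalizes_add: "normalizes x x' \<Longrightarrow> normalizes y y' \<Longrightarrow> normalizes (x + y) (x' + y')"
  by (simp add: normalizes_def G.bracket_add_left M.bracket_add_left graph_add)

lemma normalizes_scale: "normalizes x x' \<Longrightarrow> normalizes (c *s x) (c *t x')"
  by (simp add: normalizes_def G.bracket_scale_left M.bracket_scale_left graph_scale)

lemma normalizes_bracket:
  assumes "normalizes x x'" "normalizes y y'"
  shows "normalizes (bracket x y) (bracket' x' y')"
  unfolding normalizes_def
proof (intro allI impI)
  fix z z' assume "graph z z'"
  then have "graph (bracket x (bracket y z) - bracket y (bracket x z)) (bracket' x' (bracket' y' z') - bracket' y' (bracket' x' z'))"
    using assms by (intro graph_diff) (auto simp: normalizes_def)
  then show "graph (bracket (bracket x y) z) (bracket' (bracket' x' y') z')"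
    using G.jacobi_derivation[of x y z] M.jacobi_derivation[of x' y' z'] by simp
qed

lemma normalizes_nilpart:
  assumes "\<And>i. i \<in> I \<Longrightarrow> normalizes (d i) (d' i)"
  shows "nilpart I d d' x x' \<Longrightarrow> normalizes x x'"
  by (induction rule: nilpart.induct)
     (auto simp: assms normalizes_add normalizes_scale normalizes_bracket, simp add: normalizes_def graph_0)

lemma normalizes_gens: "i \<in> I \<Longrightarrow> normalizes (e i) (e' i)" "i \<in> I \<Longrightarrow> normalizes (f i) (f' i)"
  by (auto simp: normalizes_def graph_bracket_e graph_bracket_f)

lemma graph_bracket:
  assumes "graph x x'" "graph y y'"
  shows "graph (bracket x y) (bracket' x' y')"
proof -
  have t: "normalizes (t i) (t' i)" if "i \<in> I" for i
    using normalizes_bracket[OF normalizes_gens[OF that]] ef[OF that that] ef'[OF that that] by simp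
  have "normalizes (\<Sum>i\<in>J. c i *s t i) (\<Sum>i\<in>J. c i *t t' i)" if "J \<subseteq> I" for J c
    using finite_subset[OF that finI] that
  proof (induction J rule: finite_induct)
    case empty
    show ?case by (simp add: normalizes_def graph_0)
  next
    case (insert i J)
    then show ?case using t by (simp add: normalizes_add normalizes_scale)
  qed
  then have torus: "normalizes k k'" if "torus I t t' k k'" for k k'
    using that by (auto simp: torus_def)
  obtain u u' k k' z z' where *: "nilpart I f f' u u'" "torus I t t' k k'" "nilpart I e e' z z'"
     "x = u + k + z" "x' = u' + k' + z'"
    using assms unfolding graph_def by blast
  have "normalizes x x'"
    unfolding *(4,5)
    using normalizes_nilpart[OF normalizes_gens(2) *(1)] torus[OF *(2)] normalizes_nilpart[OF normalizes_gens(1) *(3)]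
    by (intro normalizes_add)
  then show ?thesis using assms by (simp add: normalizes_def)
qed

lemma graph_fst_subspace: "G.subspace {x. \<exists>x'. graph x x'}"
  unfolding G.subspace_def using graph_0 graph_add graph_scale by blast

lemma graph_snd_subspace: "M.subspace {x'. \<exists>x. graph x x'}"
  unfolding M.subspace_def using graph_0 graph_add graph_scale by blast

lemma kernel_fst_subspace: "G.subspace {x. graph x 0}"
  unfolding G.subspace_def using graph_0 graph_add[of _ 0 _ 0] graph_scale[of _ 0] by auto

lemma kernel_snd_subspace: "M.subspace {x'. graph 0 x'}"
  unfolding M.subspace_def using graph_0 graph_add[of 0 _ 0] graph_scale[of 0] by auto

end

section \<open>Chevalley generators of so(2n+1)\<close>

definition mat_unit :: "int \<Rightarrow> int \<Rightarrow> cmat" where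
  "mat_unit a b = (\<lambda>i j. if i = a \<and> j = b then 1 else 0)"

lemma so_unit_mat_unit: "so_unit a b = mat_unit a b - mat_unit (- b) (- a)"
  by (simp add: so_unit_def mat_unit_def fun_eq_iff)

lemma mat_mult_unit:
  assumes "b \<in> box n"
  shows "mat_mult n (mat_unit a b) (mat_unit c d) = (if b = c then mat_unit a d else 0)"
proof (intro ext)
  fix i j
  have "mat_mult n (mat_unit a b) (mat_unit c d) i j =
     (\<Sum>k\<in>box n. if k = b then (if i = a \<and> b = c \<and> j = d then 1 else 0) else 0)"
    unfolding mat_mult_def by (intro sum.cong) (auto simp: mat_unit_def)
  also have "\<dots> = (if b = c then mat_unit a d else 0) i j"
    using assms by (simp add: mat_unit_def)
  finally show "mat_mult n (mat_unit a b) (mat_unit c d) i j = (if b = c then mat_unit a d else 0) i j" .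
qed

lemma so_unit_commutator:
  assumes "a \<in> box n" "b \<in> box n" "c \<in> box n" "d \<in> box n"
  shows "mat_bracket n (so_unit a b) (so_unit c d) =
    (if b = c then so_unit a d else 0) - (if a = d then so_unit c b else 0)
    - (if b = - d then so_unit a (- c) else 0) - (if a = - c then so_unit (- b) d else 0)"
proof -
  have neg: "- a \<in> box n" "- b \<in> box n" "- c \<in> box n" "- d \<in> box n" using assms by auto
  have eqs: "(- a = - d) = (a = d)" "(- c = - b) = (b = c)" "(- a = c) = (a = - c)" "(- c = a) = (a = - c)"
    "(d = - b) = (b = - d)" "(d = a) = (a = d)" by auto
  show ?thesis
    unfolding so_unit_mat_unit mat_bracket_def mat_mult_diff_left mat_mult_diff_right
      mat_mult_unit[OF assms(2)] mat_mult_unit[OF assms(4)] mat_mult_unit[OF neg(1)] mat_mult_unit[OF neg(3)] eqs minus_minus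
    by (cases "b = c"; cases "a = d"; cases "b = - d"; cases "a = - c")
       (simp_all only: if_True if_False simp_thms diff_0_right add_0, simp_all)
qed

lemma so_unit_diag_commutator:
  assumes "q \<in> box n" "a \<in> box n" "b \<in> box n"
  shows "mat_bracket n (so_unit q q) (so_unit a b) =
    mat_scale ((if q = a then 1 else 0) - (if q = b then 1 else 0) + (if q = - b then 1 else 0) - (if q = - a then 1 else 0))
      (so_unit a b)"
proof -
  have 1: "(if q = a then so_unit q b else 0) = mat_scale (if q = a then 1 else 0) (so_unit a b)"
    by (simp add: fun_eq_iff)
  have 2: "(if q = b then so_unit a q else 0) = mat_scale (if q = b then 1 else 0) (so_unit a b)"
    by (simp add: fun_eq_iff)
  have 3: "(if q = - b then so_unit q (- a) else 0) = mat_scale (if q = - b then - 1 else 0) (so_unit a b)"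
    using so_unit_flip[of b a] by (simp add: fun_eq_iff)
  have 4: "(if q = - a then so_unit (- q) b else 0) = mat_scale (if q = - a then 1 else 0) (so_unit a b)"
    by (simp add: fun_eq_iff)
  show ?thesis
    unfolding so_unit_commutator[OF assms(1) assms(1) assms(2,3)] 1 2 3 4
    by (simp add: fun_eq_iff algebra_simps)
qed

text \<open>The k-th simple root vector sits right above the diagonal in this row. The rows run from
  -n to -1, and k = n gives position (-1, 0), the short root.\<close>

definition simple_row :: "nat \<Rightarrow> nat \<Rightarrow> int" where "simple_row n k = int k - 1 - int n"

definition so_e :: "nat \<Rightarrow> nat \<Rightarrow> cmat" where
  "so_e n k = so_unit (simple_row n k) (simple_row n k + 1)"

(* The factor 2 normalises the coroot of the short simple root. *)
definition so_f :: "nat \<Rightarrow> nat \<Rightarrow> cmat" where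
  "so_f n k = mat_scale (if k = n then 2 else 1) (so_unit (simple_row n k + 1) (simple_row n k))"

definition so_h :: "nat \<Rightarrow> nat \<Rightarrow> cmat" where
  "so_h n k = mat_scale (if k = n then 2 else 1) (so_unit (simple_row n k) (simple_row n k) - so_unit (simple_row n k + 1) (simple_row n k + 1))"

lemma simple_row_bounds: "k \<in> {1..n} \<Longrightarrow> simple_row n k \<in> box n \<and> simple_row n k + 1 \<in> box n \<and> simple_row n k < 0"
  by (auto simp: simple_row_def)

lemma so_e_so_f:
  assumes "i \<in> {1..n}" "j \<in> {1..n}"
  shows "mat_bracket n (so_e n i) (so_f n j) = (if i = j then so_h n i else 0)"
proof -
  interpret complex_lie_algebra mat_scale "mat_bracket n" by (rule mat_lie_algebra)
  note b = simple_row_bounds[OF assms(1)] simple_row_bounds[OF assms(2)]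
  have c: "(simple_row n i + 1 = simple_row n j + 1) = (i = j)" "(simple_row n i = simple_row n j) = (i = j)"
    "\<not> (simple_row n i + 1 = - simple_row n j)" "\<not> (simple_row n i = - (simple_row n j + 1))"
    using b by (auto simp: simple_row_def)
  have "mat_bracket n (so_unit (simple_row n i) (simple_row n i + 1)) (so_unit (simple_row n j + 1) (simple_row n j)) =
     (if i = j then so_unit (simple_row n i) (simple_row n i) - so_unit (simple_row n i + 1) (simple_row n i + 1) else 0)"
    using b by (subst so_unit_commutator) (simp_all only: c if_False, auto)
  then show ?thesis by (simp add: so_e_def so_f_def so_h_def bracket_scale_right)
qed

lemma so_h_weight:
  assumes "i \<in> {1..n}" "j \<in> {1..n}"
  shows "mat_bracket n (so_h n j) (so_unit (simple_row n i) (simple_row n i + 1)) =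
      mat_scale (of_int (cartan_matrix_B n i j)) (so_unit (simple_row n i) (simple_row n i + 1))" (is ?E)
    and "mat_bracket n (so_h n j) (so_unit (simple_row n i + 1) (simple_row n i)) =
      mat_scale (- of_int (cartan_matrix_B n i j)) (so_unit (simple_row n i + 1) (simple_row n i))" (is ?F)
proof -
  interpret complex_lie_algebra mat_scale "mat_bracket n" by (rule mat_lie_algebra)
  let ?p = "simple_row n i" and ?q = "simple_row n j"
  note b = simple_row_bounds[OF assms(1)] simple_row_bounds[OF assms(2)]
  have c: "(?q = ?p) = (i = j)" "(?q = ?p + 1) = (j = Suc i)" "\<not> ?q = - ?p" "(?q = - (?p + 1)) = False"
     "(?q + 1 = ?p) = (i = Suc j)" "(?q + 1 = ?p + 1) = (i = j)" "(?q + 1 = - ?p) = False" "(?q + 1 = - (?p + 1)) = (i = n \<and> j = n)"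
    using b assms by (auto simp: simple_row_def)
  \<comment> \<open>The last summand belongs to the index \<open>simple_row n n + 1\<close> = 0,
    which equals its own negative, so that \<open>so_unit 0 0\<close> = 0. Without it the factor 2
    would produce 4 on the diagonal at i = j = n.\<close>
  have 1: "complex_of_int (cartan_matrix_B n i j) = (if j = n then 2 else 1) *
     ((if i = j then 1 else 0) - (if j = Suc i then 1 else 0)
      - ((if i = Suc j then 1 else 0) - (if i = j then 1 else 0) + (if i = n \<and> j = n then 1 else 0)))"
    using assms by (auto simp: cartan_matrix_B_deltas)
  show ?E
    using b unfolding so_h_def bracket_scale_left bracket_diff_left
    by (subst (1 2) so_unit_diag_commutator) (simp_all only: c if_False, auto simp: 1 fun_eq_iff algebra_simps)
  show ?F
    using b unfolding so_h_def bracket_scale_left bracket_diff_left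
    by (subst (1 2) so_unit_diag_commutator) (simp_all only: c if_False, auto simp: 1 fun_eq_iff algebra_simps)
qed

lemma so_e_mem: "k \<in> {1..n} \<Longrightarrow> so_e n k \<in> so_mat n"
  unfolding so_e_def using simple_row_bounds by (intro so_unit_mem) auto

lemma so_f_mem: "k \<in> {1..n} \<Longrightarrow> so_f n k \<in> so_mat n"
proof -
  assume k: "k \<in> {1..n}"
  interpret complex_lie_algebra mat_scale "mat_bracket n" by (rule mat_lie_algebra)
  show ?thesis unfolding so_f_def using simple_row_bounds[OF k] by (intro subspace_scale[OF so_mat_subspace] so_unit_mem) auto
qed

lemma so_h_mem: "k \<in> {1..n} \<Longrightarrow> so_h n k \<in> so_mat n"
proof -
  assume k: "k \<in> {1..n}"
  interpret complex_lie_algebra mat_scale "mat_bracket n" by (rule mat_lie_algebra)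
  show ?thesis unfolding so_h_def using simple_row_bounds[OF k]
    by (intro subspace_scale[OF so_mat_subspace] subspace_diff[OF so_mat_subspace] so_unit_mem) auto
qed

lemma so_unit_diagonal: "i \<noteq> j \<Longrightarrow> so_unit q q i j = 0"
  unfolding so_unit_def by (cases "i = q"; cases "i = - q") auto

lemma so_h_diagonal: "i \<noteq> j \<Longrightarrow> so_h n k i j = 0"
  by (simp add: so_h_def so_unit_diagonal)

lemma so_diag_sum:
  assumes "\<And>i. d (- i) = - d i"
  shows "so_diag n d = (\<Sum>p=1..n. mat_scale (d (- int p)) (so_unit (- int p) (- int p)))"
proof (intro ext)
  fix i j
  have d0: "d 0 = 0" using assms[of 0] by simp
  have "(\<Sum>p=1..n. mat_scale (d (- int p)) (so_unit (- int p) (- int p))) i j =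
     (\<Sum>p=1..n. d (- int p) * so_unit (- int p) (- int p) i j)" by (simp add: sum_fun_apply)
  also have "\<dots> = so_diag n d i j"
  proof (cases "i = j")
    case False
    then show ?thesis by (simp add: so_unit_diagonal so_diag_def)
  next
    case True
    have "(\<Sum>p=1..n. d (- int p) * so_unit (- int p) (- int p) i i) =
       (\<Sum>p=1..n. if p = nat \<bar>i\<bar> then d i else 0)"
    proof (rule sum.cong)
      fix p assume p: "p \<in> {1..n}"
      show "d (- int p) * so_unit (- int p) (- int p) i i = (if p = nat \<bar>i\<bar> then d i else 0)"
        unfolding so_unit_def using assms[of "int p"] p by (cases "i = int p"; cases "i = - int p") auto
    qed simp
    also have "\<dots> = (if nat \<bar>i\<bar> \<in> {1..n} then d i else 0)" by simp
    also have "\<dots> = so_diag n d i i" using d0 by (cases "i = 0") (auto simp: so_diag_def)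
    finally show ?thesis using True by simp
  qed
  finally show "so_diag n d i j = (\<Sum>p=1..n. mat_scale (d (- int p)) (so_unit (- int p) (- int p))) i j" by simp
qed

text \<open>The superdiagonal and subdiagonal units in the nonnegative rows are flips of the given
  ones. Brackets with these units move \<open>so_unit p q\<close> along its row as far as the
  antidiagonal, where \<open>so_unit\<close> vanishes; positions beyond it are flips again. The
  torus comes from the short roots, as [so_unit (-p) 0, so_unit 0 (-p)] = so_unit (-p) (-p).\<close>

lemma so_mat_generated:
  assumes U: "module.subspace mat_scale U" "\<And>X Y. X \<in> U \<Longrightarrow> Y \<in> U \<Longrightarrow> mat_bracket n X Y \<in> U"
    and gens: "\<And>k. k \<in> {1..n} \<Longrightarrow> so_e n k \<in> U" "\<And>k. k \<in> {1..n} \<Longrightarrow> so_f n k \<in> U"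
  shows "so_mat n \<subseteq> U"
proof -
  interpret complex_lie_algebra mat_scale "mat_bracket n" by (rule mat_lie_algebra)
  have neg: "- X \<in> U" if "X \<in> U" for X using subspace_neg[OF U(1) that] .
  have E: "so_unit q (q + 1) \<in> U \<and> so_unit (q + 1) q \<in> U" if "- int n \<le> q" "q < 0" for q
  proof -
    define k where "k = nat (q + 1 + int n)"
    have k: "k \<in> {1..n}" "simple_row n k = q" using that by (auto simp: k_def simple_row_def)
    have "mat_scale (if k = n then 2 else 1) (so_unit (q + 1) q) \<in> U" using gens(2)[OF k(1)] k(2) by (simp add: so_f_def)
    then have "so_unit (q + 1) q \<in> U" by (rule scale_mem_cancel[OF U(1)]) simp
    then show ?thesis using gens(1)[OF k(1)] k(2) by (simp add: so_e_def)
  qed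
  have E': "so_unit q (q + 1) \<in> U \<and> so_unit (q + 1) q \<in> U" if "- int n \<le> q" "q < int n" for q
  proof (cases "q < 0")
    case True then show ?thesis using E that by blast
  next
    case False
    then have "so_unit (- q - 1) (- q) \<in> U" "so_unit (- q) (- q - 1) \<in> U" using E[of "- q - 1"] that by auto
    moreover have "so_unit q (q + 1) = - so_unit (- q - 1) (- q)" "so_unit (q + 1) q = - so_unit (- q) (- q - 1)"
      using so_unit_flip[of "- q" "- q - 1"] so_unit_flip[of "- q - 1" "- q"] by (simp_all add: add.commute)
    ultimately show ?thesis using neg by auto
  qed
  have up: "q < - p \<longrightarrow> so_unit p q \<in> U \<and> so_unit q p \<in> U" if "- int n \<le> p" "p < 0" "p + 1 \<le> q" for p q
    using that(3)
  proof (induction q rule: int_ge_induct)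
    case base then show ?case using E that by auto
  next
    case (step q)
    show ?case
    proof
      assume q: "q + 1 < - p"
      then have IH: "so_unit p q \<in> U" "so_unit q p \<in> U" using step by auto
      have box: "p \<in> box n" "q \<in> box n" "q + 1 \<in> box n" using that step q by auto
      have EU: "so_unit q (q + 1) \<in> U" "so_unit (q + 1) q \<in> U" using E'[of q] box q that by auto
      have c: "(q + 1 = p) = False" "(q + 1 = - q) = False" "(q = - p) = False" "(q = p) = False" "(q = - (q + 1)) = False"
        "(q + 1 = - p) = False" "(p = q) = False"
        using step q by presburger+
      have "mat_bracket n (so_unit q (q + 1)) (so_unit p q) = - so_unit p (q + 1)"
        unfolding so_unit_commutator[OF box(2,3,1,2)] c by simp
      moreover have "mat_bracket n (so_unit (q + 1) q) (so_unit q p) = so_unit (q + 1) p"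
        unfolding so_unit_commutator[OF box(3,2,2,1)] c by simp
      ultimately show "so_unit p (q + 1) \<in> U \<and> so_unit (q + 1) p \<in> U"
        using U(2)[OF EU(1) IH(1)] U(2)[OF EU(2) IH(2)] neg[of "- so_unit p (q + 1)"] by simp
    qed
  qed
  have unit: "so_unit p q \<in> U" if "(p, q) \<in> so_roots n" for p q
  proof (cases "p < 0")
    case True then show ?thesis using up[of p q] that by (auto simp: so_roots_def)
  next
    case False
    then have "so_unit (- q) (- p) \<in> U" using up[of "- p" "- q"] that by (auto simp: so_roots_def)
    then have "- so_unit p q \<in> U" by (simp add: so_unit_flip)
    from neg[OF this] show ?thesis by simp
  qed
  have diag: "so_unit (- int p) (- int p) \<in> U" if p: "p \<in> {1..n}" for p
  proof -
    have box: "- int p \<in> box n" "0 \<in> box n" using p by auto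
    have "so_unit (- int p) 0 \<in> U" "so_unit 0 (- int p) \<in> U" using up[of "- int p" 0] p by auto
    then have "mat_bracket n (so_unit (- int p) 0) (so_unit 0 (- int p)) \<in> U" by (rule U(2))
    moreover have "mat_bracket n (so_unit (- int p) 0) (so_unit 0 (- int p)) = so_unit (- int p) (- int p)"
      unfolding so_unit_commutator[OF box box(2,1)] using p by (simp add: so_unit_mat_unit)
    ultimately show ?thesis by simp
  qed
  show ?thesis
  proof
    fix M assume M: "M \<in> so_mat n"
    have "so_diag n (\<lambda>i. M i i) = (\<Sum>p=1..n. mat_scale (M (- int p) (- int p)) (so_unit (- int p) (- int p)))"
      by (rule so_diag_sum) (simp add: so_mat_skew[OF M])
    also have "\<dots> \<in> U" using diag by (intro subspace_sum[OF U(1)] subspace_scale[OF U(1)])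
    finally have "so_diag n (\<lambda>i. M i i) \<in> U" .
    moreover have "(\<Sum>(p,q)\<in>so_roots n. mat_scale (M p q) (so_unit p q)) \<in> U"
      using unit by (intro subspace_sum[OF U(1)]) (auto intro: subspace_scale[OF U(1)])
    ultimately show "M \<in> U"
      by (subst so_mat_decomposition[OF M]) (rule subspace_add[OF U(1)])
  qed
qed

section \<open>Kernels and ranges of the two projections\<close>

lemma (in complex_lie_algebra) eigenvalues_disjoint:
  assumes x: "x \<in> span {v. \<exists>m\<in>P. bracket K v = m *s v}" and y: "y \<in> span {v. \<exists>m\<in>N. bracket K v = m *s v}"
    and "0 \<notin> P" "0 \<notin> N" "bracket K (y + x) = 0"
  shows "y + x = 0"
proof -
  have "x \<in> span {v. \<exists>m\<in>P \<union> N. bracket K v = m *s v}" "y \<in> span {v. \<exists>m\<in>P \<union> N. bracket K v = m *s v}"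
    using x y span_mono[of "{v. \<exists>m\<in>P. bracket K v = m *s v}" "{v. \<exists>m\<in>P \<union> N. bracket K v = m *s v}"]
      span_mono[of "{v. \<exists>m\<in>N. bracket K v = m *s v}" "{v. \<exists>m\<in>P \<union> N. bracket K v = m *s v}"] by blast+
  then have "y + x \<in> span {v. \<exists>m\<in>P \<union> N. bracket K v = m *s v}" by (intro span_add)
  then obtain F v where v: "finite F" "F \<subseteq> P \<union> N" "y + x = (\<Sum>m\<in>F. v m)" "\<forall>m. bracket K (v m) = m *s v m"
    using eigen_span[OF linop_bracket[of K], where x="y + x" and M="P \<union> N"] by blast
  have "(\<Sum>m\<in>F. m *s v m) \<in> {0}"
    using assms(5) v by (simp add: linop_sum[OF linop_bracket])
  then have "\<forall>m\<in>F. m *s v m \<in> {0}"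
    using v by (intro eigen_sum_mem[OF linop_bracket[of K], where w="\<lambda>m. m"])
      (auto simp: subspace_def bracket_scale_right)
  moreover have "m \<noteq> 0" if "m \<in> F" for m using that v(2) assms by auto
  ultimately show ?thesis using v(3) by (auto intro!: sum.neutral)
qed

text \<open>K acts as a grading: a nested bracket of k + 1 generators has eigenvalue s (k + 1). With
  s = 1 and s = -1 all eigenvalues on the positive and negative parts are nonzero, as
  \<open>eigenvalues_disjoint\<close> requires.\<close>

lemma (in two_lie_algebras) nilpart_eigenvalues:
  assumes "\<And>i. i \<in> I \<Longrightarrow> bracket K (d i) = s *s d i"
  shows "nilpart I d d' x x' \<Longrightarrow> x \<in> G.span {v. \<exists>m\<in>range (\<lambda>k. s * of_nat (Suc k)). bracket K v = m *s v}"
proof (induction rule: nilpart.induct)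
  case (gen i)
  have "s \<in> range (\<lambda>k. s * of_nat (Suc k))" by (rule range_eqI[of _ _ 0]) simp
  then show ?case using assms[OF gen] by (intro G.span_base) blast
next
  case (bracket i x x')
  show ?case
  proof (rule G.linop_span_mem[OF G.linop_bracket bracket.IH _ G.subspace_span])
    fix v assume "v \<in> {v. \<exists>m\<in>range (\<lambda>k. s * of_nat (Suc k)). bracket K v = m *s v}"
    then obtain k where k: "bracket K v = (s * of_nat (Suc k)) *s v" by blast
    have "bracket K (bracket (d i) v) = (s + s * of_nat (Suc k)) *s bracket (d i) v"
      using G.jacobi_derivation[of K "d i" v] assms[OF bracket(1)] k
      by (simp only: G.bracket_scale_left G.bracket_scale_right G.scale_left_distrib)
    also have "s + s * of_nat (Suc k) = s * of_nat (Suc (Suc k))" by (simp add: algebra_simps)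
    finally show "bracket (d i) v \<in> G.span {v. \<exists>m\<in>range (\<lambda>k. s * of_nat (Suc k)). bracket K v = m *s v}"
      by (intro G.span_base CollectI bexI[of _ "s * of_nat (Suc (Suc k))"]) (auto simp del: of_nat_Suc)
  qed
qed (auto intro: G.span_zero G.span_add G.span_scale)

locale type_B_chevalley = type_B_data +
  fixes e f :: "nat \<Rightarrow> 'a"
  assumes n1: "n \<ge> 1"
    and e_root: "\<And>i. i \<in> {1..n} \<Longrightarrow> e i \<in> root_space h (\<alpha> i)"
    and f_root: "\<And>i. i \<in> {1..n} \<Longrightarrow> f i \<in> root_space h (\<lambda>K. - \<alpha> i K)"
    and ef_H: "\<And>i. i \<in> {1..n} \<Longrightarrow> bracket (e i) (f i) = H i"
begin

sublocale M: complex_lie_algebra mat_scale "mat_bracket n" by (rule mat_lie_algebra)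

sublocale chevalley_pairs scale bracket mat_scale "mat_bracket n" "{1..n}" e f H "so_e n" "so_f n" "so_h n"
  "\<lambda>i j. of_int (cartan_matrix_B n i j)"
proof
  fix i j assume ij: "i \<in> {1..n}" "j \<in> {1..n}"
  show "bracket (e i) (f j) = (if i = j then H i else 0)"
    using chevalley_commute[OF ij _ e_root[OF ij(1)] f_root[OF ij(2)]] ef_H[OF ij(1)] by (cases "i = j") auto
  show "mat_bracket n (so_e n i) (so_f n j) = (if i = j then so_h n i else 0)"
    by (rule so_e_so_f[OF ij])
  show "bracket (H j) (e i) = of_int (cartan_matrix_B n i j) *s e i"
    using root_spaceD[OF e_root[OF ij(1)] H_in_h[OF ij(2)]] cartan_integers[OF ij] by simp
  show "bracket (H j) (f i) = - of_int (cartan_matrix_B n i j) *s f i"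
    using root_spaceD[OF f_root[OF ij(1)] H_in_h[OF ij(2)]] cartan_integers[OF ij] by simp
  show "mat_bracket n (so_h n j) (so_e n i) = mat_scale (of_int (cartan_matrix_B n i j)) (so_e n i)"
    unfolding so_e_def by (rule so_h_weight(1)[OF ij])
  show "mat_bracket n (so_h n j) (so_f n i) = mat_scale (- of_int (cartan_matrix_B n i j)) (so_f n i)"
    unfolding so_f_def M.bracket_scale_right so_h_weight(2)[OF ij] by (simp add: fun_eq_iff)
qed simp

lemma upper_part:
  "nilpart {1..n} e (so_e n) x M \<Longrightarrow> M \<in> so_mat n \<and> (\<forall>i j. i \<ge> j \<longrightarrow> M i j = 0)"
proof (induction rule: nilpart.induct)
  case zero
  show ?case by (intro conjI M.subspace_0[OF so_mat_subspace]) simp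
next
  case (gen i)
  have "so_e n i a b = 0" if "a \<ge> b" for a b
  proof -
    have *: "\<not> (a = simple_row n i \<and> b = simple_row n i + 1)" "\<not> (a = - (simple_row n i + 1) \<and> b = - simple_row n i)"
      using that by linarith+
    show ?thesis unfolding so_e_def so_unit_def if_not_P[OF *(1)] if_not_P[OF *(2)] by simp
  qed
  then show ?case using so_e_mem[OF gen] by blast
next
  case (add x x' y y')
  then show ?case by (intro conjI M.subspace_add[OF so_mat_subspace]) simp_all
next
  case (scale x x' c)
  then show ?case by (intro conjI M.subspace_scale[OF so_mat_subspace]) simp_all
next
  case (bracket i x M)
  note b = simple_row_bounds[OF bracket(1)]
  have "mat_bracket n (so_e n i) M a b = 0" if "a \<ge> b" for a b
    proof -
    let ?p = "simple_row n i"
    have box: "?p \<in> box n" "?p + 1 \<in> box n" using b by blast+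
    have Z: "M i j = 0" if "i \<ge> j" for i j using bracket(3) that by blast
    have c: "(P \<longrightarrow> x = 0) \<Longrightarrow> (if P then x else 0) = (0::complex)" for P x by simp
    have z: "a = ?p \<longrightarrow> M (?p + 1) b = 0" "a = - (?p + 1) \<longrightarrow> M (- ?p) b = 0"
      "b = ?p + 1 \<longrightarrow> M a ?p = 0" "b = - ?p \<longrightarrow> M a (- (?p + 1)) = 0"
      using that by (intro impI Z; simp)+
    show ?thesis
      unfolding so_e_def mat_bracket_so_unit[OF box] c[OF z(1)] c[OF z(2)] c[OF z(3)] c[OF z(4)] by simp
  qed
  then show ?case using so_mat_bracket so_e_mem bracket by blast
qed

lemma lower_part:
  "nilpart {1..n} f (so_f n) x M \<Longrightarrow> M \<in> so_mat n \<and> (\<forall>i j. i \<le> j \<longrightarrow> M i j = 0)"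
proof (induction rule: nilpart.induct)
  case zero
  show ?case by (intro conjI M.subspace_0[OF so_mat_subspace]) simp
next
  case (gen i)
  have "so_f n i a b = 0" if "a \<le> b" for a b
  proof -
    have *: "\<not> (a = simple_row n i + 1 \<and> b = simple_row n i)" "\<not> (a = - simple_row n i \<and> b = - (simple_row n i + 1))"
      using that by linarith+
    show ?thesis unfolding so_f_def so_unit_def mat_scale_apply if_not_P[OF *(1)] if_not_P[OF *(2)] by simp
  qed
  then show ?case using so_f_mem[OF gen] by blast
next
  case (add x x' y y')
  then show ?case by (intro conjI M.subspace_add[OF so_mat_subspace]) simp_all
next
  case (scale x x' c)
  then show ?case by (intro conjI M.subspace_scale[OF so_mat_subspace]) simp_all
next
  case (bracket i x M)
  note b = simple_row_bounds[OF bracket(1)]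
  have "mat_bracket n (so_f n i) M a b = 0" if "a \<le> b" for a b
  proof -
    let ?p = "simple_row n i"
    have box: "?p + 1 \<in> box n" "?p \<in> box n" using b by blast+
    have Z: "M i j = 0" if "i \<le> j" for i j using bracket(3) that by blast
    have c: "(P \<longrightarrow> x = 0) \<Longrightarrow> (if P then x else 0) = (0::complex)" for P x by simp
    have z: "a = ?p + 1 \<longrightarrow> M ?p b = 0" "a = - ?p \<longrightarrow> M (- (?p + 1)) b = 0"
      "b = ?p \<longrightarrow> M a (?p + 1) = 0" "b = - (?p + 1) \<longrightarrow> M a (- ?p) = 0"
      using that by (intro impI Z; simp)+
    show ?thesis
      unfolding so_f_def M.bracket_scale_left mat_scale_apply mat_bracket_so_unit[OF box] c[OF z(1)] c[OF z(2)] c[OF z(3)] c[OF z(4)]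
      by simp
  qed
  then show ?case using so_mat_bracket so_f_mem bracket by blast
qed

lemma torus_part: "torus {1..n} H (so_h n) k M \<Longrightarrow> k \<in> h \<and> M \<in> so_mat n \<and> (\<forall>i j. i \<noteq> j \<longrightarrow> M i j = 0)"
proof -
  assume "torus {1..n} H (so_h n) k M"
  then obtain c where c: "k = (\<Sum>i=1..n. c i *s H i)" "M = (\<Sum>i=1..n. mat_scale (c i) (so_h n i))"
    by (auto simp: torus_def)
  have "k \<in> h" unfolding c using H_in_h by (intro subspace_sum[OF h_subspace] subspace_scale[OF h_subspace])
  moreover have "M \<in> so_mat n" unfolding c using so_h_mem
    by (intro M.subspace_sum[OF so_mat_subspace] M.subspace_scale[OF so_mat_subspace])
  ultimately show ?thesis unfolding c by (simp add: sum_fun_apply so_h_diagonal)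
qed

text \<open>A torus pair uses the same coefficients on both sides and the two algebras share their
  Cartan integers. Hence the simple roots of k can be read off the matrix M; this transfers
  vanishing between the two components.\<close>

lemma torus_weights:
  assumes "torus {1..n} H (so_h n) k M" "i \<in> {1..n}"
  shows "mat_bracket n M (so_e n i) = mat_scale (\<alpha> i k) (so_e n i)"
proof -
  obtain c where c: "k = (\<Sum>j=1..n. c j *s H j)" "M = (\<Sum>j=1..n. mat_scale (c j) (so_h n j))"
    using assms(1) by (auto simp: torus_def)
  have "mat_bracket n M (so_e n i) = (\<Sum>j=1..n. mat_scale (c j) (mat_bracket n (so_h n j) (so_e n i)))"
    unfolding c by (simp add: M.linop_sum[OF M.linop_bracket_left] M.bracket_scale_left)
  also have "\<dots> = (\<Sum>j=1..n. mat_scale (c j * \<alpha> i (H j)) (so_e n i))"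
    using te'[OF assms(2)] cartan_integers[OF assms(2)] by simp
  also have "\<dots> = mat_scale (\<alpha> i k) (so_e n i)"
    unfolding c by (subst simple_root_sum[OF assms(2)]) (use H_in_h in \<open>auto simp: M.scale_sum_left\<close>)
  finally show ?thesis .
qed

text \<open>The element K of h on which every simple root takes the value 1 has only nonzero
  eigenvalues on y and x, while it commutes with h.\<close>

lemma graph_direct:
  assumes "nilpart {1..n} f (so_f n) y y'" "nilpart {1..n} e (so_e n) x x'" "y + x \<in> h"
  shows "y + x = 0"
proof -
  obtain c where c: "\<And>i. i \<in> {1..n} \<Longrightarrow> \<alpha> i (\<Sum>j=1..n. c j *s H j) = 1" "(\<Sum>j=1..n. c j *s H j) \<in> h"
    using h_element[of "\<lambda>_. 1"] by blast
  define K where "K = (\<Sum>j=1..n. c j *s H j)"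
  have K: "K \<in> h" "\<And>i. i \<in> {1..n} \<Longrightarrow> \<alpha> i K = 1" using c by (auto simp: K_def)
  have x: "x \<in> span {v. \<exists>m\<in>range (\<lambda>k. 1 * of_nat (Suc k)). bracket K v = m *s v}"
    by (rule nilpart_eigenvalues[OF _ assms(2)]) (use root_spaceD[OF e_root K(1)] K(2) in auto)
  have y: "y \<in> span {v. \<exists>m\<in>range (\<lambda>k. (- 1) * of_nat (Suc k)). bracket K v = m *s v}"
    by (rule nilpart_eigenvalues[OF _ assms(1)]) (use root_spaceD[OF f_root K(1)] K(2) in auto)
  have "(0::complex) \<noteq> of_nat (Suc k)" for k by (metis of_nat_eq_0_iff nat.distinct(1))
  then show ?thesis
    by (intro eigenvalues_disjoint[OF x y]) (use h_abelian[OF K(1) assms(3)] in \<open>auto simp del: of_nat_Suc\<close>)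
qed

lemma graph_surjective: "\<exists>M. graph x M"
proof -
  have "{x. \<exists>M. graph x M} = UNIV"
  proof (rule generation[OF e_root f_root ef_H graph_fst_subspace])
    show "H i \<in> {x. \<exists>M. graph x M}" if "i \<in> {1..n}" for i
      using graph_torus[OF torus_gen[OF finI that]] by blast
  qed (use graph_bracket_e graph_bracket_f in blast)+
  then show ?thesis by blast
qed

lemma graph_range: "(\<exists>x. graph x M) \<longleftrightarrow> M \<in> so_mat n"
proof
  assume "\<exists>x. graph x M"
  then show "M \<in> so_mat n"
    unfolding graph_def using upper_part lower_part torus_part M.subspace_add[OF so_mat_subspace] by metis
next
  have "so_mat n \<subseteq> {M. \<exists>x. graph x M}"
  proof (rule so_mat_generated[OF graph_snd_subspace])
    show "mat_bracket n X Y \<in> {M. \<exists>x. graph x M}" if "X \<in> {M. \<exists>x. graph x M}" "Y \<in> {M. \<exists>x. graph x M}" for X Y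
      using that graph_bracket by blast
    show "so_e n k \<in> {M. \<exists>x. graph x M}" "so_f n k \<in> {M. \<exists>x. graph x M}" if "k \<in> {1..n}" for k
      using graph_pos[OF nilpart.gen[OF that]] graph_neg[OF nilpart.gen[OF that]] by blast+
  qed
  then show "M \<in> so_mat n \<Longrightarrow> \<exists>x. graph x M" by blast
qed

text \<open>Write (0, D) as a sum of its three parts. By \<open>graph_direct\<close> the h-component
  of the torus part is zero, so by \<open>torus_weights\<close> all simple roots vanish on its
  matrix. The triangular parts do not touch the diagonal, so this matrix has the same diagonal as
  D.\<close>

lemma diagonal_kernel:
  assumes "graph 0 D" "\<And>i j. i \<noteq> j \<Longrightarrow> D i j = 0"
  shows "D = 0"
proof -
  have so: "D \<in> so_mat n" using graph_range assms(1) by blast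
  obtain y y' k k' z z' where g: "nilpart {1..n} f (so_f n) y y'" "torus {1..n} H (so_h n) k k'" "nilpart {1..n} e (so_e n) z z'"
    "0 = y + k + z" "D = y' + k' + z'"
    using assms(1) unfolding graph_def by blast
  have kh: "k \<in> h" using torus_part[OF g(2)] by blast
  have "y + z = - k" using g(4) by (simp add: eq_neg_iff_add_eq_0 algebra_simps)
  then have "y + z \<in> h" using kh subspace_neg[OF h_subspace] by simp
  then have "y + z = 0" using graph_direct[OF g(1,3)] by blast
  then have "k = 0" using \<open>y + z = - k\<close> by simp
  then have \<alpha>0: "\<alpha> i k = 0" if "i \<in> {1..n}" for i using simple_root_scale[OF that kh, of 0] by simp
  have "y' i i = 0" "z' i i = 0" for i using upper_part[OF g(3)] lower_part[OF g(1)] by auto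
  then have Dk: "D i i = k' i i" for i using g(5) by simp
  have step: "D p p = D (p + 1) (p + 1)" if "- int n \<le> p" "p < 0" for p
  proof -
    define i where "i = nat (p + 1 + int n)"
    have i: "i \<in> {1..n}" "simple_row n i = p" using that by (auto simp: i_def simple_row_def)
    have box: "p \<in> box n" "p + 1 \<in> box n" using that by auto
    have "mat_bracket n k' (so_unit p (p + 1)) p (p + 1) = 0"
      using torus_weights[OF g(2) i(1)] \<alpha>0[OF i(1)] i(2) by (simp add: so_e_def)
    then have "mat_bracket n (so_unit p (p + 1)) k' p (p + 1) = 0"
      using M.bracket_skew[of "so_unit p (p + 1)" k'] by simp
    moreover have "p \<noteq> - (p + 1)" "p + 1 \<noteq> - p" by presburger+
    ultimately show ?thesis unfolding Dk by (simp add: mat_bracket_so_unit[OF box])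
  qed
  have "D i i = 0" for i using so_mat_diagonal_zero[OF so step] .
  then show ?thesis using assms(2) by (metis (no_types) ext zero_fun_apply)
qed

text \<open>The kernel is an ideal of so(2n+1), so it contains the root components and the diagonal
  part of M. A root vector in it, bracketed with the opposite root vector, would give a nonzero
  diagonal matrix in the kernel, contrary to \<open>diagonal_kernel\<close>.\<close>

lemma kernel_snd: "graph 0 M \<Longrightarrow> M = 0"
proof -
  assume g: "graph 0 M"
  let ?U = "{M. graph 0 M}"
  have so: "M \<in> so_mat n" using g graph_range by blast
  have stable: "mat_bracket n N X \<in> ?U" if "N \<in> so_mat n" "X \<in> ?U" for N X
    using that graph_range[of N] graph_bracket[of _ N 0 X] by auto
  have T: "so_diag n (\<lambda>i. of_int (ternary i)) \<in> so_mat n"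
    by (rule so_diag_mem) (simp add: ternary_odd)
  have gU: "M \<in> ?U" using g by simp
  note comps = so_mat_components[OF kernel_snd_subspace _ so gU]
  have diag: "so_diag n (\<lambda>i. M i i) = 0"
    by (rule diagonal_kernel) (use comps(1)[OF stable[OF T]] in simp, simp add: so_diag_def)
  have "M p q = 0" if pq: "(p, q) \<in> so_roots n" for p q
  proof (rule ccontr)
    assume "M p q \<noteq> 0"
    then have "so_unit p q \<in> ?U" using comps(2)[OF stable[OF T] pq] by blast
    note b = so_rootsD[OF pq]
    then have "mat_bracket n (so_unit q p) (so_unit p q) \<in> ?U"
      using stable[OF so_unit_mem \<open>so_unit p q \<in> ?U\<close>] by blast
    moreover have c: "(q = - p) = False" "(p = - q) = False" using b by auto
    have "mat_bracket n (so_unit q p) (so_unit p q) = so_unit q q - so_unit p p"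
      using b by (subst so_unit_commutator) (simp_all only: c if_False, auto)
    ultimately have "so_unit q q - so_unit p p = 0"
      by (intro diagonal_kernel) (auto simp: so_unit_diagonal)
    then have "so_unit q q p p = so_unit p p p p" by (metis eq_iff_diff_eq_0)
    then show False using b unfolding so_unit_def by (auto split: if_splits)
  qed
  moreover have "M i i = 0" for i
    using fun_cong[OF fun_cong[OF diag, of i], of i] so_mat_support[OF so, of i i] by (auto simp: so_diag_def split: if_splits)
  ultimately show "M = 0"
    by (intro so_mat_eqI[OF so M.subspace_0[OF so_mat_subspace]]) auto
qed

text \<open>By simplicity the kernel is zero or everything. In the second case H_1 is paired with
  the zero matrix, so the torus part of the pair has zero matrix and then zero h-component.
  \<open>graph_direct\<close> now gives H_1 = 0, against \<alpha>_1(H_1) = 2.\<close>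

lemma kernel_fst: "graph x 0 \<Longrightarrow> x = 0"
proof -
  assume x: "graph x 0"
  let ?Z = "{x. graph x 0}"
  have "bracket y z \<in> ?Z" if "z \<in> ?Z" for y z
    using that graph_surjective[of y] graph_bracket[of y _ z 0] by auto
  then have "lie_ideal UNIV ?Z" using kernel_fst_subspace by (simp add: lie_ideal_def)
  moreover have "?Z \<noteq> UNIV"
  proof
    assume "?Z = UNIV"
    have one: "1 \<in> {1..n}" using n1 by simp
    have "graph (H 1) 0" using \<open>?Z = UNIV\<close> by blast
    then obtain y y' k k' z z' where g: "nilpart {1..n} f (so_f n) y y'" "torus {1..n} H (so_h n) k k'" "nilpart {1..n} e (so_e n) z z'"
      "H 1 = y + k + z" "0 = y' + k' + z'"
      unfolding graph_def by blast
    have kh: "k \<in> h" using torus_part[OF g(2)] by blast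
    have "k' i j = 0" for i j
    proof (cases "i = j")
      case True
      then have "y' i j = 0" "z' i j = 0" using upper_part[OF g(3)] lower_part[OF g(1)] by auto
      then show ?thesis using fun_cong[OF fun_cong[OF g(5), of i], of j] by simp
    qed (use torus_part[OF g(2)] in blast)
    then have k': "k' = 0" by (intro ext) simp
    have "\<alpha> i k = 0" if i: "i \<in> {1..n}" for i
    proof -
      have "mat_scale (\<alpha> i k) (so_e n i) = 0" using torus_weights[OF g(2) i] k' by simp
      then have "\<alpha> i k * so_e n i (simple_row n i) (simple_row n i + 1) = 0" by (metis mat_scale_apply zero_fun_apply)
      moreover have "simple_row n i \<noteq> - (simple_row n i + 1)" by presburger
      then have "so_e n i (simple_row n i) (simple_row n i + 1) = 1" unfolding so_e_def so_unit_def by simp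
      ultimately show ?thesis by simp
    qed
    then have "k = 0" using center_trivial[OF kh] by blast
    then have "y + z = H 1" using g(4) by simp
    then have "H 1 = 0" using graph_direct[OF g(1,3)] H_in_h[OF one] by simp
    moreover have "\<alpha> 1 (H 1) = 2" using cartan_integers[OF one one] by (simp add: cartan_matrix_B_def)
    moreover have "\<alpha> 1 0 = 0" using simple_root_scale[OF one H_in_h[OF one], of 0] by simp
    ultimately show False by simp
  qed
  ultimately have "?Z = {0}" using simple by (auto simp: simple_lie_algebra_def)
  then show ?thesis using x by blast
qed

definition so_iso :: "'a \<Rightarrow> cmat" where "so_iso x = (THE M. graph x M)"

lemma graph_iff: "graph x M \<longleftrightarrow> so_iso x = M"
proof -
  have uniq: "M = N" if "graph x M" "graph x N" for M N
    using kernel_snd[of "M - N"] graph_diff[OF that] by simp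
  obtain N where "graph x N" using graph_surjective by blast
  then have "so_iso x = N" unfolding so_iso_def using uniq by blast
  then show ?thesis using \<open>graph x N\<close> uniq by blast
qed

end

locale so_isomorphism = complex_lie_algebra +
  fixes n :: nat and \<psi> :: "'a \<Rightarrow> cmat"
  assumes psi_add: "\<psi> (x + y) = \<psi> x + \<psi> y"
    and psi_scale: "\<psi> (c *s x) = mat_scale c (\<psi> x)"
    and psi_bracket: "\<psi> (bracket x y) = mat_bracket n (\<psi> x) (\<psi> y)"
    and psi_inj: "\<psi> x = 0 \<Longrightarrow> x = 0"
    and psi_range: "range \<psi> = so_mat n"

lemma (in type_B_chevalley) so_iso: "so_isomorphism scale bracket n so_iso"
proof unfold_locales
  show "so_iso (x + y) = so_iso x + so_iso y" for x y
    using graph_add graph_iff by metis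
  show "so_iso (scale c x) = mat_scale c (so_iso x)" for c x
    using graph_scale graph_iff by metis
  show "so_iso (bracket x y) = mat_bracket n (so_iso x) (so_iso y)" for x y
    using graph_bracket graph_iff by metis
  show "so_iso x = 0 \<Longrightarrow> x = 0" for x
    using kernel_fst graph_iff by metis
  show "range so_iso = so_mat n"
    using graph_range unfolding graph_iff by (intro set_eqI) (metis rangeE rangeI)
qed

theorem (in complex_lie_algebra) type_B_so_isomorphism:
  assumes "simple_lie_algebra" "type_B n" "n \<ge> 1"
  shows "\<exists>\<psi>. so_isomorphism scale bracket n \<psi>"
proof -
  have "\<exists>h \<alpha> H. cartan_subalgebra h \<and> is_base h n \<alpha> \<and> (\<forall>j\<in>{1..n}. is_coroot h (\<alpha> j) (H j)) \<and>
    (\<forall>i\<in>{1..n}. \<forall>j\<in>{1..n}. \<alpha> i (H j) = of_int (cartan_matrix_B n i j))"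
    using assms(2) unfolding type_B_def .
  then obtain h \<alpha> H where h: "cartan_subalgebra h" "is_base h n \<alpha>" "\<forall>j\<in>{1..n}. is_coroot h (\<alpha> j) (H j)"
    "\<forall>i\<in>{1..n}. \<forall>j\<in>{1..n}. \<alpha> i (H j) = of_int (cartan_matrix_B n i j)"
    by (elim exE conjE) (rule that; assumption)
  interpret type_B_data scale bracket h \<alpha> H n
    by unfold_locales (use assms(1) h in \<open>simp_all\<close>)
  have "\<forall>i\<in>{1..n}. \<exists>ef. fst ef \<in> root_space h (\<alpha> i) \<and> snd ef \<in> root_space h (\<lambda>K. - \<alpha> i K) \<and> bracket (fst ef) (snd ef) = H i"
  proof
    fix i assume "i \<in> {1..n}"
    then obtain e f where "e \<in> root_space h (\<alpha> i)" "f \<in> root_space h (\<lambda>K. - \<alpha> i K)" "bracket e f = H i"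
      by (rule chevalley_pair)
    then show "\<exists>ef. fst ef \<in> root_space h (\<alpha> i) \<and> snd ef \<in> root_space h (\<lambda>K. - \<alpha> i K) \<and> bracket (fst ef) (snd ef) = H i"
      by (intro exI[of _ "(e, f)"]) simp
  qed
  then obtain ef where ef: "\<forall>i\<in>{1..n}. fst (ef i) \<in> root_space h (\<alpha> i) \<and> snd (ef i) \<in> root_space h (\<lambda>K. - \<alpha> i K) \<and> bracket (fst (ef i)) (snd (ef i)) = H i"
    by (elim bchoice[THEN exE])
  interpret type_B_chevalley scale bracket h \<alpha> H n "\<lambda>i. fst (ef i)" "\<lambda>i. snd (ef i)"
    using ef assms(3) by unfold_locales auto
  show ?thesis using so_iso by blast
qed

section \<open>Triangular form of solvable subalgebras\<close>

type_synonym cvec = "int \<Rightarrow> complex"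

definition vec_scale :: "complex \<Rightarrow> cvec \<Rightarrow> cvec" where "vec_scale c v = (\<lambda>i. c * v i)"

definition mat_vec :: "nat \<Rightarrow> cmat \<Rightarrow> cvec \<Rightarrow> cvec" where
  "mat_vec n M v = (\<lambda>i. \<Sum>k\<in>box n. M i k * v k)"

definition form :: "nat \<Rightarrow> cvec \<Rightarrow> cvec \<Rightarrow> complex" where
  "form n u v = (\<Sum>i\<in>box n. u i * v (- i))"

definition box_vecs :: "nat \<Rightarrow> cvec set" where
  "box_vecs n = {v. \<forall>i. i \<notin> box n \<longrightarrow> v i = 0}"

definition unit_vec :: "int \<Rightarrow> cvec" where "unit_vec a = (\<lambda>i. if i = a then 1 else 0)"

lemma vec_scale_apply [simp]: "vec_scale c v i = c * v i"
  by (simp add: vec_scale_def)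

lemma vec_vector_space: "field_vector_space vec_scale"
  by unfold_locales (auto simp: fun_eq_iff algebra_simps)

interpretation vec: field_vector_space vec_scale by (rule vec_vector_space)

lemma box_vecs_subspace: "vec.subspace (box_vecs n)"
  by (auto simp: vec.subspace_def box_vecs_def)

lemma unit_vec_box: "a \<in> box n \<Longrightarrow> unit_vec a \<in> box_vecs n"
  by (auto simp: unit_vec_def box_vecs_def)

lemma box_vecs_span: "box_vecs n \<subseteq> vec.span (unit_vec ` box n)"
proof
  fix v assume v: "v \<in> box_vecs n"
  have "v = (\<Sum>a\<in>box n. vec_scale (v a) (unit_vec a))"
  proof
    fix i
    have "(\<Sum>a\<in>box n. v a * unit_vec a i) = (\<Sum>a\<in>box n. if a = i then v i else 0)"
      by (rule sum.cong) (auto simp: unit_vec_def)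
    then show "v i = (\<Sum>a\<in>box n. vec_scale (v a) (unit_vec a)) i"
      using v by (auto simp: sum_fun_apply box_vecs_def)
  qed
  also have "\<dots> \<in> vec.span (unit_vec ` box n)"
    by (intro vec.span_sum vec.span_scale vec.span_base) auto
  finally show "v \<in> vec.span (unit_vec ` box n)" .
qed

lemma mat_vec_linop: "vec.linop (mat_vec n M)"
  by (auto simp: vec.linop_def mat_vec_def fun_eq_iff sum.distrib sum_distrib_left algebra_simps)

lemma mat_vec_diff: "mat_vec n (A - B) v = mat_vec n A v - mat_vec n B v"
  by (auto simp: mat_vec_def fun_eq_iff sum_subtractf algebra_simps)

lemma mat_vec_mult: "mat_vec n (mat_mult n A B) v = mat_vec n A (mat_vec n B v)"
proof
  fix i
  show "mat_vec n (mat_mult n A B) v i = mat_vec n A (mat_vec n B v) i"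
    unfolding mat_vec_def mat_mult_def sum_distrib_left sum_distrib_right
    by (subst sum.swap) (simp add: mult.assoc)
qed

lemma form_add_left: "form n (u + v) w = form n u w + form n v w"
  and form_scale_left: "form n (vec_scale c u) w = c * form n u w"
  and form_diff_left: "form n (u - v) w = form n u w - form n v w"
  by (auto simp: form_def sum.distrib sum_subtractf sum_distrib_left algebra_simps)

lemma form_commute: "form n u v = form n v u"
proof -
  have "form n u v = (\<Sum>i\<in>box n. u (- i) * v (- (- i)))" unfolding form_def by (rule sum_box_uminus[symmetric])
  then show ?thesis by (simp add: form_def mult.commute)
qed

lemma form_add_right: "form n w (u + v) = form n w u + form n w v"
  and form_scale_right: "form n w (vec_scale c u) = c * form n w u"
  and form_diff_right: "form n w (u - v) = form n w u - form n w v"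
  using form_add_left form_scale_left form_diff_left form_commute by metis+

lemma form_unit: "a \<in> box n \<Longrightarrow> form n (unit_vec a) v = v (- a)"
proof -
  assume a: "a \<in> box n"
  have "form n (unit_vec a) v = (\<Sum>i\<in>box n. if i = a then v (- i) else 0)"
    unfolding form_def by (rule sum.cong) (auto simp: unit_vec_def)
  then show ?thesis using a by simp
qed

lemma form_so_mat:
  assumes "M \<in> so_mat n"
  shows "form n (mat_vec n M u) v = - form n u (mat_vec n M v)"
proof -
  have "form n u (mat_vec n M v) = (\<Sum>k\<in>box n. \<Sum>i\<in>box n. u k * (M (- k) i * v i))"
    by (simp add: form_def mat_vec_def sum_distrib_left)
  also have "\<dots> = (\<Sum>k\<in>box n. \<Sum>i\<in>box n. u k * (M (- k) (- i) * v (- i)))"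
    by (rule sum.cong[OF refl], rule sum_box_uminus[symmetric])
  also have "\<dots> = - (\<Sum>k\<in>box n. \<Sum>i\<in>box n. M i k * u k * v (- i))"
    unfolding sum_negf[symmetric] by (intro sum.cong) (auto simp: so_mat_skew[OF assms])
  also have "(\<Sum>k\<in>box n. \<Sum>i\<in>box n. M i k * u k * v (- i)) = form n (mat_vec n M u) v"
    unfolding form_def mat_vec_def sum_distrib_right by (rule sum.swap)
  finally show ?thesis by simp
qed

lemma mat_vec_box: "M \<in> so_mat n \<Longrightarrow> mat_vec n M v \<in> box_vecs n"
  using so_mat_support by (auto simp: mat_vec_def box_vecs_def intro!: sum.neutral)

section \<open>Isotropic eigenvectors of solvable subalgebras\<close>

context complex_lie_algebra
begin

text \<open>All conditions are restricted to S, because the induction in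
  \<open>so_rep_triangular\<close> replaces \<phi> by the middle block of a conjugate, known to
  respect brackets only on S.\<close>

definition so_rep :: "nat \<Rightarrow> 'g set \<Rightarrow> ('g \<Rightarrow> cmat) \<Rightarrow> bool" where
  "so_rep n S \<phi> \<longleftrightarrow> lie_subalgebra S \<and> (\<forall>x\<in>S. \<phi> x \<in> so_mat n) \<and> (\<forall>x\<in>S. \<forall>y\<in>S. \<phi> (x + y) = \<phi> x + \<phi> y) \<and>
     (\<forall>c. \<forall>x\<in>S. \<phi> (c *s x) = mat_scale c (\<phi> x)) \<and>
     (\<forall>x\<in>S. \<forall>y\<in>S. \<phi> (bracket x y) = mat_bracket n (\<phi> x) (\<phi> y))"

lemma so_rep_lie_representation:
  assumes "so_rep n S \<phi>"
  shows "lie_representation scale bracket vec_scale S (\<lambda>x. mat_vec n (\<phi> x))"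
proof unfold_locales
  fix x y c v assume x: "x \<in> S" and y: "y \<in> S"
  show "mat_vec n (\<phi> (x + y)) v = mat_vec n (\<phi> x) v + mat_vec n (\<phi> y) v"
    using assms x y by (simp add: so_rep_def mat_vec_def fun_eq_iff sum.distrib algebra_simps)
  show "mat_vec n (\<phi> (bracket x y)) v = mat_vec n (\<phi> x) (mat_vec n (\<phi> y) v) - mat_vec n (\<phi> y) (mat_vec n (\<phi> x) v)"
  proof -
    have "\<phi> (bracket x y) = mat_bracket n (\<phi> x) (\<phi> y)" using assms x y by (simp add: so_rep_def)
    then show ?thesis by (simp add: mat_bracket_def mat_vec_diff mat_vec_mult)
  qed
next
  fix x c v assume x: "x \<in> S"
  show "mat_vec n (\<phi> (c *s x)) v = vec_scale c (mat_vec n (\<phi> x) v)"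
    using assms x by (simp add: so_rep_def mat_vec_def fun_eq_iff sum_distrib_left algebra_simps)
next
  show "lie_subalgebra S" using assms by (simp add: so_rep_def)
qed (rule mat_vec_linop)

lemma so_rep_eigenvector:
  assumes "so_rep n S \<phi>" "solvable S" "vec.subspace C" "C \<subseteq> box_vecs n" "C \<noteq> {0}"
    "\<And>x v. x \<in> S \<Longrightarrow> v \<in> C \<Longrightarrow> mat_vec n (\<phi> x) v \<in> C"
  shows "\<exists>u\<in>C. u \<noteq> 0 \<and> (\<forall>x\<in>S. \<exists>c. mat_vec n (\<phi> x) u = vec_scale c u)"
proof -
  have "C \<subseteq> vec.span (unit_vec ` box n)" using assms(4) box_vecs_span by blast
  then obtain u where "u \<in> C" "u \<noteq> 0" "\<And>x. x \<in> S \<Longrightarrow> \<exists>c. mat_vec n (\<phi> x) u = vec_scale c u"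
    using lie_theorem[OF assms(2) so_rep_lie_representation[OF assms(1)] assms(3) _ _ assms(5,6), of "unit_vec ` box n"]
    by auto
  then show ?thesis by blast
qed

text \<open>Skewness gives c (v, v) = -c (v, v).\<close>

lemma anisotropic_eigenvalue:
  assumes "M \<in> so_mat n" "mat_vec n M v = vec_scale c v" "form n v v \<noteq> 0"
  shows "mat_vec n M v = 0"
proof -
  have "c * form n v v = - (c * form n v v)"
    using form_so_mat[OF assms(1), of v v] by (simp add: assms(2) form_scale_left form_scale_right)
  then have "c = 0" using assms(3) by simp
  then show ?thesis using assms(2) by (simp add: fun_eq_iff)
qed

(* S kills an anisotropic common eigenvector v and then preserves its orthogonal complement; two orthogonal
   anisotropic eigenvectors span a plane killed by S, and this plane contains an isotropic vector. *)
lemma isotropic_eigenvector: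
  assumes rep: "so_rep n S \<phi>" and sol: "solvable S" and n: "n \<ge> 1"
  shows "\<exists>u\<in>box_vecs n. u \<noteq> 0 \<and> form n u u = 0 \<and> (\<forall>x\<in>S. \<exists>c. mat_vec n (\<phi> x) u = vec_scale c u)"
proof -
  have so: "\<phi> x \<in> so_mat n" if "x \<in> S" for x using rep that by (simp add: so_rep_def)
  have "unit_vec 0 \<in> box_vecs n" by (rule unit_vec_box) simp
  moreover have unz: "unit_vec a \<noteq> 0" for a by (auto simp: unit_vec_def fun_eq_iff)
  ultimately have "box_vecs n \<noteq> {0}" by blast
  then obtain v where v: "v \<in> box_vecs n" "v \<noteq> 0" "\<forall>x\<in>S. \<exists>c. mat_vec n (\<phi> x) v = vec_scale c v"
    using so_rep_eigenvector[OF rep sol box_vecs_subspace] mat_vec_box so by blast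
  show ?thesis
  proof (cases "form n v v = 0")
    case True
    then show ?thesis using v by blast
  next
    case False
    have v0: "mat_vec n (\<phi> x) v = 0" if "x \<in> S" for x
      using anisotropic_eigenvalue[OF so[OF that] _ False] v(3) that by blast
    define C where "C = {w \<in> box_vecs n. form n w v = 0}"
    have sub: "vec.subspace C"
      using box_vecs_subspace[of n]
      by (auto simp: C_def vec.subspace_def form_add_left form_scale_left) (simp add: form_def)
    \<comment> \<open>As n is at least 1, the coordinates 1 and -1 both exist, and a nonzero
      combination of \<open>unit_vec 1\<close> and \<open>unit_vec (-1)\<close> is orthogonal to
      v.\<close>
    have "C \<noteq> {0}"
    proof (cases "v (- 1) = 0")
      case True
      then have "unit_vec 1 \<in> C" using unit_vec_box[of 1 n] n by (simp add: C_def form_unit)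
      then show ?thesis using unz by blast
    next
      case nz: False
      let ?w = "vec_scale (v 1) (unit_vec 1) - vec_scale (v (-1)) (unit_vec (-1))"
      have "?w \<in> box_vecs n"
        using unit_vec_box[of 1 n] unit_vec_box[of "-1" n] n
        by (intro vec.subspace_diff[OF box_vecs_subspace] vec.subspace_scale[OF box_vecs_subspace]) auto
      moreover have "form n ?w v = 0"
        using n by (simp add: form_diff_left form_scale_left form_unit)
      moreover have "?w (-1) \<noteq> 0" using nz by (simp add: unit_vec_def)
      then have "?w \<noteq> 0" by (metis zero_fun_apply)
      ultimately show ?thesis unfolding C_def by blast
    qed
    moreover have "mat_vec n (\<phi> x) w \<in> C" if "x \<in> S" "w \<in> C" for x w
      using that v0 form_so_mat[OF so] mat_vec_box[OF so] by (auto simp: C_def) (simp add: form_def)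
    ultimately obtain u where u: "u \<in> C" "u \<noteq> 0" "\<forall>x\<in>S. \<exists>c. mat_vec n (\<phi> x) u = vec_scale c u"
      using so_rep_eigenvector[OF rep sol sub] C_def by blast
    show ?thesis
    proof (cases "form n u u = 0")
      case True
      then show ?thesis using u C_def by blast
    next
      case nz: False
      have u0: "mat_vec n (\<phi> x) u = 0" if "x \<in> S" for x
        using anisotropic_eigenvalue[OF so[OF that] _ nz] u(3) that by blast
      define t where "t = csqrt (- form n u u / form n v v)"
      have t: "t * t = - form n u u / form n v v"
        using power2_csqrt[of "- form n u u / form n v v"] by (simp add: t_def power2_eq_square)
      have uv: "form n u v = 0" "form n v u = 0" using u(1) form_commute C_def by auto
      let ?w = "u + vec_scale t v"
      have "form n ?w ?w = form n u u + t * t * form n v v"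
        by (simp add: form_add_left form_add_right form_scale_left form_scale_right uv)
      also have "\<dots> = 0" using False by (simp add: t)
      finally have iso: "form n ?w ?w = 0" .
      have "?w \<noteq> 0"
      proof
        assume "?w = 0"
        then have "form n ?w v = 0" by (simp add: form_def)
        then have "t = 0" using False by (simp add: form_add_left form_scale_left uv)
        then show False using t nz False by simp
      qed
      moreover have "?w \<in> box_vecs n"
        using u(1) v(1) C_def
        by (intro vec.subspace_add[OF box_vecs_subspace] vec.subspace_scale[OF box_vecs_subspace]) auto
      moreover have "mat_vec n (\<phi> x) ?w = vec_scale 0 ?w" if "x \<in> S" for x
        using u0[OF that] v0[OF that]
        by (simp add: vec.linop_add[OF mat_vec_linop] vec.linop_scale[OF mat_vec_linop])
      ultimately show ?thesis using iso by blast
    qed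
  qed
qed

end

section \<open>The orthogonal group of the form\<close>

definition mat_adj :: "cmat \<Rightarrow> cmat" where "mat_adj P = (\<lambda>i j. P (- j) (- i))"

definition mat_id :: "nat \<Rightarrow> cmat" where "mat_id n = (\<lambda>i j. if i = j \<and> i \<in> box n then 1 else 0)"

definition box_mats :: "nat \<Rightarrow> cmat set" where
  "box_mats n = {M. \<forall>i j. i \<notin> box n \<or> j \<notin> box n \<longrightarrow> M i j = 0}"

definition so_group :: "nat \<Rightarrow> cmat set" where
  "so_group n = {P \<in> box_mats n. mat_mult n (mat_adj P) P = mat_id n \<and> mat_mult n P (mat_adj P) = mat_id n}"

lemma mat_adj_adj [simp]: "mat_adj (mat_adj P) = P"
  by (simp add: mat_adj_def)

lemma mat_adj_mult: "mat_adj (mat_mult n A B) = mat_mult n (mat_adj B) (mat_adj A)"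
proof (intro ext)
  fix i j
  have "(\<Sum>k\<in>box n. A (- j) k * B k (- i)) = (\<Sum>k\<in>box n. A (- j) (- k) * B (- k) (- i))"
    by (rule sum_box_uminus[symmetric])
  then show "mat_adj (mat_mult n A B) i j = mat_mult n (mat_adj B) (mat_adj A) i j"
    by (simp add: mat_adj_def mat_mult_def mult.commute)
qed

lemma mat_id_left: "M \<in> box_mats n \<Longrightarrow> mat_mult n (mat_id n) M = M"
proof (intro ext)
  fix i j assume M: "M \<in> box_mats n"
  have "mat_mult n (mat_id n) M i j = (\<Sum>k\<in>box n. if k = i then M i j else 0)"
    unfolding mat_mult_def by (rule sum.cong) (auto simp: mat_id_def)
  then show "mat_mult n (mat_id n) M i j = M i j" using M by (simp add: box_mats_def)
qed

lemma mat_id_right: "M \<in> box_mats n \<Longrightarrow> mat_mult n M (mat_id n) = M"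
proof (intro ext)
  fix i j assume M: "M \<in> box_mats n"
  have "mat_mult n M (mat_id n) i j = (\<Sum>k\<in>box n. if k = j then M i j else 0)"
    unfolding mat_mult_def by (rule sum.cong) (auto simp: mat_id_def)
  then show "mat_mult n M (mat_id n) i j = M i j" using M by (simp add: box_mats_def)
qed

lemma box_mats_mult: "A \<in> box_mats n \<Longrightarrow> B \<in> box_mats n \<Longrightarrow> mat_mult n A B \<in> box_mats n"
  unfolding box_mats_def mat_mult_def by (auto intro!: sum.neutral)

lemma box_mats_adj: "A \<in> box_mats n \<Longrightarrow> mat_adj A \<in> box_mats n"
  unfolding box_mats_def mat_adj_def by auto

lemma so_mat_box: "M \<in> so_mat n \<Longrightarrow> M \<in> box_mats n"
  by (auto simp: so_mat_def box_mats_def)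

lemma so_mat_adj: "M \<in> so_mat n \<longleftrightarrow> M \<in> box_mats n \<and> mat_adj M = - M"
  by (auto simp: so_mat_def box_mats_def mat_adj_def fun_eq_iff)

lemma mat_mult_minus_left: "mat_mult n (- A) B = - mat_mult n A B"
  and mat_mult_minus_right: "mat_mult n A (- B) = - mat_mult n A B"
  by (auto simp: mat_mult_def fun_eq_iff sum_negf)

lemma mat_id_group: "mat_id n \<in> so_group n"
proof -
  have "mat_id n \<in> box_mats n" "mat_adj (mat_id n) = mat_id n"
    by (auto simp: box_mats_def mat_id_def mat_adj_def fun_eq_iff)
  then show ?thesis using mat_id_left[of "mat_id n" n] by (simp add: so_group_def)
qed

lemma so_group_mult:
  assumes "P \<in> so_group n" "Q \<in> so_group n"
  shows "mat_mult n P Q \<in> so_group n"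
proof -
  have box: "P \<in> box_mats n" "Q \<in> box_mats n" "mat_adj P \<in> box_mats n" "mat_adj Q \<in> box_mats n"
    using assms box_mats_adj by (auto simp: so_group_def)
  have "mat_mult n (mat_mult n (mat_adj Q) (mat_adj P)) (mat_mult n P Q)
      = mat_mult n (mat_adj Q) (mat_mult n (mat_mult n (mat_adj P) P) Q)"
    by (simp add: mat_mult_assoc)
  moreover have "mat_mult n (mat_mult n P Q) (mat_mult n (mat_adj Q) (mat_adj P))
      = mat_mult n P (mat_mult n (mat_mult n Q (mat_adj Q)) (mat_adj P))"
    by (simp add: mat_mult_assoc)
  ultimately show ?thesis
    using assms box by (simp add: so_group_def mat_adj_mult mat_id_left box_mats_mult)
qed

definition mat_conj :: "nat \<Rightarrow> cmat \<Rightarrow> cmat \<Rightarrow> cmat" where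
  "mat_conj n P M = mat_mult n (mat_adj P) (mat_mult n M P)"

lemma mat_conj_mult: "mat_conj n (mat_mult n P Q) M = mat_conj n Q (mat_conj n P M)"
  by (simp add: mat_conj_def mat_adj_mult mat_mult_assoc)

lemma mat_conj_so:
  assumes "P \<in> box_mats n" "M \<in> so_mat n"
  shows "mat_conj n P M \<in> so_mat n"
  using assms unfolding so_mat_adj mat_conj_def mat_adj_mult
  by (simp add: box_mats_mult box_mats_adj mat_mult_minus_left mat_mult_minus_right mat_mult_assoc)

lemma mat_conj_product:
  assumes "P \<in> so_group n" "M \<in> box_mats n" "N \<in> box_mats n"
  shows "mat_mult n (mat_conj n P M) (mat_conj n P N) = mat_mult n (mat_adj P) (mat_mult n (mat_mult n M N) P)"
proof -
  have "mat_mult n (mat_conj n P M) (mat_conj n P N) =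
     mat_mult n (mat_adj P) (mat_mult n M (mat_mult n (mat_mult n P (mat_adj P)) (mat_mult n N P)))"
    by (simp add: mat_conj_def mat_mult_assoc)
  also have "mat_mult n (mat_mult n P (mat_adj P)) (mat_mult n N P) = mat_mult n N P"
    using assms by (simp add: so_group_def mat_id_left box_mats_mult)
  finally show ?thesis by (simp add: mat_mult_assoc)
qed

lemma mat_conj_bracket:
  assumes "P \<in> so_group n" "M \<in> so_mat n" "N \<in> so_mat n"
  shows "mat_conj n P (mat_bracket n M N) = mat_bracket n (mat_conj n P M) (mat_conj n P N)"
  unfolding mat_bracket_def mat_conj_product[OF assms(1) so_mat_box[OF assms(2)] so_mat_box[OF assms(3)]]
    mat_conj_product[OF assms(1) so_mat_box[OF assms(3)] so_mat_box[OF assms(2)]]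
  by (simp add: mat_conj_def mat_mult_diff_left mat_mult_diff_right)

lemma mat_conj_add: "mat_conj n P (M + N) = mat_conj n P M + mat_conj n P N"
  and mat_conj_scale: "mat_conj n P (mat_scale c M) = mat_scale c (mat_conj n P M)"
  by (simp_all add: mat_conj_def mat_mult_add_left mat_mult_add_right mat_mult_scale_left mat_mult_scale_right)

lemma mat_conj_inverse:
  assumes "P \<in> so_group n" "M \<in> box_mats n"
  shows "mat_conj n (mat_adj P) (mat_conj n P M) = M" "mat_conj n P (mat_conj n (mat_adj P) M) = M"
proof -
  have "mat_conj n (mat_mult n P (mat_adj P)) M = M" "mat_conj n (mat_mult n (mat_adj P) P) M = M"
  proof -
    have "mat_adj (mat_id n) = mat_id n" by (auto simp: mat_id_def mat_adj_def fun_eq_iff)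
    then have "mat_conj n (mat_id n) M = M"
      using assms by (simp add: mat_conj_def mat_id_left mat_id_right)
    then show "mat_conj n (mat_mult n P (mat_adj P)) M = M" "mat_conj n (mat_mult n (mat_adj P) P) M = M"
      using assms by (simp_all add: so_group_def)
  qed
  then show "mat_conj n (mat_adj P) (mat_conj n P M) = M" "mat_conj n P (mat_conj n (mat_adj P) M) = M"
    by (simp_all add: mat_conj_mult)
qed

lemma mat_id_vec: "v \<in> box_vecs n \<Longrightarrow> mat_vec n (mat_id n) v = v"
proof
  fix i assume v: "v \<in> box_vecs n"
  have "mat_vec n (mat_id n) v i = (\<Sum>k\<in>box n. if k = i then v i else 0)"
    unfolding mat_vec_def by (rule sum.cong) (auto simp: mat_id_def)
  then show "mat_vec n (mat_id n) v i = v i" using v by (simp add: box_vecs_def)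
qed

lemma mat_vec_unit: "a \<in> box n \<Longrightarrow> mat_vec n M (unit_vec a) i = M i a"
proof -
  assume a: "a \<in> box n"
  have "mat_vec n M (unit_vec a) i = (\<Sum>k\<in>box n. if k = a then M i a else 0)"
    unfolding mat_vec_def by (rule sum.cong) (auto simp: unit_vec_def)
  then show ?thesis using a by simp
qed

(* The reflection in a - b exchanges the isotropic vectors a and b. *)
lemma isotropic_reflection:
  assumes a: "a \<in> box_vecs n" "form n a a = 0" and b: "b \<in> box_vecs n" "form n b b = 0"
    and ab: "form n a b \<noteq> 0"
  shows "\<exists>R\<in>so_group n. mat_vec n R a = b"
proof -
  define w where "w = a - b"
  define q where "q = form n w w"
  have w: "w \<in> box_vecs n" unfolding w_def using a b by (intro vec.subspace_diff[OF box_vecs_subspace])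
  have q: "q = - 2 * form n a b"
    using a b form_commute[of n b a] by (simp add: q_def w_def form_diff_left form_diff_right)
  define W where "W = (\<lambda>i j. (2 / q) * w i * w (- j))"
  define R where "R = mat_id n - W"
  have Wbox: "W \<in> box_mats n" using w by (auto simp: W_def box_mats_def box_vecs_def)
  have idbox: "mat_id n \<in> box_mats n" using mat_id_group by (simp add: so_group_def)
  have Rbox: "R \<in> box_mats n" using Wbox idbox by (auto simp: R_def box_mats_def)
  have adj: "mat_adj R = R" by (auto simp: R_def W_def mat_id_def mat_adj_def fun_eq_iff)
  have WW: "mat_mult n W W = W + W"
  proof (intro ext)
    fix i j
    have "mat_mult n W W i j = (\<Sum>k\<in>box n. ((2 / q) * (2 / q) * w i * w (- j)) * (w k * w (- k)))"
      unfolding mat_mult_def W_def by (intro sum.cong) (auto simp: algebra_simps)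
    also have "\<dots> = (2 / q) * (2 / q) * w i * w (- j) * q"
      unfolding sum_distrib_left[symmetric] by (simp add: q_def form_def)
    also have "\<dots> = (W + W) i j" using q ab by (simp add: W_def field_simps)
    finally show "mat_mult n W W i j = (W + W) i j" .
  qed
  have "mat_mult n R R = mat_id n"
    unfolding R_def mat_mult_diff_left mat_mult_diff_right WW mat_id_left[OF Wbox] mat_id_right[OF Wbox] mat_id_left[OF idbox]
    by simp
  then have "R \<in> so_group n" using Rbox adj by (simp add: so_group_def)
  moreover have "mat_vec n R a = b"
  proof
    fix i
    have "mat_vec n W a i = (\<Sum>k\<in>box n. (2 / q) * w i * (a k * w (- k)))"
      unfolding mat_vec_def W_def by (intro sum.cong) (auto simp: algebra_simps)
    also have "\<dots> = (2 / q) * w i * form n a w"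
      by (simp add: form_def sum_distrib_left)
    also have "form n a w = - form n a b" using a by (simp add: w_def form_diff_right)
    also have "(2 / q) * w i * - form n a b = w i" using ab by (simp add: q)
    finally have "mat_vec n W a i = w i" .
    then show "mat_vec n R a i = b i"
      using mat_id_vec[OF a(1)] by (simp add: R_def mat_vec_diff w_def)
  qed
  ultimately show ?thesis by blast
qed

text \<open>One reflection suffices when u is not orthogonal to \<open>unit_vec (- int n)\<close>,
  that is, when u (int n) is nonzero. Otherwise two reflections are composed, through an isotropic z
  orthogonal to neither vector.\<close>

lemma isotropic_transitive:
  assumes n: "n \<ge> 1" and u: "u \<in> box_vecs n" "u \<noteq> 0" "form n u u = 0"
  shows "\<exists>P\<in>so_group n. mat_vec n P (unit_vec (- int n)) = u"
proof -
  let ?e = "unit_vec (- int n)"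
  have e: "?e \<in> box_vecs n" "form n ?e ?e = 0" using n by (auto simp: unit_vec_box form_unit) (simp add: unit_vec_def)
  show ?thesis
  proof (cases "u (int n) = 0")
    case False
    then have "form n ?e u \<noteq> 0" by (simp add: form_unit)
    then show ?thesis using isotropic_reflection[OF e u(1,3)] by blast
  next
    case True
    have "\<exists>z\<in>box_vecs n. form n z z = 0 \<and> form n ?e z \<noteq> 0 \<and> form n z u \<noteq> 0"
    proof (cases "u (- int n) = 0")
      case False
      show ?thesis
        by (rule bexI[of _ "unit_vec (int n)"]) (use n False in \<open>auto simp: form_unit unit_vec_box\<close>, auto simp: unit_vec_def)
    next
      case nz: True
      have "\<exists>k\<in>box n. k \<noteq> 0 \<and> u k \<noteq> 0"
      proof (rule ccontr)
        assume "\<not> ?thesis"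
        then have z: "u k = 0" if "k \<noteq> 0" for k using u(1) that by (cases "k \<in> box n") (auto simp: box_vecs_def)
        have "form n u u = (\<Sum>k\<in>box n. if k = 0 then u 0 * u 0 else 0)"
          unfolding form_def by (rule sum.cong) (auto simp: z)
        also have "\<dots> = u 0 * u 0" by simp
        finally have "u 0 = 0" using u(3) by simp
        then have "u = 0" using z by (metis (no_types) ext zero_fun_apply)
        with u(2) show False by simp
      qed
      then obtain k where k: "k \<in> box n" "k \<noteq> 0" "u k \<noteq> 0" by blast
      then have kn: "k \<noteq> int n" "k \<noteq> - int n" using True nz by auto
      have box: "- k \<in> box n" "int n \<in> box n" using k by auto
      \<comment> \<open>The first summand pairs with \<open>unit_vec (- int n)\<close>, the second
        contributes u k to the pairing with u, and k different from 0 and from both n and -n makes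
        the sum isotropic.\<close>
      let ?z = "unit_vec (int n) + unit_vec (- k)"
      have "?z \<in> box_vecs n" using box by (intro vec.subspace_add[OF box_vecs_subspace] unit_vec_box)
      moreover have "form n ?z ?z = 0"
        using n k kn by (simp add: form_add_left form_unit[OF box(1)] form_unit[OF box(2)], simp add: unit_vec_def)
      moreover have "form n ?e ?z \<noteq> 0" using k kn by (simp add: form_unit, simp add: unit_vec_def)
      moreover have "form n ?z u \<noteq> 0" using nz k by (simp add: form_add_left form_unit[OF box(1)] form_unit[OF box(2)])
      ultimately show ?thesis by blast
    qed
    then obtain z where z: "z \<in> box_vecs n" "form n z z = 0" "form n ?e z \<noteq> 0" "form n z u \<noteq> 0" by blast
    obtain P Q where "P \<in> so_group n" "mat_vec n P ?e = z" "Q \<in> so_group n" "mat_vec n Q z = u"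
      using isotropic_reflection[OF e z(1,2,3)] isotropic_reflection[OF z(1,2) u(1,3) z(4)] by blast
    then show ?thesis
      using so_group_mult[of Q n P] by (intro bexI[of _ "mat_mult n Q P"]) (simp_all add: mat_vec_mult)
  qed
qed

section \<open>Passage between n + 1 and n\<close>

lemma box_Suc: "box (Suc n) = insert (- int (Suc n)) (insert (int (Suc n)) (box n))"
  by auto

lemma sum_box_Suc: "(\<Sum>k\<in>box (Suc n). f k) = f (- int (Suc n)) + (f (int (Suc n)) + (\<Sum>k\<in>box n. f k))"
  unfolding box_Suc by (subst sum.insert, simp, simp, subst sum.insert) auto

text \<open>For a matrix that stabilises the isotropic line of
  \<open>unit_vec (- int (Suc n))\<close>, this is the induced action on the orthogonal complement
  of the line modulo the line.\<close>

definition middle :: "nat \<Rightarrow> cmat \<Rightarrow> cmat" where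
  "middle n M = (\<lambda>i j. if i \<in> box n \<and> j \<in> box n then M i j else 0)"

definition extend :: "nat \<Rightarrow> cmat \<Rightarrow> cmat" where
  "extend n P = (\<lambda>i j. if i \<in> box n \<and> j \<in> box n then P i j else if i = j \<and> \<bar>i\<bar> = int (Suc n) then 1 else 0)"

lemma middle_so: "M \<in> so_mat (Suc n) \<Longrightarrow> middle n M \<in> so_mat n"
  by (auto simp: middle_def so_mat_def)

lemma extend_adj: "mat_adj (extend n P) = extend n (mat_adj P)"
  by (auto simp: extend_def mat_adj_def fun_eq_iff)

lemma extend_outside:
  assumes "k \<in> box n" "i \<notin> box n"
  shows "extend n P i k = 0" "extend n P k i = 0"
proof -
  have *: "\<not> (i \<in> box n \<and> k \<in> box n)" "\<not> (i = k \<and> \<bar>i\<bar> = int (Suc n))"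
    "\<not> (k \<in> box n \<and> i \<in> box n)" "\<not> (k = i \<and> \<bar>k\<bar> = int (Suc n))"
    using assms by blast+
  show "extend n P i k = 0" unfolding extend_def if_not_P[OF *(1)] if_not_P[OF *(2)] ..
  show "extend n P k i = 0" unfolding extend_def if_not_P[OF *(3)] if_not_P[OF *(4)] ..
qed

lemma extend_mult: "mat_mult (Suc n) (extend n P) (extend n Q) = extend n (mat_mult n P Q)"
proof (intro ext)
  fix i j
  have mid: "(\<Sum>k\<in>box n. extend n P i k * extend n Q k j) = (if i \<in> box n \<and> j \<in> box n then mat_mult n P Q i j else 0)"
  proof (cases "i \<in> box n \<and> j \<in> box n")
    case True
    then show ?thesis by (auto simp: extend_def mat_mult_def intro!: sum.cong)
  next
    case False
    have "extend n P i k * extend n Q k j = 0" if "k \<in> box n" for k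
      using False extend_outside[OF that, of i] extend_outside[OF that, of j] by auto
    then show ?thesis unfolding if_not_P[OF False] by (intro sum.neutral ballI)
  qed
  have ends: "extend n P i (- int (Suc n)) * extend n Q (- int (Suc n)) j = (if i = - int (Suc n) \<and> j = - int (Suc n) then 1 else 0)"
    "extend n P i (int (Suc n)) * extend n Q (int (Suc n)) j = (if i = int (Suc n) \<and> j = int (Suc n) then 1 else 0)"
    by (auto simp: extend_def)
  show "mat_mult (Suc n) (extend n P) (extend n Q) i j = extend n (mat_mult n P Q) i j"
    unfolding mat_mult_def[of "Suc n"] sum_box_Suc mid ends
  proof (cases "i \<in> box n \<and> j \<in> box n")
    case True
    then have *: "\<not> (i = - int (Suc n) \<and> j = - int (Suc n))" "\<not> (i = int (Suc n) \<and> j = int (Suc n))" by auto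
    show "(if i = - int (Suc n) \<and> j = - int (Suc n) then 1 else 0)
      + ((if i = int (Suc n) \<and> j = int (Suc n) then 1 else 0)
      + (if i \<in> box n \<and> j \<in> box n then mat_mult n P Q i j else 0)) = extend n (mat_mult n P Q) i j"
      unfolding extend_def if_P[OF True] if_not_P[OF *(1)] if_not_P[OF *(2)] by simp
  next
    case False
    have "(if i = - m \<and> j = - m then 1 else 0) + ((if i = m \<and> j = m then 1 else 0) + 0)
      = (if i = j \<and> \<bar>i\<bar> = m then 1 else (0::complex))" if "m > 0" for m :: int
      using that by (cases "i = m"; cases "i = - m") auto
    from this[of "int (Suc n)"]
    show "(if i = - int (Suc n) \<and> j = - int (Suc n) then 1 else 0)
      + ((if i = int (Suc n) \<and> j = int (Suc n) then 1 else 0)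
      + (if i \<in> box n \<and> j \<in> box n then mat_mult n P Q i j else 0)) = extend n (mat_mult n P Q) i j"
      unfolding extend_def if_not_P[OF False] by simp
  qed
qed

lemma extend_group: "P \<in> so_group n \<Longrightarrow> extend n P \<in> so_group (Suc n)"
proof -
  assume P: "P \<in> so_group n"
  have "extend n (mat_id n) = mat_id (Suc n)"
  proof (intro ext)
    fix i j
    have "i \<in> box (Suc n) \<longleftrightarrow> i \<in> box n \<or> \<bar>i\<bar> = int (Suc n)" by auto
    then show "extend n (mat_id n) i j = mat_id (Suc n) i j"
      unfolding extend_def mat_id_def by (cases "i = j"; cases "i \<in> box n") (simp_all only: if_True if_False simp_thms if_cancel)
  qed
  moreover have "extend n P \<in> box_mats (Suc n)" by (auto simp: extend_def box_mats_def)
  ultimately show ?thesis using P by (simp add: so_group_def extend_adj extend_mult)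
qed

text \<open>The first column vanishes off its corner, so by skewness the last row does too. The two
  outer indices therefore contribute nothing to the middle entries of a product.\<close>

lemma middle_bracket:
  assumes A: "A \<in> so_mat (Suc n)" "\<And>i. i \<noteq> - int (Suc n) \<Longrightarrow> A i (- int (Suc n)) = 0"
    and B: "B \<in> so_mat (Suc n)" "\<And>i. i \<noteq> - int (Suc n) \<Longrightarrow> B i (- int (Suc n)) = 0"
  shows "middle n (mat_bracket (Suc n) A B) = mat_bracket n (middle n A) (middle n B)"
proof -
  have mult: "middle n (mat_mult (Suc n) A B) = mat_mult n (middle n A) (middle n B)"
    if A: "A \<in> so_mat (Suc n)" "\<And>i. i \<noteq> - int (Suc n) \<Longrightarrow> A i (- int (Suc n)) = 0"
    and B: "B \<in> so_mat (Suc n)" "\<And>i. i \<noteq> - int (Suc n) \<Longrightarrow> B i (- int (Suc n)) = 0" for A B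
  proof (intro ext)
    fix i j
    show "middle n (mat_mult (Suc n) A B) i j = mat_mult n (middle n A) (middle n B) i j"
    proof (cases "i \<in> box n \<and> j \<in> box n")
      case True
      then have "A i (- int (Suc n)) = 0" by (intro A(2)) auto
      moreover have "B (int (Suc n)) j = 0"
        using so_mat_skew[OF B(1), of j "int (Suc n)"] B(2)[of "- j"] True by auto
      ultimately have "mat_mult (Suc n) A B i j = (\<Sum>k\<in>box n. A i k * B k j)"
        unfolding mat_mult_def sum_box_Suc by simp
      also have "\<dots> = mat_mult n (middle n A) (middle n B) i j"
        unfolding mat_mult_def by (rule sum.cong) (use True in \<open>auto simp: middle_def\<close>)
      finally show ?thesis using True by (simp add: middle_def)
    next
      case False
      then have z: "middle n A i k * middle n B k j = 0" for k unfolding middle_def by (simp only: mult_eq_0_iff) auto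
      have "mat_mult n (middle n A) (middle n B) i j = 0"
        unfolding mat_mult_def using z by (intro sum.neutral ballI)
      moreover have "middle n (mat_mult (Suc n) A B) i j = 0" by (simp only: middle_def if_not_P[OF False])
      ultimately show ?thesis by simp
    qed
  qed
  have "middle n (M - N) = middle n M - middle n N" for M N by (auto simp: middle_def fun_eq_iff)
  then show ?thesis unfolding mat_bracket_def using mult[OF A B] mult[OF B A] by simp
qed

text \<open>Conjugation by \<open>extend n P\<close> respects the block form of A: below the
  diagonal, the first column and the last row stay zero, and the middle block is conjugated by
  P.\<close>

lemma conj_extend_upper:
  assumes A: "A \<in> so_mat (Suc n)" "\<And>i. i \<noteq> - int (Suc n) \<Longrightarrow> A i (- int (Suc n)) = 0"
    and upper: "\<And>i j. i > j \<Longrightarrow> mat_conj n P (middle n A) i j = 0" and ij: "i > j"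
  shows "mat_conj (Suc n) (extend n P) A i j = 0"
proof -
  let ?N = "int (Suc n)" and ?Q = "extend n P" and ?R = "extend n (mat_adj P)"
  have row: "A ?N k = 0" if "k \<noteq> ?N" for k
    using so_mat_skew[OF A(1), of k ?N] A(2)[of "- k"] that by simp
  have conj: "mat_conj (Suc n) ?Q A i j = (\<Sum>l\<in>box (Suc n). ?R i l * (\<Sum>k\<in>box (Suc n). A l k * ?Q k j))"
    by (simp add: mat_conj_def extend_adj mat_mult_def)
  have so: "mat_conj (Suc n) ?Q A \<in> so_mat (Suc n)"
    by (rule mat_conj_so[OF _ A(1)]) (auto simp: extend_def box_mats_def)
  have "(i \<notin> box (Suc n) \<or> j \<notin> box (Suc n)) \<or> i = ?N \<or> j = - ?N \<or> (i \<in> box n \<and> j \<in> box n)"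
    unfolding atLeastAtMost_iff of_nat_Suc using ij by linarith
  then consider "i \<notin> box (Suc n) \<or> j \<notin> box (Suc n)" | "i = ?N" | "j = - ?N" | "i \<in> box n" "j \<in> box n"
    by blast
  then show ?thesis
  proof cases
    case 1 then show ?thesis using so_mat_support[OF so] by blast
  next
    case 2
    have "?R i l * (\<Sum>k\<in>box (Suc n). A l k * ?Q k j) = 0" for l
    proof (cases "l = ?N")
      case True
      have "A l k * ?Q k j = 0" for k
      proof (cases "k = ?N")
        case True
        then show ?thesis using 2 ij by (auto simp: extend_def)
      qed (use row \<open>l = ?N\<close> in simp)
      then have "(\<Sum>k\<in>box (Suc n). A l k * ?Q k j) = 0" by (intro sum.neutral ballI)
      then show ?thesis by simp
    next
      case False
      then show ?thesis using 2 by (auto simp: extend_def)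
    qed
    then show ?thesis unfolding conj by (intro sum.neutral ballI)
  next
    case 3
    have "?R i l * (\<Sum>k\<in>box (Suc n). A l k * ?Q k j) = 0" for l
    proof (cases "l = - ?N")
      case True
      then have "?R i l = 0" using 3 ij by (auto simp: extend_def)
      then show ?thesis by simp
    next
      case False
      have "A l k * ?Q k j = 0" for k
      proof (cases "k = - ?N")
        case True
        then show ?thesis using A(2)[OF False] by simp
      next
        case False
        then have "?Q k j = 0" using 3 by (auto simp: extend_def)
        then show ?thesis by simp
      qed
      then have "(\<Sum>k\<in>box (Suc n). A l k * ?Q k j) = 0" by (intro sum.neutral ballI)
      then show ?thesis by simp
    qed
    then show ?thesis unfolding conj by (intro sum.neutral ballI)
  next
    case 4
    have "?Q k j = 0" if "k \<notin> box n" for k P using extend_outside(1)[OF 4(2) that] .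
    have R: "extend n P i (- ?N) = 0" "extend n P i ?N = 0" "extend n P (- ?N) j = 0" "extend n P ?N j = 0" for P
      using extend_outside(2)[OF 4(1)] extend_outside(1)[OF 4(2)] by auto
    have "mat_conj (Suc n) ?Q A i j = (\<Sum>l\<in>box n. ?R i l * (\<Sum>k\<in>box n. A l k * ?Q k j))"
      unfolding conj sum_box_Suc R by simp
    also have "\<dots> = mat_conj n P (middle n A) i j"
      unfolding mat_conj_def mat_mult_def using 4
      by (intro sum.cong refl arg_cong2[where f="(*)"]) (auto simp: extend_def middle_def)
    finally show ?thesis using upper[OF ij] by simp
  qed
qed

context complex_lie_algebra
begin

text \<open>An isotropic common eigenvector is moved to \<open>unit_vec (- int (Suc n))\<close>,
  which clears the first column below its corner; the induction hypothesis then treats the middle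
  block, and \<open>extend\<close> leaves the two outer coordinates alone.\<close>

theorem so_rep_triangular:
  "solvable S \<Longrightarrow> so_rep n S \<phi> \<Longrightarrow> \<exists>P\<in>so_group n. \<forall>x\<in>S. \<forall>i j. i > j \<longrightarrow> mat_conj n P (\<phi> x) i j = 0"
proof (induction n arbitrary: \<phi>)
  case 0
  have "\<phi> x \<in> so_mat 0" if "x \<in> S" for x using 0 that by (simp add: so_rep_def)
  then have "mat_conj 0 (mat_id 0) (\<phi> x) \<in> so_mat 0" if "x \<in> S" for x
    using mat_conj_so that mat_id_group by (auto simp: so_group_def)
  then show ?case using so_mat_support mat_id_group by (intro bexI[of _ "mat_id 0"]) fastforce+
next
  case (Suc n)
  let ?N = "int (Suc n)" and ?e = "unit_vec (- int (Suc n))"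
  have so: "\<phi> x \<in> so_mat (Suc n)" if "x \<in> S" for x using Suc.prems that by (simp add: so_rep_def)
  obtain u where u: "u \<in> box_vecs (Suc n)" "u \<noteq> 0" "form (Suc n) u u = 0"
    "\<forall>x\<in>S. \<exists>c. mat_vec (Suc n) (\<phi> x) u = vec_scale c u"
    using isotropic_eigenvector[OF Suc.prems(2,1)] by auto
  obtain P where P: "P \<in> so_group (Suc n)" "mat_vec (Suc n) P ?e = u"
    using isotropic_transitive[OF _ u(1,2,3)] by auto
  have Pbox: "P \<in> box_mats (Suc n)" using P by (simp add: so_group_def)
  define A where "A = (\<lambda>x. mat_conj (Suc n) P (\<phi> x))"
  have Aso: "A x \<in> so_mat (Suc n)" if "x \<in> S" for x
    unfolding A_def using mat_conj_so[OF Pbox so[OF that]] .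
  have ebox: "- ?N \<in> box (Suc n)" by simp
  have Acol: "A x i (- ?N) = 0" if x: "x \<in> S" and i: "i \<noteq> - ?N" for x i
  proof -
    obtain c where c: "mat_vec (Suc n) (\<phi> x) u = vec_scale c u" using u(4) x by blast
    have "mat_vec (Suc n) (mat_adj P) u = ?e"
      using P mat_id_vec[OF unit_vec_box[OF ebox]] by (simp add: so_group_def flip: mat_vec_mult P(2))
    then have "mat_vec (Suc n) (A x) ?e = vec_scale c ?e"
      using c P(2) by (simp add: A_def mat_conj_def mat_vec_mult vec.linop_scale[OF mat_vec_linop])
    then have "A x i (- ?N) = vec_scale c ?e i" using mat_vec_unit[OF ebox, of "A x" i] by simp
    then show ?thesis using i by (simp add: unit_vec_def)
  qed
  have "so_rep n S (\<lambda>x. middle n (A x))"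
    unfolding so_rep_def
  proof (intro conjI ballI allI)
    show "lie_subalgebra S" using Suc.prems by (simp add: so_rep_def)
    fix x assume x: "x \<in> S"
    show "middle n (A x) \<in> so_mat n" using middle_so[OF Aso[OF x]] .
    show "middle n (A (c *s x)) = mat_scale c (middle n (A x))" for c
      using Suc.prems(2) x by (simp add: so_rep_def A_def mat_conj_scale) (auto simp: middle_def fun_eq_iff)
    fix y assume y: "y \<in> S"
    show "middle n (A (x + y)) = middle n (A x) + middle n (A y)"
      using Suc.prems(2) x y by (simp add: so_rep_def A_def mat_conj_add) (auto simp: middle_def fun_eq_iff)
    have "A (bracket x y) = mat_bracket (Suc n) (A x) (A y)"
      using Suc.prems(2) x y mat_conj_bracket[OF P(1) so[OF x] so[OF y]] by (simp add: so_rep_def A_def)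
    then show "middle n (A (bracket x y)) = mat_bracket n (middle n (A x)) (middle n (A y))"
      using middle_bracket[OF Aso[OF x] Acol[OF x] Aso[OF y] Acol[OF y]] by simp
  qed
  then obtain Q where Q: "Q \<in> so_group n" "\<forall>x\<in>S. \<forall>i j. i > j \<longrightarrow> mat_conj n Q (middle n (A x)) i j = 0"
    using Suc.IH[OF Suc.prems(1)] by blast
  have "mat_conj (Suc n) (extend n Q) (A x) i j = 0" if "x \<in> S" "i > j" for x i j
    by (rule conj_extend_upper[OF Aso[OF that(1)] Acol[OF that(1)] _ that(2)]) (use Q(2) that(1) in auto)
  then have "mat_conj (Suc n) (mat_mult (Suc n) P (extend n Q)) (\<phi> x) i j = 0" if "x \<in> S" "i > j" for x i j
    using that unfolding mat_conj_mult A_def by blast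
  then show ?case using so_group_mult[OF P(1) extend_group[OF Q(1)]] by blast
qed

end

section \<open>Counting\<close>

(* d r is the number of roots of the ideal in row -r of the upper triangle of so(2n+1). *)
definition ideal_shape :: "nat \<Rightarrow> (nat \<Rightarrow> nat) \<Rightarrow> bool" where
  "ideal_shape n d \<longleftrightarrow> (\<forall>r. r \<notin> {1..n} \<longrightarrow> d r = 0) \<and> (\<forall>r\<in>{1..n}. d r \<le> 2 * r - 1) \<and>
     (\<forall>r. 1 \<le> r \<and> r < n \<and> d r > 0 \<longrightarrow> d r < d (Suc r))"

lemma finite_ideal_shape: "finite {d. ideal_shape n d}"
proof (rule finite_subset)
  show "{d. ideal_shape n d} \<subseteq> {f. \<forall>x. (x \<in> {1..n} \<longrightarrow> f x \<in> {..2 * n}) \<and> (x \<notin> {1..n} \<longrightarrow> f x = 0)}"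
  proof safe
    fix d x assume "ideal_shape n d"
    then have d: "\<And>r. r \<in> {1..n} \<Longrightarrow> d r \<le> 2 * r - 1" "\<And>r. r \<notin> {1..n} \<Longrightarrow> d r = 0"
      by (auto simp: ideal_shape_def)
    show "d x \<le> 2 * n" if "x \<in> {1..n}" using d(1)[OF that] that by auto
    show "d x = 0" if "x \<notin> {1..n}" using d(2)[OF that] .
  qed
  show "finite {f. \<forall>x. (x \<in> {1..n} \<longrightarrow> f x \<in> {..2 * n}) \<and> (x \<notin> {1..n} \<longrightarrow> f x = (0::nat))}"
    by (rule finite_set_of_finite_funs) auto
qed

lemma ideal_shape_mono:
  assumes "ideal_shape n d" "1 \<le> r" "d r > 0" "r \<le> r'"
  shows "r' \<le> n \<Longrightarrow> d r + (r' - r) \<le> d r'"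
  using assms(4)
proof (induction r' rule: dec_induct)
  case (step m)
  then have "d m > 0" using assms(3) by linarith
  then have "d m < d (Suc m)" using assms(1,2) step by (simp add: ideal_shape_def)
  then show ?case using step by linarith
qed simp

lemma ideal_shape_zero: "ideal_shape n d \<Longrightarrow> d n = 0 \<Longrightarrow> d = (\<lambda>_. 0)"
proof
  fix r assume d: "ideal_shape n d" "d n = 0"
  show "d r = 0"
  proof (cases "r \<in> {1..n}")
    case True
    then show ?thesis using ideal_shape_mono[OF d(1), of r n] d(2) by auto
  qed (use d in \<open>simp add: ideal_shape_def\<close>)
qed

lemma ideal_shape_Suc_iff:
  assumes "d (Suc n) = m"
  shows "ideal_shape (Suc n) d \<longleftrightarrow>
    ideal_shape n (d(Suc n := 0)) \<and> m \<le> 2 * n + 1 \<and> (d n > 0 \<and> n \<ge> 1 \<longrightarrow> d n < m)"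
proof
  assume s: "ideal_shape (Suc n) d"
  have "m \<le> 2 * n + 1" using s assms unfolding ideal_shape_def by (elim conjE) (drule bspec[of _ _ "Suc n"], auto)
  moreover have "d n < m" if "d n > 0" "n \<ge> 1" using s that assms by (auto simp: ideal_shape_def)
  moreover have "ideal_shape n (d(Suc n := 0))"
    using s unfolding ideal_shape_def by (auto simp: le_Suc_eq)
  ultimately show "ideal_shape n (d(Suc n := 0)) \<and> m \<le> 2 * n + 1 \<and> (d n > 0 \<and> n \<ge> 1 \<longrightarrow> d n < m)" by blast
next
  assume a: "ideal_shape n (d(Suc n := 0)) \<and> m \<le> 2 * n + 1 \<and> (d n > 0 \<and> n \<ge> 1 \<longrightarrow> d n < m)"
  then have s: "\<And>r. r \<notin> {1..n} \<Longrightarrow> (d(Suc n := 0)) r = 0" "\<And>r. r \<in> {1..n} \<Longrightarrow> (d(Suc n := 0)) r \<le> 2 * r - 1"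
     "\<And>r. 1 \<le> r \<Longrightarrow> r < n \<Longrightarrow> (d(Suc n := 0)) r > 0 \<Longrightarrow> (d(Suc n := 0)) r < (d(Suc n := 0)) (Suc r)"
    by (auto simp: ideal_shape_def)
  show "ideal_shape (Suc n) d"
    unfolding ideal_shape_def
  proof (intro conjI allI ballI impI)
    fix r
    show "d r = 0" if "r \<notin> {1..Suc n}" using s(1)[of r] that by (cases "r = Suc n") auto
    show "d r \<le> 2 * r - 1" if "r \<in> {1..Suc n}"
      using s(2)[of r] that a assms by (cases "r = Suc n") auto
    show "d r < d (Suc r)" if "1 \<le> r \<and> r < Suc n \<and> 0 < d r"
    proof (cases "r = n")
      case True then show ?thesis using a assms that by auto
    next
      case False then show ?thesis using s(3)[of r] that by auto
    qed
  qed
qed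

text \<open>A bound on the last entry, instead of its exact value, is the refinement for which the
  count obeys a two-term recursion.\<close>

definition shapes_below :: "nat \<Rightarrow> nat \<Rightarrow> (nat \<Rightarrow> nat) set" where
  "shapes_below n e = {d. ideal_shape n d \<and> d n \<le> e}"

lemma finite_shapes_below: "finite (shapes_below n e)"
  by (rule finite_subset[OF _ finite_ideal_shape[of n]]) (auto simp: shapes_below_def)

lemma ideal_shape_const_zero: "ideal_shape n (\<lambda>_. 0)"
  by (simp add: ideal_shape_def)

lemma shapes_below_0: "shapes_below n 0 = {\<lambda>_. 0}"
  using ideal_shape_zero ideal_shape_const_zero by (auto simp: shapes_below_def)

text \<open>A shape whose last entry is exactly e + 1 is an arbitrary shape of length n with last
  entry at most e, extended by one entry. The hypothesis on e makes e + 1 admissible, the bound in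
  row n + 1 being 2n + 1.\<close>

lemma shapes_below_Suc:
  assumes "e \<le> 2 * n"
  shows "card (shapes_below (Suc n) (Suc e)) = card (shapes_below (Suc n) e) + card (shapes_below n e)"
proof -
  let ?A = "{d. ideal_shape (Suc n) d \<and> d (Suc n) = Suc e}"
  have "bij_betw (\<lambda>d. d(Suc n := 0)) ?A (shapes_below n e)"
  proof (rule bij_betw_byWitness[where f'="\<lambda>d. d(Suc n := Suc e)"])
    show "(\<lambda>d. d(Suc n := 0)) ` ?A \<subseteq> shapes_below n e"
    proof (rule image_subsetI)
      fix d assume d: "d \<in> ?A"
      then have "ideal_shape n (d(Suc n := 0)) \<and> (d n > 0 \<and> n \<ge> 1 \<longrightarrow> d n < Suc e)"
        using ideal_shape_Suc_iff[of d n "Suc e"] by simp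
      moreover have "n = 0 \<Longrightarrow> d n = 0" using d by (simp add: ideal_shape_def)
      ultimately show "d(Suc n := 0) \<in> shapes_below n e"
        by (cases "n = 0") (auto simp: shapes_below_def)
    qed
    show "(\<lambda>d. d(Suc n := Suc e)) ` shapes_below n e \<subseteq> ?A"
    proof (rule image_subsetI)
      fix d assume "d \<in> shapes_below n e"
      then have d: "ideal_shape n d" "d n \<le> e" "d (Suc n) = 0" by (auto simp: shapes_below_def ideal_shape_def)
      then have "(d(Suc n := Suc e))(Suc n := 0) = d" by (auto simp: fun_eq_iff)
      then show "d(Suc n := Suc e) \<in> ?A"
        using ideal_shape_Suc_iff[of "d(Suc n := Suc e)" n "Suc e"] d assms by auto
    qed
    show "\<forall>d\<in>?A. (d(Suc n := 0))(Suc n := Suc e) = d" by (auto simp: fun_eq_iff)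
    show "\<forall>d\<in>shapes_below n e. (d(Suc n := Suc e))(Suc n := 0) = d"
      by (auto simp: fun_eq_iff shapes_below_def ideal_shape_def)
  qed
  then have "card ?A = card (shapes_below n e)" by (rule bij_betw_same_card)
  moreover have "shapes_below (Suc n) (Suc e) = shapes_below (Suc n) e \<union> ?A"
    by (auto simp: shapes_below_def le_Suc_eq)
  moreover have "finite ?A" by (rule finite_subset[OF _ finite_ideal_shape[of "Suc n"]]) auto
  moreover have "shapes_below (Suc n) e \<inter> ?A = {}" by (auto simp: shapes_below_def)
  ultimately show ?thesis using finite_shapes_below by (simp add: card_Un_disjoint)
qed

text \<open>Pascal's rule, summed over a window symmetric about the middle of row e of Pascal's
  triangle. The case split is due to truncated subtraction: for e at most n the window starts at
  0.\<close>

lemma central_binomial_sum_Suc: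
  fixes n e :: nat
  assumes "e \<le> 2 * n"
  shows "(\<Sum>k=Suc e - Suc n..Suc n. Suc e choose k) = (\<Sum>k=e - Suc n..Suc n. e choose k) + (\<Sum>k=e - n..n. e choose k)"
proof (cases "e - n")
  case 0
  have "(\<Sum>k=0..Suc n. Suc e choose k) = (\<Sum>k=0..Suc n. e choose k) + (\<Sum>k=0..n. e choose k)"
    by (simp add: sum.atLeast0_atMost_Suc_shift sum.distrib del: sum.cl_ivl_Suc)
  then show ?thesis using 0 by simp
next
  case (Suc a)
  then have True: "a \<le> n" using assms by simp
  show ?thesis
  proof -
    have "(\<Sum>k=Suc a..Suc n. Suc e choose k) = (\<Sum>k=a..n. Suc e choose Suc k)"
      by (rule sum.shift_bounds_cl_Suc_ivl)
    also have "\<dots> = (\<Sum>k=a..n. e choose k) + (\<Sum>k=Suc a..Suc n. e choose k)"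
      by (simp add: sum.distrib sum.shift_bounds_cl_Suc_ivl[symmetric] del: sum.cl_ivl_Suc)
    also have "(\<Sum>k=a..n. e choose k) = (e choose a) + (\<Sum>k=Suc a..n. e choose k)"
      using True by (simp add: sum.atLeast_Suc_atMost)
    \<comment> \<open>The boundary term e choose a passes from one sum to the other, which gives
      both windows their required ends.\<close>
    also have "\<dots> + (\<Sum>k=Suc a..Suc n. e choose k) = (\<Sum>k=a..Suc n. e choose k) + (\<Sum>k=Suc a..n. e choose k)"
      using True by (simp add: sum.atLeast_Suc_atMost[of a "Suc n"] del: sum.cl_ivl_Suc)
    finally have *: "(\<Sum>k=Suc a..Suc n. Suc e choose k) = (\<Sum>k=a..Suc n. e choose k) + (\<Sum>k=Suc a..n. e choose k)" .
    have "Suc e - Suc n = Suc a" "e - Suc n = a" "e - n = Suc a" using Suc by auto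
    with * show ?thesis by simp
  qed
qed

lemma card_shapes_below: "e \<le> 2 * n \<Longrightarrow> card (shapes_below n e) = (\<Sum>k=e - n..n. e choose k)"
proof (induction n arbitrary: e)
  case 0
  then show ?case by (simp add: shapes_below_0)
next
  case (Suc n)
  from Suc.prems show ?case
  proof (induction e)
    case 0
    have "(\<Sum>k=0 - Suc n..Suc n. 0 choose k) = (\<Sum>k=0..Suc n. if k = 0 then 1 else 0)"
      by (intro sum.cong) auto
    then show ?case by (simp add: shapes_below_0)
  next
    case (Suc e)
    show ?case
    proof (cases "e \<le> 2 * n")
      case True
      then show ?thesis
        using Suc central_binomial_sum_Suc[OF True] \<open>\<And>e. e \<le> 2 * n \<Longrightarrow> card (shapes_below n e) = (\<Sum>k=e - n..n. e choose k)\<close>[of e]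
        by (simp add: shapes_below_Suc del: sum.cl_ivl_Suc binomial_Suc_Suc)
    next
      case False
      then have e: "e = 2 * n + 1" using Suc by simp
      \<comment> \<open>For e + 1 = 2 (n + 1) the bound on the last entry already holds for every
        shape, so the set does not grow. The two central coefficients of row 2n + 1 add up to the
        single central coefficient of row 2n + 2.\<close>
      have bound: "d (Suc n) \<le> e" if "ideal_shape (Suc n) d" for d
        using that ideal_shape_Suc_iff[of d n "d (Suc n)"] e by simp
      have "shapes_below (Suc n) (Suc e) = shapes_below (Suc n) e"
        unfolding shapes_below_def using bound le_SucI by blast
      then have "card (shapes_below (Suc n) (Suc e)) = (\<Sum>k=n..Suc n. (2 * n + 1) choose k)"
        using Suc by (simp add: e)
      also have "\<dots> = Suc (2 * n + 1) choose Suc n" by (simp only: binomial_Suc_Suc) simp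
      also have "\<dots> = (\<Sum>k=Suc e - Suc n..Suc n. Suc e choose k)"
        by (simp only: e) (simp del: binomial_Suc_Suc)
      finally show ?thesis .
    qed
  qed
qed

lemma card_ideal_shape: "card {d. ideal_shape n d} = (2 * n) choose n"
proof -
  have "d n \<le> 2 * n" if "ideal_shape n d" for d
    using that by (cases "n = 0") (auto simp: ideal_shape_def dest: bspec[of _ _ n])
  then have "{d. ideal_shape n d} = shapes_below n (2 * n)" by (auto simp: shapes_below_def)
  then show ?thesis using card_shapes_below[of "2 * n" n] by simp
qed

section \<open>Ballot words\<close>

definition ballot_words :: "nat \<Rightarrow> nat \<Rightarrow> letter list set" where
  "ballot_words m k = {w. length w = m \<and> count_list w Fall = k \<and>
     (\<forall>p. prefix p w \<longrightarrow> count_list p Fall \<le> count_list p Rise)}"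

lemma count_letters: "count_list w Fall + count_list w Rise = length w"
proof (induction w)
  case (Cons a w) then show ?case by (cases a) auto
qed simp

lemma finite_ballot_words: "finite (ballot_words m k)"
proof (rule finite_subset)
  have UNIV: "(UNIV :: letter set) = {Rise, Fall}" using letter.exhaust by blast
  show "finite {w :: letter list. set w \<subseteq> UNIV \<and> length w = m}"
    by (rule finite_lists_length_eq) (simp add: UNIV)
qed (auto simp: ballot_words_def)

lemma ballot_words_empty: "2 * k > m \<Longrightarrow> ballot_words m k = {}"
proof -
  assume "2 * k > m"
  have False if "w \<in> ballot_words m k" for w
  proof -
    have "k \<le> count_list w Rise" "length w = m" "count_list w Fall = k"
      using that by (auto simp: ballot_words_def dest: spec[of _ w])
    then show False using count_letters[of w] \<open>2 * k > m\<close> by simp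
  qed
  then show ?thesis by blast
qed

lemma ballot_words_Suc:
  assumes "2 * k \<le> Suc m"
  shows "ballot_words (Suc m) k = (\<lambda>w. w @ [Rise]) ` ballot_words m k \<union>
    (if k = 0 then {} else (\<lambda>w. w @ [Fall]) ` ballot_words m (k - 1))"
proof (intro set_eqI iffI)
  fix w assume w: "w \<in> ballot_words (Suc m) k"
  then obtain v x where v: "w = v @ [x]" by (cases w rule: rev_cases) (auto simp: ballot_words_def)
  have "\<forall>p. prefix p v \<longrightarrow> count_list p Fall \<le> count_list p Rise"
    using w v by (auto simp: ballot_words_def)
  then show "w \<in> (\<lambda>w. w @ [Rise]) ` ballot_words m k \<union> (if k = 0 then {} else (\<lambda>w. w @ [Fall]) ` ballot_words m (k - 1))"
    using w v by (cases x) (auto simp: ballot_words_def)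
next
  fix w assume "w \<in> (\<lambda>w. w @ [Rise]) ` ballot_words m k \<union> (if k = 0 then {} else (\<lambda>w. w @ [Fall]) ` ballot_words m (k - 1))"
  then obtain v x where v: "w = v @ [x]" "x = Rise \<and> v \<in> ballot_words m k \<or> x = Fall \<and> k \<noteq> 0 \<and> v \<in> ballot_words m (k - 1)"
    by (auto split: if_splits)
  then have l: "length w = Suc m" "count_list w Fall = k" by (auto simp: ballot_words_def)
  then have "count_list w Fall \<le> count_list w Rise" using count_letters[of w] assms by linarith
  moreover have "\<forall>p. prefix p v \<longrightarrow> count_list p Fall \<le> count_list p Rise" using v by (auto simp: ballot_words_def)
  ultimately have "\<forall>p. prefix p w \<longrightarrow> count_list p Fall \<le> count_list p Rise" using v(1) by auto
  then show "w \<in> ballot_words (Suc m) k" using l by (simp add: ballot_words_def)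
qed

text \<open>The ballot numbers, written additively to avoid truncated subtraction and proved by
  deleting the last letter. The range includes 2k = m + 1, where there are no words and the two
  binomial coefficients agree; the recursion reaches this boundary.\<close>

lemma card_ballot_words:
  "2 * k \<le> Suc m \<Longrightarrow> card (ballot_words m k) + (if k = 0 then 0 else m choose (k - 1)) = m choose k"
proof (induction m arbitrary: k)
  case 0
  then have "k = 0" by simp
  moreover have "ballot_words 0 0 = {[]}" by (auto simp: ballot_words_def)
  ultimately show ?case by simp
next
  case (Suc m)
  show ?case
  proof (cases "2 * k = Suc (Suc m)")
    case True
    then obtain j where j: "k = Suc j" by (cases k) auto
    then have "Suc m choose j = Suc m choose k" using True by (subst binomial_symmetric) auto
    then show ?thesis using ballot_words_empty[of "Suc m" k] True j by simp
  next
    case False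
    then have k: "2 * k \<le> Suc m" using Suc.prems by simp
    have inj: "inj_on (\<lambda>w. w @ [x]) A" for x :: letter and A by (auto simp: inj_on_def)
    show ?thesis
    proof (cases k)
      case 0
      then show ?thesis using Suc.IH[of 0] ballot_words_Suc[OF k] by (simp add: card_image[OF inj])
    next
      case (Suc j)
      have "card (ballot_words (Suc m) k) = card (ballot_words m k) + card (ballot_words m j)"
        unfolding ballot_words_Suc[OF k] using Suc
        by (simp, subst card_Un_disjoint) (auto simp: finite_ballot_words card_image[OF inj])
      then show ?thesis using Suc.IH[OF k] Suc.IH[of j] k Suc by (cases j) auto
    qed
  qed
qed

text \<open>A path may end at any height, so the ballot numbers are summed over the number of falls,
  and the sum telescopes.\<close>

lemma card_B_paths: "card {w. B_path n w} = (2 * n) choose n"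
proof -
  have count: "count_list w Fall \<le> n" if "B_path n w" for w
    using that count_letters[of w] by (auto simp: B_path_def dest: spec[of _ w])
  have "{w. B_path n w} = (\<Union>k\<in>{..n}. ballot_words (2 * n) k)"
    using count by (auto simp: B_path_def ballot_words_def)
  then have "card {w. B_path n w} = (\<Sum>k\<le>n. card (ballot_words (2 * n) k))"
    by (simp, subst card_UN_disjoint) (auto simp: finite_ballot_words, auto simp: ballot_words_def)
  moreover have "j \<le> n \<Longrightarrow> (\<Sum>k\<le>j. card (ballot_words (2 * n) k)) = (2 * n) choose j" for j
  proof (induction j)
    case 0 then show ?case using card_ballot_words[of 0 "2 * n"] by simp
  next
    case (Suc j) then show ?case using card_ballot_words[of "Suc j" "2 * n"] by simp
  qed
  ultimately show ?thesis by simp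
qed

section \<open>Ideals of the upper triangular Borel subalgebra\<close>

context so_isomorphism
begin

lemma psi_0: "\<psi> 0 = 0"
  using psi_scale[of 0 0] by (simp add: fun_eq_iff)

lemma psi_so: "\<psi> x \<in> so_mat n"
  using psi_range by blast

lemma psi_surj: "M \<in> so_mat n \<Longrightarrow> \<exists>x. \<psi> x = M"
  using psi_range by (metis imageE)

lemma psi_uminus: "\<psi> (- x) = - \<psi> x"
  using psi_scale[of "-1" x] by (simp add: fun_eq_iff)

lemma psi_diff: "\<psi> (x - y) = \<psi> x - \<psi> y"
  using psi_add[of x "- y"] psi_uminus by simp

lemma psi_eq_iff: "\<psi> x = \<psi> y \<longleftrightarrow> x = y"
  using psi_diff[of x y] psi_inj[of "x - y"] by auto

text \<open>The filtration by superdiagonals: \<open>band 0\<close> is the upper triangular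
  subalgebra, \<open>band 1\<close> its strictly upper triangular part. Degrees add under brackets,
  which yields solvability as well as ad-nilpotency.\<close>

definition band :: "nat \<Rightarrow> 'a set" where
  "band k = {x. \<forall>i j. j < i + int k \<longrightarrow> \<psi> x i j = 0}"

lemma band_subspace: "subspace (band k)"
  by (auto simp: subspace_def band_def psi_0 psi_add psi_scale)

lemma band_bracket:
  assumes "x \<in> band k" "y \<in> band l"
  shows "bracket x y \<in> band (k + l)"
proof -
  have "\<psi> x i m * \<psi> y m j = 0" "\<psi> y i m * \<psi> x m j = 0" if "j < i + int (k + l)" for i j m
  proof -
    have "m < i + int k \<or> j < m + int l" "m < i + int l \<or> j < m + int k" using that by auto
    then show "\<psi> x i m * \<psi> y m j = 0" "\<psi> y i m * \<psi> x m j = 0" using assms by (auto simp: band_def)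
  qed
  then have "mat_bracket n (\<psi> x) (\<psi> y) i j = 0" if "j < i + int (k + l)" for i j
  proof -
    have "mat_mult n (\<psi> x) (\<psi> y) i j = 0" "mat_mult n (\<psi> y) (\<psi> x) i j = 0"
      unfolding mat_mult_def using that \<open>\<And>i j m. j < i + int (k + l) \<Longrightarrow> \<psi> x i m * \<psi> y m j = 0\<close>
        \<open>\<And>i j m. j < i + int (k + l) \<Longrightarrow> \<psi> y i m * \<psi> x m j = 0\<close> by (intro sum.neutral ballI; blast)+
    then show ?thesis by (simp add: mat_bracket_def)
  qed
  then show ?thesis by (simp add: band_def psi_bracket del: of_nat_add)
qed

lemma diagonal_product:
  assumes "x \<in> band 0" "y \<in> band 0"
  shows "mat_mult n (\<psi> x) (\<psi> y) i i = \<psi> x i i * \<psi> y i i"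
proof (cases "i \<in> box n")
  case True
  have "mat_mult n (\<psi> x) (\<psi> y) i i = (\<Sum>k\<in>box n. if k = i then \<psi> x i i * \<psi> y i i else 0)"
    unfolding mat_mult_def
  proof (rule sum.cong)
    fix k
    consider "k = i" | "k < i" | "i < k" by linarith
    then show "\<psi> x i k * \<psi> y k i = (if k = i then \<psi> x i i * \<psi> y i i else 0)"
      using assms by cases (auto simp: band_def)
  qed simp
  then show ?thesis using True by simp
next
  case False
  then have "\<psi> x i k = 0" for k using so_mat_support[OF psi_so] by blast
  then show ?thesis by (simp add: mat_mult_def)
qed

lemma band_bracket_0:
  assumes "x \<in> band 0" "y \<in> band 0"
  shows "bracket x y \<in> band 1"
proof -
  have "mat_bracket n (\<psi> x) (\<psi> y) i i = 0" for i
    using diagonal_product[OF assms, of i] diagonal_product[OF assms(2,1), of i] by (simp add: mat_bracket_def)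
  moreover have "mat_bracket n (\<psi> x) (\<psi> y) i j = 0" if "j < i" for i j
    using band_bracket[OF assms] that by (simp add: band_def psi_bracket)
  ultimately have "mat_bracket n (\<psi> x) (\<psi> y) i j = 0" if "j < i + 1" for i j
    using that by (cases "j = i") auto
  then show ?thesis by (simp add: band_def psi_bracket)
qed

lemma band_large: "band (2 * n + 1) = {0}"
proof -
  have "x = 0" if "x \<in> band (2 * n + 1)" for x
  proof -
    have "\<psi> x i j = 0" for i j
    proof (cases "i \<in> box n \<and> j \<in> box n")
      case True
      then have "j < i + int (2 * n + 1)" by auto
      then show ?thesis using that unfolding band_def by blast
    next
      case False
      then show ?thesis using so_mat_support[OF psi_so] by blast
    qed
    then have "\<psi> x = 0" by (intro ext) simp
    then show ?thesis by (rule psi_inj)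
  qed
  moreover have "0 \<in> band (2 * n + 1)" using subspace_0[OF band_subspace] .
  ultimately show ?thesis by blast
qed

lemma band_subalgebra: "lie_subalgebra (band 0)"
  using band_subspace band_bracket[of _ 0 _ 0] by (auto simp: lie_subalgebra_def)

text \<open>The step from \<open>band 0\<close> to \<open>band 1\<close> uses that diagonal parts
  commute. Afterwards the degree at least doubles, and growth by one per step is enough to pass
  2n.\<close>

lemma band_solvable: "solvable (band 0)"
proof -
  have "derived_series (band 0) k \<subseteq> band k" for k
  proof (induction k)
    case (Suc k)
    have "bracket_span (derived_series (band 0) k) (derived_series (band 0) k) \<subseteq> band (Suc k)"
    proof (rule bracket_span_subset[OF band_subspace])
      fix x y assume "x \<in> derived_series (band 0) k" "y \<in> derived_series (band 0) k"
      then have xy: "x \<in> band k" "y \<in> band k" using Suc by auto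
      show "bracket x y \<in> band (Suc k)"
      proof (cases k)
        case 0
        then show ?thesis using band_bracket_0 xy by (simp add: One_nat_def)
      next
        case (Suc m)
        then have "band (k + k) \<subseteq> band (Suc k)" by (auto simp: band_def)
        then show ?thesis using band_bracket[OF xy] by blast
      qed
    qed
    then show ?case by simp
  qed simp
  then have "derived_series (band 0) (2 * n + 1) \<subseteq> {0}" using band_large by metis
  moreover have "0 \<in> derived_series (band 0) (2 * n + 1)"
    unfolding Suc_eq_plus1[symmetric] by (simp add: bracket_span_def span_zero)
  ultimately show ?thesis unfolding solvable_def by blast
qed

lemma conj_so_isomorphism:
  assumes "P \<in> so_group n"
  shows "so_isomorphism scale bracket n (\<lambda>x. mat_conj n P (\<psi> x))"
proof unfold_locales
  have P: "P \<in> box_mats n" using assms by (simp add: so_group_def)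
  show "mat_conj n P (\<psi> (x + y)) = mat_conj n P (\<psi> x) + mat_conj n P (\<psi> y)" for x y
    by (simp add: psi_add mat_conj_add)
  show "mat_conj n P (\<psi> (c *s x)) = mat_scale c (mat_conj n P (\<psi> x))" for c x
    by (simp add: psi_scale mat_conj_scale)
  show "mat_conj n P (\<psi> (bracket x y)) = mat_bracket n (mat_conj n P (\<psi> x)) (mat_conj n P (\<psi> y))" for x y
    by (simp add: psi_bracket mat_conj_bracket[OF assms psi_so psi_so])
  show "x = 0" if "mat_conj n P (\<psi> x) = 0" for x
  proof -
    have "mat_conj n (mat_adj P) (mat_conj n P (\<psi> x)) = 0"
      unfolding that by (simp add: mat_conj_def mat_mult_def fun_eq_iff)
    then show ?thesis using mat_conj_inverse(1)[OF assms so_mat_box[OF psi_so]] psi_inj by simp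
  qed
  show "range (\<lambda>x. mat_conj n P (\<psi> x)) = so_mat n"
  proof
    show "range (\<lambda>x. mat_conj n P (\<psi> x)) \<subseteq> so_mat n" using mat_conj_so[OF P psi_so] by blast
    show "so_mat n \<subseteq> range (\<lambda>x. mat_conj n P (\<psi> x))"
    proof
      fix M assume M: "M \<in> so_mat n"
      then obtain x where "\<psi> x = mat_conj n (mat_adj P) M"
        using psi_surj mat_conj_so[OF box_mats_adj[OF P]] by metis
      then have "mat_conj n P (\<psi> x) = M" using mat_conj_inverse(2)[OF assms so_mat_box[OF M]] by simp
      then show "M \<in> range (\<lambda>x. mat_conj n P (\<psi> x))" by blast
    qed
  qed
qed

text \<open>A conjugate of b lies in the upper triangular subalgebra, which is itself solvable;
  maximality of b turns the inclusion into an equality.\<close>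

theorem borel_triangular:
  assumes "borel_subalgebra b"
  shows "\<exists>\<phi>. so_isomorphism scale bracket n \<phi> \<and> b = {x. \<forall>i j. j < i \<longrightarrow> \<phi> x i j = 0}"
proof -
  have b: "lie_subalgebra b" "solvable b" "\<And>S. lie_subalgebra S \<Longrightarrow> solvable S \<Longrightarrow> b \<subseteq> S \<Longrightarrow> S = b"
    using assms by (auto simp: borel_subalgebra_def)
  have "so_rep n b \<psi>" using b(1) by (simp add: so_rep_def psi_so psi_add psi_scale psi_bracket)
  then obtain P where P: "P \<in> so_group n" "\<forall>x\<in>b. \<forall>i j. i > j \<longrightarrow> mat_conj n P (\<psi> x) i j = 0"
    using so_rep_triangular[OF b(2)] by blast
  interpret C: so_isomorphism scale bracket n "\<lambda>x. mat_conj n P (\<psi> x)"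
    using conj_so_isomorphism[OF P(1)] .
  have "b \<subseteq> C.band 0" using P(2) by (auto simp: C.band_def)
  then have "C.band 0 = b" using b(3) C.band_subalgebra C.band_solvable by blast
  then show ?thesis using C.so_isomorphism_axioms by (intro exI[of _ "\<lambda>x. mat_conj n P (\<psi> x)"]) (auto simp: C.band_def)
qed

end

(* The positions (k, q) of the ideal of shape d; the second disjunct is the image of the first under (k, q) -> (-q, -k). *)
definition in_shape :: "(nat \<Rightarrow> nat) \<Rightarrow> int \<Rightarrow> int \<Rightarrow> bool" where
  "in_shape d k q \<longleftrightarrow> (k < 0 \<and> \<bar>q\<bar> < - k \<and> - k - int (d (nat (- k))) \<le> q)
     \<or> (0 < q \<and> \<bar>k\<bar> < q \<and> q - int (d (nat q)) \<le> - k)"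

lemma in_shape_less: "in_shape d k q \<Longrightarrow> k < q"
  by (auto simp: in_shape_def)

lemma in_shape_flip: "in_shape d (- q) (- k) \<longleftrightarrow> in_shape d k q"
  by (auto simp: in_shape_def)

text \<open>r - d_r is the first column of the ideal in row -r; the strict growth of d says that it
  does not move to the right in higher rows.\<close>

lemma ideal_shape_threshold:
  assumes "ideal_shape n d" "0 < r" "r \<le> r'" "r' \<le> int n" "d (nat r) > 0"
  shows "r' - int (d (nat r')) \<le> r - int (d (nat r))"
  using ideal_shape_mono[OF assms(1), of "nat r" "nat r'"] assms by (simp add: nat_le_iff) linarith

text \<open>The positions of a shape are closed under moving up and to the right, with the
  antidiagonal left out because skew matrices vanish there. A move across the antidiagonal lands on
  the flip of a position in row -q', where \<open>ideal_shape_threshold\<close> applies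
  again.\<close>

lemma in_shape_upward:
  assumes d: "ideal_shape n d" and kq: "in_shape d k q" and p: "p \<le> k" "q \<le> q'" "- int n \<le> p" "q' \<le> int n"
    and ne: "q' \<noteq> - p"
  shows "in_shape d p q'"
proof -
  have row: "in_shape d p q'" if k: "k < 0" "\<bar>q\<bar> < - k" "- k - int (d (nat (- k))) \<le> q"
    and p: "p \<le> k" "q \<le> q'" "- int n \<le> p" "q' \<le> int n" "q' \<noteq> - p" for k q p q'
  proof -
    have pos: "d (nat (- k)) > 0" using k by linarith
    show ?thesis
    proof (cases "q' < - p")
      case True
      have "- p - int (d (nat (- p))) \<le> - k - int (d (nat (- k)))"
        using ideal_shape_threshold[OF d, of "- k" "- p"] k p pos by simp
      then show ?thesis unfolding in_shape_def using True k p by auto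
    next
      case False
      then have q': "q' > - p" using p by simp
      have "q' - int (d (nat q')) \<le> - k - int (d (nat (- k)))"
        using ideal_shape_threshold[OF d, of "- k" q'] k p pos q' by simp
      then show ?thesis unfolding in_shape_def using q' k p by auto
    qed
  qed
  show ?thesis
  proof (cases "k < 0 \<and> \<bar>q\<bar> < - k \<and> - k - int (d (nat (- k))) \<le> q")
    case True
    then show ?thesis using row[of k q p q'] p ne by blast
  next
    case False
    then have q: "0 < q" "\<bar>k\<bar> < q" "q - int (d (nat q)) \<le> - k" using kq by (auto simp: in_shape_def)
    have "in_shape d (- q') (- p)"
      by (rule row[of "- q" "- k"]) (use q p ne in auto)
    then show ?thesis by (simp add: in_shape_flip)
  qed
qed

section \<open>Shapes and ad-nilpotent ideals\<close>

locale so_borel = so_isomorphism +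
  fixes b :: "'a set"
  assumes b_band: "b = band 0"
begin

definition shape_ideal :: "(nat \<Rightarrow> nat) \<Rightarrow> 'a set" where
  "shape_ideal d = {x. \<forall>k q. \<psi> x k q \<noteq> 0 \<longrightarrow> in_shape d k q}"

lemma shape_ideal_band: "x \<in> shape_ideal d \<Longrightarrow> x \<in> band 1"
  using in_shape_less[of d] by (force simp: shape_ideal_def band_def)

lemma band_mono: "k \<le> l \<Longrightarrow> band l \<subseteq> band k"
  by (auto simp: band_def)

lemma shape_ideal_subspace: "subspace (shape_ideal d)"
  by (auto simp: subspace_def shape_ideal_def psi_0 psi_add psi_scale) (metis add.right_neutral)

text \<open>A nonzero entry of [x, y] arises from an entry of y by a move up or to the right, x
  being upper triangular, so \<open>in_shape_upward\<close> gives the ideal property. Nilpotency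
  holds because the ideal lies in \<open>band 1\<close>.\<close>

lemma shape_ideal_ad_nilpotent:
  assumes d: "ideal_shape n d"
  shows "ad_nilpotent_ideal b (shape_ideal d)"
  unfolding ad_nilpotent_ideal_def lie_ideal_def
proof (intro conjI ballI)
  show "subspace (shape_ideal d)" by (rule shape_ideal_subspace)
  show "shape_ideal d \<subseteq> b" using shape_ideal_band band_mono[of 0 1] b_band by auto
  show "bracket x y \<in> shape_ideal d" if x: "x \<in> b" and y: "y \<in> shape_ideal d" for x y
    unfolding shape_ideal_def
  proof (intro CollectI allI impI)
    fix p q assume nz: "\<psi> (bracket x y) p q \<noteq> 0"
    have box: "p \<in> box n" "q \<in> box n" using nz so_mat_support[OF psi_so] by blast+
    have ne: "q \<noteq> - p" using nz so_mat_antidiagonal[OF psi_so] by auto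
    have "\<exists>k. \<psi> x p k * \<psi> y k q \<noteq> 0 \<or> \<psi> y p k * \<psi> x k q \<noteq> 0"
    proof (rule ccontr)
      assume "\<not> ?thesis"
      then have "mat_mult n (\<psi> x) (\<psi> y) p q = 0" "mat_mult n (\<psi> y) (\<psi> x) p q = 0"
        unfolding mat_mult_def by (intro sum.neutral ballI; blast)+
      then have "mat_bracket n (\<psi> x) (\<psi> y) p q = 0" by (simp add: mat_bracket_def)
      with nz show False by (simp add: psi_bracket)
    qed
    then obtain k where "(\<psi> x p k \<noteq> 0 \<and> \<psi> y k q \<noteq> 0) \<or> (\<psi> y p k \<noteq> 0 \<and> \<psi> x k q \<noteq> 0)" by auto
    moreover have "i \<le> j" if "\<psi> x i j \<noteq> 0" for i j
      by (rule ccontr) (use that x b_band in \<open>auto simp: band_def\<close>)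
    ultimately have "(p \<le> k \<and> in_shape d k q) \<or> (in_shape d p k \<and> k \<le> q)"
      using y by (auto simp: shape_ideal_def)
    then show "in_shape d p q" using in_shape_upward[OF d _ _ _ _ _ ne] box by fastforce
  qed
  show "\<exists>k. \<forall>y\<in>b. (bracket x ^^ k) y = 0" if x: "x \<in> shape_ideal d" for x
  proof (intro exI[of _ "2 * n + 1"] ballI)
    fix y assume y: "y \<in> b"
    have "(bracket x ^^ k) y \<in> band k" for k
    proof (induction k)
      case 0 then show ?case using y b_band by simp
    next
      case (Suc k) then show ?case using band_bracket[OF shape_ideal_band[OF x] Suc] by (simp add: plus_1_eq_Suc)
    qed
    from this[of "2 * n + 1"] show "(bracket x ^^ (2 * n + 1)) y = 0" unfolding band_large by simp
  qed
qed

lemma shape_ideal_inj_aux: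
  assumes "ideal_shape n d'" "shape_ideal d' \<subseteq> shape_ideal d"
  shows "d' r \<le> d r"
proof (rule ccontr)
  assume lt: "\<not> d' r \<le> d r"
  then have r: "r \<in> {1..n}" "d' r \<le> 2 * r - 1" using assms(1) by (auto simp: ideal_shape_def)
  \<comment> \<open>The leftmost position of row -r in the shape d'; it lies outside the shape d
    when d r is smaller.\<close>
  define q where "q = int r - int (d' r)"
  have q: "\<bar>q\<bar> < int r" using r lt by (auto simp: q_def)
  have box: "- int r \<in> box n" "q \<in> box n" using r q by auto
  obtain x where x: "\<psi> x = so_unit (- int r) q" using psi_surj[OF so_unit_mem[OF box]] by blast
  have in1: "in_shape d' (- int r) q" using q r by (simp add: in_shape_def q_def)
  have "x \<in> shape_ideal d'"
    unfolding shape_ideal_def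
  proof (intro CollectI allI impI)
    fix i j assume "\<psi> x i j \<noteq> 0"
    then have nz: "so_unit (- int r) q i j \<noteq> 0" by (simp add: x)
    have "(i = - int r \<and> j = q) \<or> (i = - q \<and> j = - (- int r))"
    proof (rule ccontr)
      assume "\<not> ?thesis"
      then have *: "\<not> (i = - int r \<and> j = q)" "\<not> (i = - q \<and> j = - (- int r))" by blast+
      show False using nz unfolding so_unit_def if_not_P[OF *(1)] if_not_P[OF *(2)] by simp
    qed
    then show "in_shape d' i j"
    proof (elim disjE conjE)
      assume "i = - int r" "j = q" then show ?thesis using in1 by simp
    next
      assume "i = - q" "j = - (- int r)" then show ?thesis using in1 by (simp only: in_shape_flip)
    qed
  qed
  then have "x \<in> shape_ideal d" using assms(2) by blast
  moreover have "\<psi> x (- int r) q \<noteq> 0"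
    using q unfolding x so_unit_def by auto
  ultimately have "in_shape d (- int r) q" by (simp add: shape_ideal_def)
  then show False using lt q by (auto simp: in_shape_def q_def)
qed

lemma shape_ideal_inj: "inj_on shape_ideal {d. ideal_shape n d}"
proof (rule inj_onI)
  fix d d' assume "d \<in> {d. ideal_shape n d}" "d' \<in> {d. ideal_shape n d}" "shape_ideal d = shape_ideal d'"
  then show "d = d'" using shape_ideal_inj_aux[of d d'] shape_ideal_inj_aux[of d' d] by (intro ext antisym) auto
qed

text \<open>On the simple root vector at (p, p + 1), each application of ad x multiplies this entry
  by the difference of two neighbouring diagonal entries of x. Nilpotency makes every such
  difference zero, and \<open>so_mat_diagonal_zero\<close> concludes.\<close>

lemma ad_nilpotent_diagonal:
  assumes I: "ad_nilpotent_ideal b I" and x: "x \<in> I"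
  shows "\<psi> x i i = 0"
proof -
  have xb: "x \<in> band 0" using assms b_band by (auto simp: ad_nilpotent_ideal_def lie_ideal_def)
  obtain m where m: "\<forall>y\<in>b. (bracket x ^^ m) y = 0" using assms unfolding ad_nilpotent_ideal_def by blast
  have step: "\<psi> x p p = \<psi> x (p + 1) (p + 1)" if p: "- int n \<le> p" "p < 0" for p
  proof -
    have box: "p \<in> box n" "p + 1 \<in> box n" using p by auto
    obtain y where y: "\<psi> y = so_unit p (p + 1)" using psi_surj[OF so_unit_mem[OF box]] by blast
    have "y \<in> band 1"
    proof -
      have "so_unit p (p + 1) i j = 0" if "j < i + 1" for i j
      proof -
        have *: "\<not> (i = p \<and> j = p + 1)" "\<not> (i = - (p + 1) \<and> j = - p)" using that by linarith+
        show ?thesis unfolding so_unit_def if_not_P[OF *(1)] if_not_P[OF *(2)] by simp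
      qed
      then show ?thesis by (simp add: band_def y)
    qed
    have "(bracket x ^^ k) y \<in> band 1 \<and>
       \<psi> ((bracket x ^^ k) y) p (p + 1) = (\<psi> x p p - \<psi> x (p + 1) (p + 1)) ^ k" for k
    proof (induction k)
      case 0
      have "\<not> (p = - (p + 1))" by presburger
      then show ?case using \<open>y \<in> band 1\<close> by (simp add: y so_unit_def)
    next
      case (Suc k)
      let ?z = "(bracket x ^^ k) y"
      have z: "?z \<in> band 1" "\<psi> ?z p (p + 1) = (\<psi> x p p - \<psi> x (p + 1) (p + 1)) ^ k" using Suc by auto
      have "mat_mult n (\<psi> x) (\<psi> ?z) p (p + 1) = (\<Sum>l\<in>box n. if l = p then \<psi> x p p * \<psi> ?z p (p + 1) else 0)"
        unfolding mat_mult_def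
      proof (rule sum.cong)
        fix l
        consider "l = p" | "l < p" | "p < l" by linarith
        then show "\<psi> x p l * \<psi> ?z l (p + 1) = (if l = p then \<psi> x p p * \<psi> ?z p (p + 1) else 0)"
          using xb z(1) by cases (auto simp: band_def)
      qed simp
      moreover have "mat_mult n (\<psi> ?z) (\<psi> x) p (p + 1) = (\<Sum>l\<in>box n. if l = p + 1 then \<psi> ?z p (p + 1) * \<psi> x (p + 1) (p + 1) else 0)"
        unfolding mat_mult_def
      proof (rule sum.cong)
        fix l
        consider "l = p + 1" | "l < p + 1" | "p + 1 < l" by linarith
        then show "\<psi> ?z p l * \<psi> x l (p + 1) = (if l = p + 1 then \<psi> ?z p (p + 1) * \<psi> x (p + 1) (p + 1) else 0)"
          using xb z(1) by cases (auto simp: band_def)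
      qed simp
      ultimately have "\<psi> (bracket x ?z) p (p + 1) = (\<psi> x p p - \<psi> x (p + 1) (p + 1)) * \<psi> ?z p (p + 1)"
        using box by (simp add: psi_bracket mat_bracket_def algebra_simps)
      then show ?case using z band_bracket[OF xb z(1)] by simp
    qed
    then have "(\<psi> x p p - \<psi> x (p + 1) (p + 1)) ^ m = \<psi> ((bracket x ^^ m) y) p (p + 1)" by simp
    also have "\<dots> = 0" using m \<open>y \<in> band 1\<close> band_mono[of 0 1] b_band by (auto simp: psi_0)
    finally show ?thesis by simp
  qed
  show ?thesis using so_mat_diagonal_zero[OF psi_so step] .
qed

lemma upward_interval:
  fixes Q :: "int set"
  assumes "Q \<subseteq> {l..<r}" "\<And>q. q \<in> Q \<Longrightarrow> q + 1 < r \<Longrightarrow> q + 1 \<in> Q"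
  shows "Q = {r - int (card Q)..<r}"
proof (cases "Q = {}")
  case False
  have fin: "finite Q" using assms(1) finite_subset by blast
  define m where "m = Min Q"
  have m: "m \<in> Q" "\<And>q. q \<in> Q \<Longrightarrow> m \<le> q" using fin False by (auto simp: m_def)
  have "q < r \<longrightarrow> q \<in> Q" if "m \<le> q" for q
    using that by (induction q rule: int_ge_induct) (use m assms(2) in auto)
  then have Q: "Q = {m..<r}" using m assms(1) by auto
  moreover have "m < r" using m assms(1) by auto
  ultimately show ?thesis by simp
qed simp

text \<open>The image U of the ideal is stable under the diagonal matrix of ternary weights, and its
  diagonals vanish, so it is spanned by the root vectors it contains. Brackets with simple root
  vectors show that these form final segments of the rows, of lengths given by a shape.\<close>

lemma ad_nilpotent_shape:
  assumes I: "ad_nilpotent_ideal b I"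
  shows "\<exists>d. ideal_shape n d \<and> I = shape_ideal d"
proof -
  have I': "subspace I" "I \<subseteq> band 0" "\<And>x y. x \<in> band 0 \<Longrightarrow> y \<in> I \<Longrightarrow> bracket x y \<in> I"
    using I b_band by (auto simp: ad_nilpotent_ideal_def lie_ideal_def)
  interpret M: complex_lie_algebra mat_scale "mat_bracket n" by (rule mat_lie_algebra)
  define U where "U = \<psi> ` I"
  have mem: "x \<in> I \<longleftrightarrow> \<psi> x \<in> U" for x using psi_eq_iff by (auto simp: U_def)
  have U: "M.subspace U"
    unfolding M.subspace_def
  proof (intro conjI ballI allI)
    show "0 \<in> U" using mem[of 0] subspace_0[OF I'(1)] by (simp add: psi_0)
    show "X + Y \<in> U" if "X \<in> U" "Y \<in> U" for X Y
      using that subspace_add[OF I'(1)] psi_add by (auto simp: U_def) (metis image_eqI)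
    show "mat_scale c X \<in> U" if "X \<in> U" for c X
      using that subspace_scale[OF I'(1)] psi_scale by (auto simp: U_def) (metis image_eqI)
  qed
  have stable: "mat_bracket n T X \<in> U" if T: "T \<in> so_mat n" "\<And>i j. j < i \<Longrightarrow> T i j = 0" "X \<in> U" for T X
  proof -
    obtain t where "\<psi> t = T" using psi_surj[OF T(1)] by blast
    moreover obtain x where "x \<in> I" "\<psi> x = X" using T(3) by (auto simp: U_def)
    moreover have "t \<in> band 0" using T \<open>\<psi> t = T\<close> by (simp add: band_def)
    ultimately have "bracket t x \<in> I" "\<psi> (bracket t x) = mat_bracket n T X" using I'(3) by (auto simp: psi_bracket)
    then show ?thesis using mem by metis
  qed
  have E: "mat_bracket n (so_unit q (q + 1)) X \<in> U" if "q \<in> box n" "q + 1 \<in> box n" "X \<in> U" for q X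
  proof (rule stable[OF so_unit_mem[OF that(1,2)] _ that(3)])
    fix i j :: int assume "j < i"
    then have *: "\<not> (i = q \<and> j = q + 1)" "\<not> (i = - (q + 1) \<and> j = - q)" by linarith+
    show "so_unit q (q + 1) i j = 0" unfolding so_unit_def if_not_P[OF *(1)] if_not_P[OF *(2)] by simp
  qed
  \<comment> \<open>The columns of row -r that belong to the ideal. The clause r \<le> n makes
    \<open>d r\<close> zero beyond n, and for r = 0 the set is empty anyway.\<close>
  define Q where "Q = (\<lambda>r. {q. \<bar>q\<bar> < int r \<and> r \<le> n \<and> so_unit (- int r) q \<in> U})"
  define d where "d = (\<lambda>r. card (Q r))"
  have Qsub: "Q r \<subseteq> {- int r + 1..<int r}" for r by (auto simp: Q_def)
  have Qfin: "finite (Q r)" for r using finite_subset[OF Qsub] by simp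
  have right: "q + 1 \<in> Q r" if "q \<in> Q r" "q + 1 < int r" for q r
  proof -
    have q: "\<bar>q\<bar> < int r" "r \<le> n" "so_unit (- int r) q \<in> U" using that by (auto simp: Q_def)
    have box: "q \<in> box n" "q + 1 \<in> box n" "- int r \<in> box n" using q that by auto
    have "q + 1 \<noteq> - int r" "q + 1 \<noteq> - q" "q \<noteq> - (- int r)" using q(1) by presburger+
    then have c: "(q + 1 = - int r) = False" "(q + 1 = - q) = False" "(q = - (- int r)) = False" "(q = q) = True" by blast+
    have "mat_bracket n (so_unit q (q + 1)) (so_unit (- int r) q) = - so_unit (- int r) (q + 1)"
      unfolding so_unit_commutator[OF box(1,2,3,1)] c by simp
    then have "- so_unit (- int r) (q + 1) \<in> U" using E[OF box(1,2) q(3)] by simp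
    then have "so_unit (- int r) (q + 1) \<in> U" using M.subspace_neg[OF U] by fastforce
    then show ?thesis using q that by (auto simp: Q_def)
  qed
  have down: "q \<in> Q (Suc r)" if "q \<in> Q r" "r < n" for q r
  proof -
    have q: "\<bar>q\<bar> < int r" "r \<le> n" "so_unit (- int r) q \<in> U" using that by (auto simp: Q_def)
    let ?p = "- int r - 1"
    have box: "?p \<in> box n" "?p + 1 \<in> box n" "- int r \<in> box n" "q \<in> box n" using q that by auto
    have c: "(?p = q) = False" "(- int r = - q) = False" "(?p = - (- int r)) = False"
      using q by auto
    have "mat_bracket n (so_unit ?p (?p + 1)) (so_unit (- int r) q) = so_unit ?p q"
      unfolding so_unit_commutator[OF box] using c by simp
    then have "so_unit ?p q \<in> U" using E[OF box(1,2) q(3)] by simp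
    moreover have "?p = - int (Suc r)" by simp
    ultimately have "so_unit (- int (Suc r)) q \<in> U" by (simp only:)
    then show ?thesis using q that by (auto simp: Q_def)
  qed
  have Q: "Q r = {int r - int (d r)..<int r}" for r
    unfolding d_def by (rule upward_interval[OF Qsub right])
  have shape: "ideal_shape n d"
    unfolding ideal_shape_def
  proof (intro conjI allI ballI impI)
    fix r
    show "d r = 0" if "r \<notin> {1..n}"
    proof -
      have "Q r = {}" using that by (auto simp: Q_def)
      then show ?thesis by (simp add: d_def)
    qed
    show "d r \<le> 2 * r - 1" if "r \<in> {1..n}"
      using card_mono[OF _ Qsub[of r]] by (simp add: d_def)
    show "d r < d (Suc r)" if "1 \<le> r \<and> r < n \<and> 0 < d r"
    proof -
      \<comment> \<open>A nonempty row contains its last column r - 1. This column passes to the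
        next row, where one more step to the right reaches column r, a column that row -r does not
        have; hence the strict growth.\<close>
      have "int r - 1 \<in> Q r" unfolding Q using that by simp
      then have "int r - 1 \<in> Q (Suc r)" using down that by blast
      then have "int r \<in> Q (Suc r)" using right[of "int r - 1" "Suc r"] by simp
      then have "insert (int r) (Q r) \<subseteq> Q (Suc r)" using down that by blast
      moreover have "int r \<notin> Q r" by (simp add: Q_def)
      ultimately show ?thesis using card_mono[OF Qfin, of "insert (int r) (Q r)" "Suc r"] Qfin[of r] by (simp add: d_def)
    qed
  qed
  have T: "so_diag n (\<lambda>i. of_int (ternary i)) \<in> so_mat n" by (rule so_diag_mem) (simp add: ternary_odd)
  have Tstable: "mat_bracket n (so_diag n (\<lambda>i. of_int (ternary i))) X \<in> U" if "X \<in> U" for X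
    by (rule stable[OF T _ that]) (simp add: so_diag_def)
  have "x \<in> shape_ideal d" if x: "x \<in> I" for x
    unfolding shape_ideal_def
  proof (intro CollectI allI impI)
    fix k q assume nz: "\<psi> x k q \<noteq> 0"
    have box: "k \<in> box n" "q \<in> box n" using nz so_mat_support[OF psi_so] by blast+
    have ne: "q \<noteq> - k" "k \<noteq> q" using nz so_mat_antidiagonal[OF psi_so] ad_nilpotent_diagonal[OF I x] by auto
    have "\<not> q < k" using nz I'(2) x by (auto simp: band_def)
    then have kq: "k < q" using ne by simp
    have unit: "so_unit i j \<in> U" if "(i, j) \<in> so_roots n" "\<psi> x i j \<noteq> 0" for i j
      using so_mat_components(2)[OF U Tstable psi_so _ that] mem x by blast
    show "in_shape d k q"
    proof (cases "\<bar>q\<bar> < \<bar>k\<bar>")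
      case True
      then have "so_unit k q \<in> U" using unit[OF _ nz] box by (auto simp: so_roots_def)
      moreover have k: "k < 0" using True kq by auto
      ultimately have "q \<in> Q (nat (- k))" using True box by (auto simp: Q_def)
      then show ?thesis using True k unfolding Q in_shape_def by auto
    next
      case False
      then have lt: "\<bar>k\<bar> < \<bar>q\<bar>" "0 < q" using ne kq by auto
      have "\<psi> x (- q) (- k) \<noteq> 0" using nz so_mat_skew[OF psi_so, of x q k] by simp
      then have "so_unit (- q) (- k) \<in> U" using unit[of "- q" "- k"] lt box by (auto simp: so_roots_def)
      then have "- k \<in> Q (nat q)" using lt box by (auto simp: Q_def)
      then show ?thesis using lt unfolding Q in_shape_def by auto
    qed
  qed
  moreover have "x \<in> I" if x: "x \<in> shape_ideal d" for x
  proof -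
    have "\<psi> x i i = 0" for i using x in_shape_less[of d i i] by (auto simp: shape_ideal_def)
    then have "so_diag n (\<lambda>i. \<psi> x i i) = 0" by (simp add: so_diag_def fun_eq_iff)
    then have "\<psi> x = (\<Sum>(p,q)\<in>so_roots n. mat_scale (\<psi> x p q) (so_unit p q))"
      using so_mat_decomposition[OF psi_so, of x] by simp
    also have "\<dots> \<in> U"
    proof (rule M.subspace_sum[OF U])
      fix z assume z: "z \<in> so_roots n"
      obtain p q where pq: "z = (p, q)" by force
      have "mat_scale (\<psi> x p q) (so_unit p q) \<in> U"
      proof (cases "\<psi> x p q = 0")
        case True
        then show ?thesis using M.subspace_0[OF U] by simp
      next
        case False
        then have "in_shape d p q" using x by (simp add: shape_ideal_def)
        then have p: "p < 0" "- p - int (d (nat (- p))) \<le> q" "\<bar>q\<bar> < - p"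
          using z pq by (auto simp: so_roots_def in_shape_def)
        then have "q \<in> Q (nat (- p))" unfolding Q by auto
        then have "so_unit p q \<in> U" using p by (simp add: Q_def)
        then show ?thesis using M.subspace_scale[OF U] by blast
      qed
      then show "(case z of (p, q) \<Rightarrow> mat_scale (\<psi> x p q) (so_unit p q)) \<in> U" by (simp add: pq)
    qed
    finally show ?thesis using mem by simp
  qed
  ultimately show ?thesis using shape by blast
qed

theorem card_ad_nilpotent_ideals: "card {I. ad_nilpotent_ideal b I} = (2 * n) choose n"
proof -
  have "{I. ad_nilpotent_ideal b I} = shape_ideal ` {d. ideal_shape n d}"
    using shape_ideal_ad_nilpotent ad_nilpotent_shape by blast
  then show ?thesis using card_image[OF shape_ideal_inj] card_ideal_shape by simp
qed

end

theorem corollary4: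
  fixes n :: nat
  assumes "n \<ge> 2"
  shows "card {w. B_path n w} = (2 * n) choose n \<and>
    (\<forall>(scale :: complex \<Rightarrow> 'g::ab_group_add \<Rightarrow> 'g) bracket b.
       complex_lie_algebra scale bracket \<and>
       complex_lie_algebra.simple_lie_algebra scale bracket \<and>
       complex_lie_algebra.type_B scale bracket n \<and>
       complex_lie_algebra.borel_subalgebra scale bracket b \<longrightarrow>
       card {I. complex_lie_algebra.ad_nilpotent_ideal scale bracket b I} = (2 * n) choose n)"
proof (intro conjI allI impI; (elim conjE)?)
  show "card {w. B_path n w} = (2 * n) choose n" by (rule card_B_paths)
next
  fix scale :: "complex \<Rightarrow> 'g \<Rightarrow> 'g" and bracket b
  assume L: "complex_lie_algebra scale bracket"
    "complex_lie_algebra.simple_lie_algebra scale bracket"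
    "complex_lie_algebra.type_B scale bracket n"
    "complex_lie_algebra.borel_subalgebra scale bracket b"
  interpret complex_lie_algebra scale bracket by fact
  obtain \<psi> where "so_isomorphism scale bracket n \<psi>"
    using type_B_so_isomorphism[OF L(2,3)] assms by auto
  then interpret A: so_isomorphism scale bracket n \<psi> .
  obtain \<phi> where \<phi>: "so_isomorphism scale bracket n \<phi>" "b = {x. \<forall>i j. j < i \<longrightarrow> \<phi> x i j = 0}"
    using A.borel_triangular[OF L(4)] by blast
  interpret B: so_isomorphism scale bracket n \<phi> by fact
  have "b = B.band 0" unfolding \<phi>(2) B.band_def by simp
  then interpret so_borel scale bracket n \<phi> b by unfold_locales
  show "card {I. ad_nilpotent_ideal b I} = (2 * n) choose n" by (rule card_ad_nilpotent_ideals)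
qed

end
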